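(* Let $\varepsilon>0$ and $k\geq 0$ be real numbers and $\ell\in\mathbb{N}$. Then, for all $X\geq 2$, as $K$ ranges over all quadratic number fields with $D_K\leq X$, $$\sum_{K}\#\mathrm{Cl}_K[\ell]^k \ll_{\ell,k,\varepsilon} X^{\frac{k}{2}+1-\min\left\{1,\ \frac{k}{\ell+2}\right\}+\varepsilon}.$$
   Context: For a number field $K$, $D_K$ denotes the absolute value of its discriminant, $\mathrm{Cl}_K$ its ideal class group, and $\mathrm{Cl}_K[\ell]=\{[\mathfrak{a}]\in \mathrm{Cl}_K : [\mathfrak{a}]^\ell=[\mathcal{O}_K]\}$ its $\ell$-torsion subgroup. Number fields are taken inside a fixed algebraic closure $\overline{\mathbb{Q}}$. The notation $f\ll_{a} g$ means $|f|\leq C|g|$ on the common domain for a constant $C>0$ depending only on $a$. *)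

theory Defs
  imports
    Complex_Main
    "HOL-Computational_Algebra.Polynomial"
    "HOL-Algebra.Coset"
    "HOL-Algebra.Algebraic_Closure_Type"
    "Jordan_Normal_Form.Determinant"
begin

text \<open>
  Number fields are subfields of \<^typ>\<open>complex\<close> of finite degree over the rationals.
  All of these lie in the algebraic closure of the rationals inside the complex numbers,
  so this amounts to working inside a fixed algebraic closure; fields are counted as
  subsets, not up to isomorphism.
\<close>

definition rat_scale :: "rat \<Rightarrow> complex \<Rightarrow> complex" where
  "rat_scale q z = of_rat q * z"

definition int_scale :: "int \<Rightarrow> complex \<Rightarrow> complex" where
  "int_scale n z = of_int n * z"

global_interpretation rat_vs: vector_space rat_scale
  by unfold_locales (simp_all add: rat_scale_def algebra_simps of_rat_add of_rat_mult)

global_interpretation int_mod: Modules.module int_scale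
  by unfold_locales (simp_all add: int_scale_def algebra_simps)

definition number_field :: "complex set \<Rightarrow> bool" where
  "number_field K \<longleftrightarrow>
     subfield K (ring_of_type_algebra :: complex ring) \<and>
     (\<exists>B. finite B \<and> rat_vs.span B = K)"

definition quadratic_field :: "complex set \<Rightarrow> bool" where
  "quadratic_field K \<longleftrightarrow> number_field K \<and> rat_vs.dim K = 2"

definition ring_of_integers :: "complex set \<Rightarrow> complex set" where
  "ring_of_integers K = {x \<in> K. algebraic_int x}"


text \<open>
  The trace of \<open>x\<close> is the trace of the matrix of multiplication by \<open>x\<close> with respect to a
  rational basis of \<open>K\<close>; it does not depend on the chosen basis.
\<close>

definition field_trace :: "complex set \<Rightarrow> complex \<Rightarrow> rat" where
  "field_trace K x =
     (let B = (SOME B. rat_vs.independent B \<and> rat_vs.span B = K)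
      in \<Sum>b\<in>B. rat_vs.representation B (x * b) b)"

definition integral_basis :: "complex set \<Rightarrow> complex list \<Rightarrow> bool" where
  "integral_basis K ws \<longleftrightarrow>
     distinct ws \<and> int_mod.independent (set ws) \<and>
     int_mod.span (set ws) = ring_of_integers K"

text \<open>The discriminant does not depend on the chosen integral basis either.\<close>

definition discriminant :: "complex set \<Rightarrow> rat" where
  "discriminant K =
     (let ws = (SOME ws. integral_basis K ws); n = length ws
      in det (mat n n (\<lambda>(i, j). field_trace K (ws ! i * ws ! j))))"

definition abs_disc :: "complex set \<Rightarrow> real" where
  "abs_disc K = \<bar>of_rat (discriminant K)\<bar>"


definition fractional_ideal :: "complex set \<Rightarrow> complex set \<Rightarrow> bool" where
  "fractional_ideal K I \<longleftrightarrow>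
     I \<subseteq> K \<and> 0 \<in> I \<and> I \<noteq> {0} \<and>
     (\<forall>a\<in>I. \<forall>b\<in>I. a + b \<in> I) \<and>
     (\<forall>r\<in>ring_of_integers K. \<forall>a\<in>I. r * a \<in> I) \<and>
     (\<exists>d\<in>ring_of_integers K. d \<noteq> 0 \<and> (\<forall>a\<in>I. d * a \<in> ring_of_integers K))"

text \<open>The product of two fractional ideals consists of all finite sums of products.\<close>

definition fractional_ideal_group :: "complex set \<Rightarrow> complex set monoid" where
  "fractional_ideal_group K =
     \<lparr>carrier = {I. fractional_ideal K I},
      monoid.mult = (\<lambda>I J. int_mod.span {a * b | a b. a \<in> I \<and> b \<in> J}),
      monoid.one = ring_of_integers K\<rparr>"

definition principal_ideals :: "complex set \<Rightarrow> complex set set" where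
  "principal_ideals K = {(\<lambda>r. x * r) ` ring_of_integers K | x. x \<in> K \<and> x \<noteq> 0}"

definition class_group :: "complex set \<Rightarrow> complex set set monoid" where
  "class_group K = fractional_ideal_group K Mod principal_ideals K"

definition class_group_torsion :: "complex set \<Rightarrow> nat \<Rightarrow> complex set set set" where
  "class_group_torsion K l =
     {c \<in> carrier (class_group K). c [^]\<^bsub>class_group K\<^esub> l = \<one>\<^bsub>class_group K\<^esub>}"

definition quadratic_fields_upto :: "real \<Rightarrow> complex set set" where
  "quadratic_fields_upto x = {K. quadratic_field K \<and> abs_disc K \<le> x}"

end

theory Submission
  imports
    Defs
    "HOL-Analysis.Convex"
    "HOL-Real_Asymp.Real_Asymp"
    "HOL-Number_Theory.Number_Theory"
begin

text \<open>
  Let \<open>K = \<rat>(\<surd>d)\<close>, let \<open>P\<close> run through prime ideals of degree one above the split primes up to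
  \<open>Y\<close> (one above each), and write \<open>\<aa>^l = (\<gamma>)\<close> for a representative \<open>\<aa>\<close> of an \<open>l\<close>-torsion
  class \<open>c\<close>. Attach to the pair \<open>(c, P)\<close> the integral binary form of a basis of \<open>\<aa> P\<close>, reduced with
  respect to a positive definite form whose weight balances the two absolute values of \<open>\<gamma>\<close>,
  together with the rounded logarithm of the relative size of its shortest vector. Real and imaginary
  fields alike have only \<open>O(\<bar>d\<bar>^(1/2+\<epsilon>))\<close> such codes, so that neither class numbers nor regulators
  enter. If two pairs with different primes \<open>P, P'\<close> share a code, then \<open>P'^l\<close> times the conjugate of
  \<open>P^l\<close> has a generator all of whose absolute values are \<open>O(Y^l)\<close>. It generates \<open>K\<close>, has norm
  \<open>\<plusminus>(p p')^l\<close> and trace \<open>O(Y^l)\<close>, hence this happens for only \<open>O(Y^(l+2))\<close> values of \<open>d\<close>.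
  For all other \<open>d\<close> the code is injective and the torsion is \<open>O(\<bar>d\<bar>^(1/2+\<epsilon>))\<close> divided by the number of
  split primes up to \<open>Y\<close>.

  If \<open>Y\<close> is at least a fixed power of \<open>x\<close>, that number is at least \<open>Y^(1-\<epsilon>)\<close> for all but
  \<open>O(x^\<epsilon>)\<close> of the \<open>d\<close> up to \<open>x\<close>: otherwise the sum of the quadratic character over the primes up to
  \<open>Y\<close> is biased, and a high moment of these sums is bounded by duality, quadratic reciprocity and the
  vanishing of complete character sums. The theorem follows by letting \<open>Y\<close> run through the finitely
  many powers \<open>x^(i/(J(l+2)))\<close> with \<open>i \<le> J\<close>.
\<close>

section \<open>Jacobi symbols and character sums\<close>

text \<open>The exponent reflects one trade-off. At a threshold Y about Y^(l+2) discriminants are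
  lost, while the bound for every other torsion group improves by nearly a factor Y. The resulting
  exponent is linear in log Y, so its worst case sits at an end of the range: at Y = 1 when k
  exceeds l+2, at Y = x^(1/(l+2)) otherwise. Fields with too few split primes cannot be ruled out
  one by one. They receive the bound O(x^(1/2+\<epsilon>)) valid for every field, and since they are
  so rare they cost only x^(k/2+\<epsilon>), which the target always allows. The obstacle in real
  fields is that \<gamma> is known only up to an infinite group of units. The weight of the form is
  the l-th root of the quotient of the two absolute values of \<gamma>, so that another choice of
  generator moves the form and its short vector along with it. The l-th power of the short vector is
  then fixed, relative to \<gamma>, up to a bounded power of d, and a rounded logarithm of size
  O(log d) records what is left.\<close>

lemma Legendre_values: "Legendre a p \<in> {-1, 0, 1}"
  by (auto simp: Legendre_def)

lemma Legendre_cong: "[a = b] (mod p) \<Longrightarrow> Legendre a p = Legendre b p"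
proof -
  assume "[a = b] (mod p)"
  hence "[x = a] (mod p) \<longleftrightarrow> [x = b] (mod p)" "[a = x] (mod p) \<longleftrightarrow> [b = x] (mod p)" for x
    by (auto simp: cong_def)
  thus ?thesis by (simp add: Legendre_def QuadRes_def)
qed

text \<open>Euler's criterion gives a congruence modulo \<open>p\<close>; it is an equality because
  both sides lie in {-1, 0, 1} and so differ by at most 2 < p.\<close>

lemma Legendre_mult:
  assumes "prime (p::nat)" "p > 2"
  shows "Legendre (a * b) (int p) = Legendre a (int p) * Legendre b (int p)"
proof -
  have "[Legendre (a * b) (int p) = (a * b) ^ ((p - 1) div 2)] (mod int p)"
    using euler_criterion assms by blast
  also have "(a * b) ^ ((p - 1) div 2) = a ^ ((p - 1) div 2) * b ^ ((p - 1) div 2)"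
    by (rule power_mult_distrib)
  also have "[a ^ ((p - 1) div 2) * b ^ ((p - 1) div 2) = Legendre a (int p) * Legendre b (int p)] (mod int p)"
    by (intro cong_mult cong_sym[OF euler_criterion] assms)
  finally have "int p dvd Legendre (a * b) (int p) - Legendre a (int p) * Legendre b (int p)"
    by (simp add: cong_iff_dvd_diff)
  moreover have "\<bar>Legendre (a * b) (int p) - Legendre a (int p) * Legendre b (int p)\<bar> \<le> 2"
    using Legendre_values[of "a * b" "int p"] Legendre_values[of a "int p"] Legendre_values[of b "int p"] by auto
  ultimately have "Legendre (a * b) (int p) - Legendre a (int p) * Legendre b (int p) = 0"
    using assms(2) dvd_imp_le_int[of "Legendre (a * b) (int p) - Legendre a (int p) * Legendre b (int p)" "int p"]
    by linarith
  thus ?thesis by simp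
qed

text \<open>Only used for odd \<open>n\<close>: at the prime \<open>2\<close> the Legendre symbol has no meaning here.\<close>

definition jacobi :: "int \<Rightarrow> nat \<Rightarrow> int" where
  "jacobi a n = (\<Prod>p\<in>#prime_factorization n. Legendre a (int p))"

lemma jacobi_1 [simp]: "jacobi a 1 = 1" "jacobi a (Suc 0) = 1" by (simp_all add: jacobi_def)
lemma jacobi_prime [simp]: "prime p \<Longrightarrow> jacobi a p = Legendre a (int p)"
  by (simp add: jacobi_def prime_factorization_prime)
lemma jacobi_mult_right: "m > 0 \<Longrightarrow> n > 0 \<Longrightarrow> jacobi a (m * n) = jacobi a m * jacobi a n"
  by (simp add: jacobi_def prime_factorization_mult)

lemma odd_prime_gt_2: "prime (p::nat) \<Longrightarrow> odd p \<Longrightarrow> p > 2"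
  using prime_gt_1_nat[of p] by (cases "p = 2") auto

lemma odd_induct_primes [consumes 1, case_names one mult]:
  assumes "odd (n::nat)" "P 1"
    "\<And>p n. prime p \<Longrightarrow> odd p \<Longrightarrow> odd n \<Longrightarrow> P n \<Longrightarrow> P (p * n)"
  shows "P n"
  using assms(1)
proof (induction n rule: prime_divisors_induct)
  case (unit x) thus ?case using assms(2) by simp
next
  case (factor p x) thus ?case using assms(3)[of p x] by auto
qed auto

lemma jacobi_values: "jacobi a n \<in> {-1, 0, 1}"
proof -
  have "(\<Prod>p\<in>#M. Legendre a (int p)) \<in> {-1, 0, 1}" for M
  proof (induction M)
    case (add p M)
    thus ?case using Legendre_values[of a "int p"] by (simp only: image_mset_add_mset prod_mset.add_mset) auto
  qed simp
  thus ?thesis by (simp add: jacobi_def)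
qed

lemma jacobi_mult_left:
  assumes "odd n" shows "jacobi (a * b) n = jacobi a n * jacobi b n"
  using assms
proof (induction n rule: odd_induct_primes)
  case (mult p n)
  thus ?case using odd_prime_gt_2[of p] by (simp add: jacobi_mult_right prime_gt_0_nat odd_pos Legendre_mult)
qed simp

lemma jacobi_cong:
  assumes "odd n" "[a = b] (mod int n)" shows "jacobi a n = jacobi b n"
  using assms
proof (induction n rule: odd_induct_primes)
  case (mult p n)
  have "[a = b] (mod int p)" "[a = b] (mod int n)"
    using mult.prems by (auto elim: cong_dvd_modulus)
  thus ?case using mult Legendre_cong[of a b "int p"]
    by (simp add: jacobi_mult_right prime_gt_0_nat odd_pos)
qed simp

lemma Legendre_1: "prime p \<Longrightarrow> Legendre 1 (int p) = 1"
proof -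
  assume "prime p"
  hence "\<not> [1 = 0] (mod int p)" by (auto simp: cong_0_iff dest: prime_gt_1_nat)
  moreover have "QuadRes (int p) 1" unfolding QuadRes_def by (rule exI[of _ 1]) simp
  ultimately show ?thesis by (simp add: Legendre_def)
qed

lemma jacobi_one_left: "odd n \<Longrightarrow> jacobi 1 n = 1"
  by (induction n rule: odd_induct_primes)
     (auto simp: jacobi_mult_right prime_gt_0_nat odd_pos Legendre_1)

lemma jacobi_not_coprime:
  assumes "odd n" "\<not> coprime a (int n)" shows "jacobi a n = 0"
  using assms
proof (induction n rule: odd_induct_primes)
  case (mult p n)
  show ?case
  proof (cases "int p dvd a")
    case True
    thus ?thesis using mult by (simp add: jacobi_mult_right prime_gt_0_nat odd_pos Legendre_def cong_0_iff)
  next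
    case False
    hence "coprime a (int p)" using mult.hyps(1)
      by (metis coprime_commute prime_imp_coprime prime_nat_int_transfer)
    hence "\<not> coprime a (int n)" using mult.prems by auto
    thus ?thesis using mult by (simp add: jacobi_mult_right prime_gt_0_nat odd_pos)
  qed
qed simp

text \<open>The sign (-1)^((m-1)/2 * (n-1)/2) of the reciprocity law for odd \<open>m\<close> and
  \<open>n\<close>, written through residues modulo 4 so that multiplicativity is a finite
  check.\<close>

definition rsign :: "nat \<Rightarrow> nat \<Rightarrow> int" where
  "rsign m n = (if m mod 4 = 3 \<and> n mod 4 = 3 then -1 else 1)"

lemma odd_mod_4: "odd (n::nat) \<Longrightarrow> n mod 4 = 1 \<or> n mod 4 = 3"
  by presburger

lemma rsign_mult: "odd m \<Longrightarrow> odd m' \<Longrightarrow> rsign (m * m') n = rsign m n * rsign m' n"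
  using odd_mod_4[of m] odd_mod_4[of m'] by (auto simp: rsign_def mod_mult_eq[of m 4 m', symmetric])
lemma rsign_commute: "rsign m n = rsign n m" by (auto simp: rsign_def)

lemma Legendre_reciprocity:
  assumes "prime p" "prime q" "odd p" "odd q"
  shows "Legendre (int p) (int q) = rsign p q * Legendre (int q) (int p)"
proof (cases "p = q")
  case True thus ?thesis by (simp add: Legendre_def cong_0_iff)
next
  case False
  have "Legendre (int p) (int q) * Legendre (int q) (int p) = (-1) ^ ((p - 1) div 2 * ((q - 1) div 2))"
    using Quadratic_Reciprocity assms False odd_prime_gt_2 by simp
  also have "\<dots> = rsign p q"
  proof -
    have "even ((p - 1) div 2) \<longleftrightarrow> p mod 4 \<noteq> 3" "even ((q - 1) div 2) \<longleftrightarrow> q mod 4 \<noteq> 3"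
      using assms(3,4) by presburger+
    thus ?thesis by (auto simp: rsign_def)
  qed
  finally have e: "Legendre (int p) (int q) * Legendre (int q) (int p) = rsign p q" .
  have "rsign p q \<noteq> 0" by (simp add: rsign_def)
  hence "Legendre (int q) (int p) \<in> {-1, 1}" using e Legendre_values[of "int q" "int p"] by auto
  thus ?thesis using e by auto
qed

text \<open>The law for primes extends one argument at a time, since the symbols and
  \<open>rsign\<close> are multiplicative on odd numbers: the inner induction treats
  \<open>m\<close> against a prime, the outer one treats \<open>n\<close>.\<close>

lemma jacobi_reciprocity:
  assumes "odd m" "odd n"
  shows "jacobi (int m) n = rsign m n * jacobi (int n) m"
  using assms(2)
proof (induction n rule: odd_induct_primes)
  case one
  show ?case using jacobi_one_left[OF assms(1)] by (simp add: rsign_def)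
next
  case (mult p n)
  have "Legendre (int m) (int p) = rsign m p * jacobi (int p) m" using assms(1)
  proof (induction m rule: odd_induct_primes)
    case one thus ?case using mult by (simp add: rsign_def Legendre_1)
  next
    case (mult q m)
    thus ?case using \<open>prime p\<close> \<open>odd p\<close> odd_prime_gt_2[of p] Legendre_reciprocity[of q p]
      by (simp add: jacobi_mult_right Legendre_mult rsign_mult prime_gt_0_nat odd_pos)
  qed
  thus ?case using mult assms(1)
    by (simp add: jacobi_mult_right jacobi_mult_left prime_gt_0_nat odd_pos
         rsign_commute[of m] rsign_mult)
qed

text \<open>Squaring modulo \<open>q\<close> identifies 1 and \<open>q - 1\<close>; a self-map of a
  finite set that is not injective misses a value.\<close>

lemma quadratic_nonresidue_exists:
  assumes "prime (q::nat)" "odd q" shows "\<exists>r. Legendre r (int q) = -1"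
proof -
  let ?f = "\<lambda>x::nat. x\<^sup>2 mod q"
  have q: "q > 2" using assms odd_prime_gt_2 by blast
  have "?f 1 = ?f (q - 1)"
  proof -
    have "[int (q - 1) ^ 2 = 1] (mod int q)"
    proof -
      have "int (q - 1) = int q - 1" using q by simp
      hence "int (q - 1) ^ 2 - 1 = int q * (int q - 2)" by (simp add: power2_eq_square algebra_simps)
      thus ?thesis by (simp add: cong_iff_dvd_diff)
    qed
    hence "[(q - 1) ^ 2 = 1] (mod q)"
      by (metis cong_int_iff of_nat_1 of_nat_power)
    thus ?thesis by (simp add: cong_def)
  qed
  hence "\<not> inj_on ?f {..<q}" using q inj_onD[of ?f "{..<q}" 1 "q - 1"] by auto
  moreover have "?f ` {..<q} \<subseteq> {..<q}" using q by auto
  ultimately have "?f ` {..<q} \<noteq> {..<q}"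
    using eq_card_imp_inj_on[of "{..<q}" ?f] by auto
  then obtain r where r: "r < q" "r \<notin> ?f ` {..<q}" using \<open>?f ` {..<q} \<subseteq> {..<q}\<close> by blast
  have "r \<noteq> 0"
  proof
    assume "r = 0"
    hence "r = ?f 0" by simp
    moreover have "0 \<in> {..<q}" using q by simp
    ultimately show False using r(2) by (metis (no_types, lifting) image_eqI)
  qed
  hence "\<not> [int r = 0] (mod int q)" using r(1) by (metis cong_0_iff int_dvd_int_iff nat_dvd_not_less gr0I)
  moreover have "\<not> QuadRes (int q) (int r)"
  proof
    assume "QuadRes (int q) (int r)"
    then obtain y where y: "[y\<^sup>2 = int r] (mod int q)" by (auto simp: QuadRes_def)
    define x where "x = nat (y mod int q)"
    have x: "int x = y mod int q" "x < q" using q by (auto simp: x_def nat_less_iff)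
    have "[int x ^ 2 = int r] (mod int q)"
      using y cong_pow[of "y mod int q" y "int q" 2] x by (metis cong_mod_left cong_refl cong_trans)
    hence "[x\<^sup>2 = r] (mod q)" by (metis cong_int_iff of_nat_power)
    thus False using r x by (auto simp: cong_def image_iff)
  qed
  ultimately show ?thesis by (auto simp: Legendre_def)
qed

text \<open>By the Chinese remainder theorem \<open>a\<close> can be a non-residue modulo
  \<open>q\<close> and 1 modulo \<open>m\<close>; for this \<open>q\<close> has to divide the
  modulus exactly once.\<close>

lemma jacobi_nontrivial:
  assumes "prime q" "odd q" "odd m" "\<not> q dvd m"
  shows "\<exists>a. jacobi a (q * m) = -1"
proof -
  obtain r where r: "Legendre r (int q) = -1" using quadratic_nonresidue_exists assms by blast
  have "coprime (int q) (int m)" using assms(1,4) by (simp add: prime_imp_coprime_nat)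
  then obtain a where a: "[a = r] (mod int q)" "[a = 1] (mod int m)"
    using binary_chinese_remainder_int by blast
  have "jacobi a (q * m) = Legendre r (int q) * jacobi 1 m"
    using assms a jacobi_cong[of m a 1] Legendre_cong[of a r "int q"]
    by (simp add: jacobi_mult_right prime_gt_0_nat odd_pos)
  thus ?thesis using r jacobi_one_left[OF assms(3)] by auto
qed

lemma affine_mod_bij:
  assumes "coprime a m" "m > (0::nat)"
  shows "bij_betw (\<lambda>k. (a * k + b) mod m) {..<m} {..<m}"
proof -
  have "inj_on (\<lambda>k. (a * k + b) mod m) {..<m}"
  proof (rule inj_onI)
    fix x y assume xy: "x \<in> {..<m}" "y \<in> {..<m}" "(a * x + b) mod m = (a * y + b) mod m"
    hence "[a * x + b = a * y + b] (mod m)" by (simp add: cong_def)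
    hence "[a * x = a * y] (mod m)" using cong_add_rcancel_nat by blast
    hence "[x = y] (mod m)" using assms(1) cong_mult_lcancel_nat by blast
    thus "x = y" using xy by (simp add: cong_def)
  qed
  moreover have "(\<lambda>k. (a * k + b) mod m) ` {..<m} \<subseteq> {..<m}" using assms(2) by auto
  ultimately show ?thesis using endo_inj_surj[of "{..<m}"] by (auto simp: bij_betw_def)
qed

lemma jacobi_complete_sum_affine:
  assumes "odd m" "coprime a m"
  shows "(\<Sum>k<m. jacobi (int (a * k + b)) m) = (\<Sum>k<m. jacobi (int k) m)"
proof -
  have "(\<Sum>k<m. jacobi (int (a * k + b)) m) = (\<Sum>k<m. jacobi (int ((a * k + b) mod m)) m)"
    using assms by (intro sum.cong refl jacobi_cong) (auto simp: cong_def zmod_int)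
  also have "\<dots> = (\<Sum>k<m. jacobi (int k) m)"
    using sum.reindex_bij_betw[OF affine_mod_bij[OF assms(2), of b]] assms by (simp add: odd_pos)
  finally show ?thesis .
qed

text \<open>Multiplication by a residue of symbol -1 permutes the residues and reverses the sign of
  the sum.\<close>

lemma jacobi_complete_sum:
  assumes "odd m" "jacobi a m = -1" shows "(\<Sum>k<m. jacobi (int k) m) = 0"
proof -
  define c where "c = nat (a mod int m)"
  have c: "int c = a mod int m" using assms(1) by (simp add: c_def odd_pos)
  have jc: "jacobi (int c) m = -1"
    using jacobi_cong[OF assms(1), of "int c" a] assms(2) c by (simp add: cong_def)
  have "coprime c m" using jacobi_not_coprime[OF assms(1), of "int c"] jc by auto
  hence "(\<Sum>k<m. jacobi (int k) m) = (\<Sum>k<m. jacobi (int (c * k + 0)) m)"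
    using jacobi_complete_sum_affine[OF assms(1)] by metis
  also have "\<dots> = - (\<Sum>k<m. jacobi (int k) m)"
    using jc assms(1) by (simp add: jacobi_mult_left sum_negf)
  finally show ?thesis by simp
qed

text \<open>Whole periods contribute 0 and are stripped off until fewer than \<open>m\<close> terms
  remain.\<close>

lemma periodic_partial_sum_bound:
  fixes f :: "nat \<Rightarrow> int"
  assumes "m > 0" "\<And>k. f (k + m) = f k" "\<And>k. \<bar>f k\<bar> \<le> 1" "(\<Sum>k<m. f k) = 0"
  shows "\<bar>\<Sum>k<N. f k\<bar> \<le> int m"
proof (induction N rule: less_induct)
  case (less N)
  show ?case
  proof (cases "N < m")
    case True
    have "\<bar>\<Sum>k<N. f k\<bar> \<le> (\<Sum>k<N. \<bar>f k\<bar>)" by (rule sum_abs)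
    also have "\<dots> \<le> (\<Sum>k<N. 1)" using assms(3) by (intro sum_mono)
    finally show ?thesis using True by simp
  next
    case False
    have "(\<Sum>k<N. f k) = (\<Sum>k<m. f k) + (\<Sum>k\<in>{m..<N}. f k)"
      using False by (metis atLeast0LessThan le0 linorder_not_less sum.atLeastLessThan_concat)
    also have "(\<Sum>k\<in>{m..<N}. f k) = (\<Sum>k<N - m. f (k + m))"
      using False sum.shift_bounds_nat_ivl[of f 0 m "N - m"] by (simp add: atLeast0LessThan)
    finally have "(\<Sum>k<N. f k) = (\<Sum>k<N - m. f k)" using assms by simp
    thus ?thesis using less[of "N - m"] assms(1) False by simp
  qed
qed

text \<open>Only odd arguments are summed because reciprocity will exchange them with the moduli of
  Jacobi symbols. As \<open>m\<close> is odd, k -> 2k + 1 permutes the residues, so the complete sum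
  still vanishes.\<close>

lemma jacobi_odd_sum_bound:
  assumes "odd m" "jacobi a m = -1"
  shows "\<bar>\<Sum>k<N. jacobi (int (2 * k + 1)) m\<bar> \<le> int m"
proof (rule periodic_partial_sum_bound)
  show "m > 0" using assms(1) by (rule odd_pos)
  show "jacobi (int (2 * (k + m) + 1)) m = jacobi (int (2 * k + 1)) m" for k
    using assms(1) by (intro jacobi_cong) (auto simp: cong_iff_dvd_diff)
  show "\<bar>jacobi (int (2 * k + 1)) m\<bar> \<le> 1" for k
    using jacobi_values[of "int (2 * k + 1)" m] by auto
  show "(\<Sum>k<m. jacobi (int (2 * k + 1)) m) = 0"
    using jacobi_complete_sum_affine[of m 2 1] jacobi_complete_sum[OF assms] assms(1) by simp
qed

section \<open>Reduction of binary forms, prime counting and the divisor bound\<close>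

text \<open>Gauss reduction: a minimal vector is primitive, hence extends to a unimodular basis, and
  a shift of the second vector makes the middle coefficient b' at most the first coefficient a' in
  absolute value. Then b'^2 <= a'^2 <= a' c', and 4 a' c' - b'^2 is the unchanged discriminant,
  which gives the factor 3.\<close>

lemma reduced_binary_form_exists:
  fixes a b c :: real
  assumes a: "a > 0" and D: "4 * a * c - b\<^sup>2 > 0"
  defines "f \<equiv> \<lambda>x y::int. a * (of_int x)\<^sup>2 + b * of_int x * of_int y + c * (of_int y)\<^sup>2"
  shows "\<exists>p q r t. p * t - q * r = 1 \<and> f p q \<le> f r t \<and> 3 * f p q * f r t \<le> 4 * a * c - b\<^sup>2"
proof -
  define \<Delta> where "\<Delta> = 4 * a * c - b\<^sup>2"
  have c: "c > 0" using a D by (smt (verit) mult_nonneg_nonpos zero_le_power2)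
  have fa: "4 * a * f x y = (2 * a * of_int x + b * of_int y)\<^sup>2 + \<Delta> * (of_int y)\<^sup>2" for x y
    by (simp add: f_def \<Delta>_def power2_eq_square algebra_simps)
  have fc: "4 * c * f x y = (2 * c * of_int y + b * of_int x)\<^sup>2 + \<Delta> * (of_int x)\<^sup>2" for x y
    by (simp add: f_def \<Delta>_def power2_eq_square algebra_simps)
  have \<Delta>: "\<Delta> > 0" using D by (simp add: \<Delta>_def)
  have pos: "f x y > 0" if "x \<noteq> 0 \<or> y \<noteq> 0" for x y
  proof (cases "y = 0")
    case True thus ?thesis using that a by (simp add: f_def)
  next
    case False
    hence "4 * a * f x y > 0" unfolding fa using \<Delta> by (intro add_nonneg_pos) auto
    thus ?thesis using a by (simp add: zero_less_mult_iff)
  qed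
  \<comment> \<open>The nonzero vectors of value at most \<open>a = f 1 0\<close>. There are
    finitely many, so a minimum over all nonzero vectors is attained among them.\<close>
  define S where "S = {(x, y). (x \<noteq> 0 \<or> y \<noteq> 0) \<and> f x y \<le> a}"
  define B where "B = \<lceil>4 * c * a / \<Delta> + 4 * a * a / \<Delta>\<rceil>"
  have sq: "\<bar>z\<bar> \<le> B" if "\<Delta> * (of_int z)\<^sup>2 \<le> 4 * c * a + 4 * a * a" for z :: int
  proof -
    have "(of_int z)\<^sup>2 \<le> (4 * c * a + 4 * a * a) / \<Delta>" using that \<Delta> by (simp add: field_simps)
    also have "\<dots> \<le> of_int B" unfolding B_def add_divide_distrib by (rule le_of_int_ceiling)
    finally have "of_int (z\<^sup>2) \<le> (of_int B :: real)" by simp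
    hence "z\<^sup>2 \<le> B" by (simp only: of_int_le_iff)
    moreover have "\<bar>z\<bar> * 1 \<le> \<bar>z\<bar> * \<bar>z\<bar>"
      by (cases "z = 0", simp, intro mult_left_mono, auto)
    hence "\<bar>z\<bar> \<le> z\<^sup>2" by (simp add: power2_eq_square)
    ultimately show ?thesis by linarith
  qed
  have "S \<subseteq> {-B..B} \<times> {-B..B}"
  proof
    fix v assume "v \<in> S"
    then obtain x y where v: "v = (x, y)" "f x y \<le> a" by (auto simp: S_def)
    have "\<Delta> * (of_int y)\<^sup>2 \<le> 4 * a * f x y" using fa[of x y] by simp
    also have "\<dots> \<le> 4 * a * a" using v a by simp
    finally have y: "\<bar>y\<bar> \<le> B" using a c by (intro sq) (smt (verit) mult_nonneg_nonneg)
    have "\<Delta> * (of_int x)\<^sup>2 \<le> 4 * c * f x y" using fc[of x y] by simp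
    also have "\<dots> \<le> 4 * c * a" using v c by simp
    finally have x: "\<bar>x\<bar> \<le> B" using a c by (intro sq) (smt (verit) mult_nonneg_nonneg)
    show "v \<in> {-B..B} \<times> {-B..B}" using x y v by auto
  qed
  hence finS: "finite S" by (rule finite_subset) auto
  have "(1, 0) \<in> S" by (simp add: S_def f_def)
  hence neS: "S \<noteq> {}" by blast
  obtain v where v: "v \<in> S" "\<And>w. w \<in> S \<Longrightarrow> (case v of (x, y) \<Rightarrow> f x y) \<le> (case w of (x, y) \<Rightarrow> f x y)"
    using arg_min_if_finite(1)[OF finS neS, of "\<lambda>w. case w of (x, y) \<Rightarrow> f x y"]
      arg_min_least[OF finS neS, of _ "\<lambda>w. case w of (x, y) \<Rightarrow> f x y"] by blast
  obtain p q where pq: "v = (p, q)" by fastforce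
  have pq0: "p \<noteq> 0 \<or> q \<noteq> 0" and pqa: "f p q \<le> a" using v(1) by (auto simp: S_def pq)
  have min: "f p q \<le> f x y" if "x \<noteq> 0 \<or> y \<noteq> 0" for x y
  proof (cases "f x y \<le> a")
    case True thus ?thesis using v(2)[of "(x, y)"] that by (simp add: S_def pq)
  qed (use pqa in simp)
  have cop: "gcd p q = 1"
  proof (rule ccontr)
    assume ne: "gcd p q \<noteq> 1"
    define g where "g = gcd p q"
    have g2: "g \<ge> 2" using ne pq0 unfolding g_def
      by (smt (verit) gcd_ge_0_int gcd_eq_0_iff)
    obtain p' q' where p': "p = g * p'" "q = g * q'" unfolding g_def by (meson dvdE gcd_dvd1 gcd_dvd2)
    have nz: "p' \<noteq> 0 \<or> q' \<noteq> 0" using pq0 p' by auto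
    have "f p q = (of_int g)\<^sup>2 * f p' q'" unfolding p' f_def by (simp add: power2_eq_square algebra_simps)
    moreover have "(of_int g)\<^sup>2 \<ge> (2::real)\<^sup>2" using g2 by (intro power_mono) auto
    ultimately have "f p q \<ge> 4 * f p' q'" using pos[OF nz] by simp
    thus False using min[OF nz] pos[OF nz] by simp
  qed
  then obtain t0 r0' where "t0 * p + r0' * q = 1" using bezout_int[of p q] by metis
  hence bz: "p * t0 - q * (- r0') = 1" by (simp add: algebra_simps)
  define r0 where "r0 = - r0'"
  define b0 where "b0 = 2 * a * of_int p * of_int r0 + b * (of_int p * of_int t0 + of_int q * of_int r0) + 2 * c * of_int q * of_int t0"
  \<comment> \<open>Adding \<open>k\<close> times the minimal vector changes the middle coefficient
    by \<open>2 * k * f p q\<close>; rounding brings it into the interval of radius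
    \<open>f p q\<close>.\<close>
  define k where "k = - round (b0 / (2 * f p q))"
  define r t where "r = r0 + k * p" and "t = t0 + k * q"
  define b' where "b' = b0 + 2 * of_int k * f p q"
  have fp: "f p q > 0" using pos[OF pq0] .
  have det: "p * t - q * r = 1" using bz by (simp add: r_def t_def r0_def algebra_simps)
  have b'_eq: "b' = 2 * a * of_int p * of_int r + b * (of_int p * of_int t + of_int q * of_int r) + 2 * c * of_int q * of_int t"
    by (simp add: b'_def b0_def f_def r_def t_def power2_eq_square algebra_simps)
  have "4 * f p q * f r t - b'\<^sup>2 = \<Delta> * of_int (p * t - q * r) ^ 2"
    unfolding b'_eq f_def \<Delta>_def by (simp add: power2_eq_square algebra_simps)
  hence disc: "4 * f p q * f r t - b'\<^sup>2 = \<Delta>" using det by simp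
  have "\<bar>b0 / (2 * f p q) + of_int k\<bar> \<le> 1 / 2"
    using of_int_round_abs_le[of "b0 / (2 * f p q)"] by (simp add: k_def abs_minus_commute)
  hence "\<bar>b0 / (2 * f p q) + of_int k\<bar> * (2 * f p q) \<le> f p q"
    using mult_right_mono[of _ "1 / 2" "2 * f p q"] fp by fastforce
  moreover have "\<bar>b0 / (2 * f p q) + of_int k\<bar> * (2 * f p q) = \<bar>b'\<bar>"
  proof -
    have "b' = (b0 / (2 * f p q) + of_int k) * (2 * f p q)" using fp by (simp add: b'_def distrib_right)
    thus ?thesis using fp by (simp only: abs_mult)
  qed
  ultimately have "\<bar>b'\<bar> \<le> f p q" by simp
  hence "b'\<^sup>2 \<le> (f p q)\<^sup>2" using fp by (simp add: abs_le_square_iff[symmetric])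
  moreover have "f p q \<le> f r t" using min[of r t] det by fastforce
  hence "(f p q)\<^sup>2 \<le> f p q * f r t" using fp by (simp add: power2_eq_square)
  ultimately have "3 * f p q * f r t \<le> \<Delta>" using disc by simp
  thus ?thesis using det \<open>f p q \<le> f r t\<close> unfolding \<Delta>_def by blast
qed

section \<open>A Chebyshev lower bound for the number of primes\<close>

text \<open>The numbers 1 / (k * binomial(n, k)) form Leibniz's harmonic triangle; this is its
  recurrence.\<close>

lemma leibniz_triangle_step:
  assumes "1 \<le> k" "k < n"
  shows "1 / (real (Suc k) * real (n choose Suc k)) = 1 / (real k * real ((n - 1) choose k)) - 1 / (real k * real (n choose k))"
proof -
  define C where "C = real (n choose k)"
  have C: "C > 0" using assms by (simp add: C_def)
  have e1: "real (Suc k) * real (n choose Suc k) = (real n - real k) * C"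
    using assms binomial_absorption[of k n] binomial_absorb_comp[of n k]
    by (simp only: C_def of_nat_mult[symmetric] of_nat_diff[symmetric] less_imp_le)
  have "(real n - real k) * C = real n * real ((n - 1) choose k)"
    using assms binomial_absorb_comp[of n k]
    by (simp only: C_def of_nat_mult[symmetric] of_nat_diff[symmetric] less_imp_le)
  hence e2: "real ((n - 1) choose k) = (real n - real k) * C / real n" using assms by (simp add: field_simps)
  show ?thesis unfolding e1 e2 C_def[symmetric] using C assms by (simp add: field_simps)
qed

text \<open>The entries with k = 1 are 1/n, whose denominators \<open>M\<close> clears, and the
  recurrence only takes differences. In other words, k * binomial(n, k) divides every common
  multiple of 1, ..., N.\<close>

lemma leibniz_triangle_denominator:
  fixes M :: nat
  assumes M: "\<And>i. 1 \<le> i \<Longrightarrow> i \<le> N \<Longrightarrow> i dvd M"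
  shows "1 \<le> k \<Longrightarrow> k \<le> n \<Longrightarrow> n \<le> N \<Longrightarrow> real M / (real k * real (n choose k)) \<in> \<int>"
proof (induction k arbitrary: n rule: nat_induct_at_least)
  case base
  have "n dvd M" using M base by auto
  then obtain j where "M = n * j" by blast
  thus ?case using base by simp
next
  case (Suc k)
  have "real M / (real (Suc k) * real (n choose Suc k))
      = real M / (real k * real ((n - 1) choose k)) - real M / (real k * real (n choose k))"
    using arg_cong[OF leibniz_triangle_step[of k n], of "\<lambda>x. real M * x"] Suc.hyps Suc.prems
    by (simp add: right_diff_distrib)
  moreover have "real M / (real k * real ((n - 1) choose k)) \<in> \<int>" "real M / (real k * real (n choose k)) \<in> \<int>"
    using Suc by auto
  ultimately show ?case by (metis Ints_diff)
qed

text \<open>With N = 2n, the number n * binomial(2n, n) divides the least common multiple of 1, ...,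
  N, which is a product of one power p^e <= N for each prime p <= N. On the other hand n *
  binomial(2n, n) >= 4^n / 2 >= 2^n.\<close>

lemma prime_counting_lower:
  assumes n: "n \<ge> (1::nat)"
  shows "real n * ln 2 \<le> real (card {p. prime p \<and> p \<le> 2 * n}) * ln (2 * real n)"
proof -
  define N where "N = 2 * n"
  define P where "P = {p. prime p \<and> p \<le> N}"
  have "P \<subseteq> {..N}" by (auto simp: P_def)
  hence finP: "finite P" by (rule finite_subset) simp
  \<comment> \<open>The largest exponent with \<open>p ^ e p\<close> at most \<open>N\<close>, so
    that \<open>M\<close> below is the least common multiple of 1, ..., \<open>N\<close>.\<close>
  define e where "e p = Max {k. p ^ k \<le> N}" for p
  have fin: "finite {k. p ^ k \<le> N}" if "prime p" for p :: nat
  proof (rule finite_subset)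
    show "{k. p ^ k \<le> N} \<subseteq> {..N}"
    proof
      fix k assume "k \<in> {k. p ^ k \<le> N}"
      moreover have "k < p ^ k" using prime_gt_1_nat[OF that] power_gt_expt[of p k] by simp
      ultimately show "k \<in> {..N}" by simp
    qed
  qed simp
  have ne: "0 \<in> {k. p ^ k \<le> N}" for p :: nat using n by (simp add: N_def)
  have e1: "p ^ e p \<le> N" if "prime p" for p
    using Max_in[OF fin[OF that]] ne[of p] unfolding e_def by blast
  have e2: "k \<le> e p" if "prime p" "p ^ k \<le> N" for p k
    unfolding e_def using fin[OF that(1)] that(2) by (intro Max_ge) auto
  define M where "M = (\<Prod>p\<in>P. p ^ e p)"
  have dvdM: "i dvd M" if "1 \<le> i" "i \<le> N" for i
  proof -
    have "i = (\<Prod>p\<in>prime_factors i. p ^ multiplicity p i)"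
      using that(1) prod_prime_factors[of i] by simp
    also have "\<dots> dvd M" unfolding M_def
    proof (rule prod_dvd_prod_subset2)
      show "finite P" by fact
      show "prime_factors i \<subseteq> P" using that by (auto simp: P_def prime_factors_dvd intro: order_trans[OF dvd_imp_le])
      fix p assume p: "p \<in> prime_factors i"
      have "p ^ multiplicity p i \<le> i" using that by (intro dvd_imp_le multiplicity_dvd) simp
      hence "p ^ multiplicity p i \<le> N" using that by linarith
      thus "p ^ multiplicity p i dvd p ^ e p" using e2 p by (intro le_imp_power_dvd) auto
    qed
    finally show ?thesis .
  qed
  have "M \<le> (\<Prod>p\<in>P. N)" unfolding M_def by (intro prod_mono) (auto simp: P_def e1)
  hence MN: "M \<le> N ^ card P" by simp
  have M0: "M > 0" unfolding M_def by (intro prod_pos) (auto simp: P_def prime_gt_0_nat)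
  have "real M / (real n * real (N choose n)) \<in> \<int>"
    by (rule leibniz_triangle_denominator[OF dvdM]) (use n in \<open>auto simp: N_def\<close>)
  then obtain j where j: "real M / (real n * real (N choose n)) = of_int j" by (auto elim: Ints_cases)
  have cp: "real n * real (N choose n) > 0" using n by (simp add: N_def)
  have "of_int j > (0::real)" unfolding j[symmetric] using M0 cp by simp
  hence "of_int j \<ge> (1::real)" by simp
  hence "real n * real (N choose n) \<le> real M" using cp unfolding j[symmetric] by (simp add: field_simps)
  moreover have "4 ^ n / (2 * real n) \<le> real (N choose n)" unfolding N_def using central_binomial_lower_bound n by simp
  hence "4 ^ n / 2 \<le> real n * real (N choose n)" using n by (simp add: field_simps)
  moreover have "(2::real) ^ n \<le> 4 ^ n / 2"
  proof -
    have "(2::real) ^ n * 2 \<le> 2 ^ n * 2 ^ n" using n self_le_power[of "2::real" n] by simp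
    also have "\<dots> = 4 ^ n" by (simp flip: power_mult_distrib)
    finally show ?thesis by simp
  qed
  ultimately have "(2::real) ^ n \<le> real (N ^ card P)" using MN by (smt (verit) of_nat_mono)
  hence "ln ((2::real) ^ n) \<le> ln (real (N ^ card P))" using n by (intro ln_mono) (auto simp: N_def)
  moreover have "real N > 0" using n by (simp add: N_def)
  hence "ln (real (N ^ card P)) = real (card P) * ln (real N)"
    using ln_realpow[of "real N" "card P"] by (simp only: of_nat_power)
  ultimately have "real n * ln 2 \<le> real (card P) * ln (real N)" by (simp add: ln_realpow)
  thus ?thesis by (simp add: N_def P_def)
qed

section \<open>The divisor bound\<close>

lemma card_divisors_prime_power_mult:
  fixes p m :: nat
  assumes "prime p" "m > 0"
  shows "card {d. d dvd p ^ e * m} \<le> (e + 1) * card {d. d dvd m}"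
proof -
  have fin: "finite {d. d dvd m}" using assms by simp
  have "{d. d dvd p ^ e * m} \<subseteq> (\<lambda>(i, d'). p ^ i * d') ` ({..e} \<times> {d. d dvd m})"
  proof
    fix d assume "d \<in> {d. d dvd p ^ e * m}"
    then obtain b c where "d = b * c" "b dvd p ^ e" "c dvd m" using division_decomp by blast
    moreover then obtain i where "i \<le> e" "b = p ^ i" using divides_primepow_nat[OF assms(1)] by blast
    ultimately show "d \<in> (\<lambda>(i, d'). p ^ i * d') ` ({..e} \<times> {d. d dvd m})" by force
  qed
  hence "card {d. d dvd p ^ e * m} \<le> card ({..e} \<times> {d. d dvd m})"
    using fin by (meson card_image_le card_mono finite_SigmaI finite_atMost finite_imageI le_trans)
  thus ?thesis by (simp add: card_cartesian_product)
qed

text \<open>The quotient of the divisor count by n^\<epsilon> is at most the product of (e + 1) /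
  p^(e \<epsilon>) over the prime powers in n. A factor is at most 1 once p^\<epsilon> >= 2, because
  e + 1 <= 2^e, and the fewer than \<open>B\<close> remaining primes contribute at most
  \<open>A\<close> each.\<close>

lemma divisor_bound:
  fixes \<epsilon> :: real
  assumes "\<epsilon> > 0"
  shows "\<exists>C>0. \<forall>n>0. real (card {d::nat. d dvd n}) \<le> C * real n powr \<epsilon>"
proof -
  define B where "B = nat \<lceil>2 powr (1 / \<epsilon>)\<rceil>"
  \<comment> \<open>Chosen so that \<open>real e + 1 \<le> A * 2 powr (real e * \<epsilon>)\<close>
    follows from 1 + y <= exp y; it is the factor allowed for a small prime.\<close>
  define A where "A = 1 + 1 / (\<epsilon> * ln 2)"
  have A1: "A \<ge> 1" using assms by (simp add: A_def)
  have key: "real e + 1 \<le> A * 2 powr (real e * \<epsilon>)" for e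
  proof -
    have "1 + real e * \<epsilon> * ln 2 \<le> exp (real e * \<epsilon> * ln 2)" by (rule exp_ge_add_one_self)
    hence *: "1 + real e * \<epsilon> * ln 2 \<le> 2 powr (real e * \<epsilon>)" by (simp add: powr_def mult_ac)
    have "A * (1 + real e * \<epsilon> * ln 2) = 1 + real e + real e * \<epsilon> * ln 2 + 1 / (\<epsilon> * ln 2)"
      unfolding A_def using assms by (simp add: field_simps)
    hence "real e + 1 \<le> A * (1 + real e * \<epsilon> * ln 2)" using assms by simp
    also have "\<dots> \<le> A * 2 powr (real e * \<epsilon>)" using * A1 by simp
    finally show ?thesis .
  qed
  \<comment> \<open>The exponent counts the small primes that occur in \<open>n\<close>, so that an
    induction removing one prime at a time can carry the constant.\<close>
  have main: "real (card {d. d dvd n}) \<le> A ^ card {p\<in>prime_factors n. p < B} * real n powr \<epsilon>" if "n > 0" for n :: nat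
    using that
  proof (induction n rule: less_induct)
    case (less n)
    show ?case
    proof (cases "n = 1")
      case True thus ?thesis using A1 by simp
    next
      case False
      then obtain p where p: "prime p" "p dvd n" using prime_factor_nat by blast
      define e where "e = multiplicity p n"
      obtain m where nm: "n = p ^ e * m" and pm: "\<not> p dvd m"
        using multiplicity_decompose'[of n p] p(1) less.prems prime_gt_1_nat[OF p(1)] unfolding e_def by auto
      have e0: "e > 0" using p less.prems by (simp add: e_def prime_multiplicity_gt_zero_iff)
      have m0: "m > 0" using nm less.prems by (cases m) auto
      have p2: "p \<ge> 2" using p prime_ge_2_nat by blast
      have "1 < p" using p2 by simp
      hence "p ^ e > 1" using one_less_power[OF _ e0] by blast
      hence mn: "m < n" using nm m0 by simp
      have pf: "prime_factors n = insert p (prime_factors m)"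
      proof -
        have "prime_factors n = prime_factors (p ^ e) \<union> prime_factors m"
          unfolding nm using m0 p by (intro prime_factors_product) (auto simp: prime_gt_0_nat)
        thus ?thesis using p e0 by (simp add: prime_factorization_prime_power)
      qed
      have pnm: "p \<notin> prime_factors m" using pm by (auto simp: prime_factors_dvd)
      have step: "real e + 1 \<le> (if p < B then A else 1) * (real (p ^ e)) powr \<epsilon>"
      proof (cases "p < B")
        case True
        have "2 powr (real e * \<epsilon>) \<le> real p powr (real e * \<epsilon>)" using p2 assms by (intro powr_mono2) auto
        also have "\<dots> = (real (p ^ e)) powr \<epsilon>" using p2 by (simp add: powr_powr powr_realpow[symmetric])
        finally show ?thesis using key[of e] A1 True by (smt (verit) mult_left_mono)
      next
        case False
        have "2 powr (1 / \<epsilon>) \<le> real p" using False by (simp add: B_def) linarith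
        hence "(2 powr (1 / \<epsilon>)) powr (real e * \<epsilon>) \<le> real p powr (real e * \<epsilon>)" using assms by (intro powr_mono2) auto
        also have "real p powr (real e * \<epsilon>) = (real (p ^ e)) powr \<epsilon>" using p2 by (simp add: powr_powr powr_realpow[symmetric])
        also have "(2 powr (1 / \<epsilon>)) powr (real e * \<epsilon>) = 2 ^ e" using assms by (simp add: powr_powr powr_realpow[symmetric])
        finally have "2 ^ e \<le> (real (p ^ e)) powr \<epsilon>" .
        moreover have "real e + 1 \<le> 2 ^ e"
        proof -
          have "Suc e \<le> 2 ^ e" using less_exp[of e] by (rule Suc_leI)
          hence "real (Suc e) \<le> real (2 ^ e)" by (rule of_nat_mono)
          thus ?thesis by simp
        qed
        ultimately show ?thesis using False by simp
      qed
      have "real (card {d. d dvd n}) \<le> real ((e + 1) * card {d. d dvd m})"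
        unfolding nm using card_divisors_prime_power_mult[OF p(1) m0] by (rule of_nat_mono)
      also have "\<dots> = (real e + 1) * real (card {d. d dvd m})" by (simp add: distrib_right)
      also have "\<dots> \<le> ((if p < B then A else 1) * (real (p ^ e)) powr \<epsilon>) * (A ^ card {q\<in>prime_factors m. q < B} * real m powr \<epsilon>)"
        using step less.IH[OF mn m0] A1 by (intro mult_mono) auto
      also have "\<dots> = ((if p < B then A else 1) * A ^ card {q\<in>prime_factors m. q < B}) * real n powr \<epsilon>"
        unfolding nm by (simp add: powr_mult)
      also have "(if p < B then A else 1) * A ^ card {q\<in>prime_factors m. q < B} = A ^ card {q\<in>prime_factors n. q < B}"
      proof (cases "p < B")
        case True
        hence "{q\<in>prime_factors n. q < B} = insert p {q\<in>prime_factors m. q < B}" using pf by auto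
        thus ?thesis using True pnm by simp
      next
        case False
        hence "{q\<in>prime_factors n. q < B} = {q\<in>prime_factors m. q < B}" using pf by auto
        thus ?thesis using False by simp
      qed
      finally show ?thesis .
    qed
  qed
  have "real (card {d. d dvd n}) \<le> A ^ B * real n powr \<epsilon>" if "n > 0" for n :: nat
  proof -
    have "card {p\<in>prime_factors n. p < B} \<le> card {..<B}" by (intro card_mono) auto
    hence "A ^ card {p\<in>prime_factors n. p < B} \<le> A ^ B" using A1 by (intro power_increasing) auto
    thus ?thesis using main[OF that] by (smt (verit) mult_right_mono powr_ge_zero)
  qed
  thus ?thesis using A1 by (intro exI[of _ "A ^ B"]) auto
qed

section \<open>Quadratic characters biased on small primes\<close>

text \<open>The inverse of 2 modulo \<open>n\<close> is (n + 1) / 2, so the symbol has a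
  multiplicative inverse.\<close>

lemma jacobi_2_nonzero: assumes "odd n" shows "jacobi 2 n \<noteq> 0"
proof -
  have "jacobi 2 n * jacobi (int ((n + 1) div 2)) n = jacobi (2 * int ((n + 1) div 2)) n"
    using jacobi_mult_left[OF assms] by simp
  also have "2 * int ((n + 1) div 2) = int n + 1" using assms by (metis even_Suc Suc_eq_plus1 dvd_mult_div_cancel of_nat_1 of_nat_add of_nat_mult of_nat_numeral)
  also have "jacobi (int n + 1) n = jacobi 1 n" using assms by (intro jacobi_cong) (auto simp: cong_iff_dvd_diff)
  also have "\<dots> = 1" using jacobi_one_left[OF assms] .
  finally show ?thesis by auto
qed

lemma jacobi_square_unit:
  assumes "odd n" "u \<in> {1, -1, 2, -2}" shows "jacobi u n * jacobi u n = 1"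
proof -
  have 2: "jacobi 2 n * jacobi 2 n = 1"
    using jacobi_2_nonzero[OF assms(1)] jacobi_values[of 2 n] by auto
  have "jacobi u n * jacobi u n = jacobi (u * u) n" using jacobi_mult_left[OF assms(1)] by simp
  also have "u * u = 1 \<or> u * u = 2 * 2" using assms(2) by auto
  hence "jacobi (u * u) n = 1"
    using jacobi_one_left[OF assms(1)] jacobi_mult_left[OF assms(1), of 2 2] 2 by auto
  finally show ?thesis .
qed

text \<open>Fixing the unit part \<open>u\<close> and the residue of \<open>e\<close> modulo \<open>4\<close> removes every sign and every
  supplementary law: the product of two such characters has a modulus congruent to \<open>1\<close> modulo \<open>4\<close>.\<close>

lemma jacobi_product_reciprocity:
  assumes n: "odd n" and u: "u \<in> {1, -1, 2, -2}" and e: "odd e" "odd e'" "e mod 4 = e' mod 4"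
  shows "jacobi (u * int e) n * jacobi (u * int e') n = jacobi (int n) (e * e')"
proof -
  have "jacobi (u * int e) n * jacobi (u * int e') n
      = (jacobi u n * jacobi u n) * jacobi (int (e * e')) n"
    using jacobi_mult_left[OF n] by simp
  also have "\<dots> = rsign (e * e') n * jacobi (int n) (e * e')"
    unfolding jacobi_square_unit[OF n u] using jacobi_reciprocity[of "e * e'" n] e n by simp
  also have "rsign (e * e') n = 1"
  proof -
    have "(e * e') mod 4 = ((e mod 4) * (e' mod 4)) mod 4" by (simp add: mod_mult_eq)
    also have "\<dots> = 1" using odd_mod_4[OF e(1)] e(3) by auto
    finally show ?thesis by (simp add: rsign_def)
  qed
  finally show ?thesis by simp
qed

lemma squarefree_prime_dvd_imp_dvd:
  fixes a b :: nat
  assumes "squarefree a" "\<And>q. prime q \<Longrightarrow> q dvd a \<Longrightarrow> q dvd b" "b > 0" shows "a dvd b"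
proof (rule multiplicity_le_imp_dvd)
  show a0: "a \<noteq> 0" using assms(1) not_squarefree_0 by metis
  fix p :: nat assume p: "prime p"
  show "multiplicity p a \<le> multiplicity p b"
  proof (cases "p dvd a")
    case True
    have "p \<in> prime_factors a" using True p a0 by (simp add: prime_factors_dvd)
    hence "multiplicity p a = 1" using assms(1) a0 squarefree_factorial_semiring'[of a] by blast
    moreover have "multiplicity p b \<ge> 1"
      using assms(2)[OF p True] p assms(3) by (intro multiplicity_geI) auto
    ultimately show ?thesis by simp
  qed (simp add: not_dvd_imp_multiplicity_0)
qed

lemma distinct_squarefree_separating_prime:
  fixes e e' :: nat
  assumes "squarefree e" "squarefree e'" "e \<noteq> e'"
  shows "\<exists>q. prime q \<and> ((q dvd e \<and> \<not> q dvd e') \<or> (q dvd e' \<and> \<not> q dvd e))"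
proof (rule ccontr)
  assume "\<not> ?thesis"
  hence *: "q dvd e \<longleftrightarrow> q dvd e'" if "prime q" for q using that by blast
  have "e > 0" "e' > 0" using assms(1,2) not_squarefree_0 by (metis gr0I)+
  hence "e dvd e'" "e' dvd e" using * assms squarefree_prime_dvd_imp_dvd by blast+
  thus False using assms(3) dvd_antisym by blast
qed

text \<open>Two distinct squarefree numbers are told apart by a prime dividing only one of them; it
  divides the product exactly once, as \<open>jacobi_nontrivial\<close> requires.\<close>

lemma jacobi_nontrivial_product:
  fixes e e' :: nat
  assumes "squarefree e" "squarefree e'" "e \<noteq> e'" "odd e" "odd e'"
  shows "\<exists>a. jacobi a (e * e') = -1"
proof -
  have gen: "\<exists>a. jacobi a (f * f') = -1"
    if q: "prime q" "q dvd f" "\<not> q dvd f'" and f: "squarefree f" "odd f" "odd f'" for q f f' :: nat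
  proof -
    obtain m where m: "f = q * m" using q(2) by blast
    have "\<not> q dvd m"
    proof
      assume "q dvd m"
      hence "q\<^sup>2 dvd f" unfolding m by (simp add: power2_eq_square)
      hence "q dvd 1" using f(1) by (auto simp: squarefree_def)
      thus False using q(1) by auto
    qed
    hence "\<not> q dvd m * f'" using q prime_dvd_mult_iff by blast
    from jacobi_nontrivial[OF q(1) _ _ this] m f show ?thesis by (auto simp: mult.assoc)
  qed
  obtain q where "prime q" "(q dvd e \<and> \<not> q dvd e') \<or> (q dvd e' \<and> \<not> q dvd e)"
    using distinct_squarefree_separating_prime[OF assms(1-3)] by blast
  thus ?thesis using gen[of q e e'] gen[of q e' e] assms by (auto simp: mult.commute)
qed

text \<open>By unique factorization every such tuple takes its entries from those of one fixed
  tuple, which leaves at most \<open>m\<close> values in each of \<open>m\<close> places.\<close>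

lemma card_prime_tuples_with_product:
  fixes P :: "nat set" and y :: nat
  assumes "finite P" "\<And>p. p \<in> P \<Longrightarrow> prime p"
  shows "card {f \<in> PiE {..<m} (\<lambda>_. P). (\<Prod>i<m. f i) = y} \<le> m ^ m"
proof (cases "{f \<in> PiE {..<m} (\<lambda>_. P). (\<Prod>i<m. f i) = y} = {}")
  case False
  then obtain f0 where f0: "f0 \<in> PiE {..<m} (\<lambda>_. P)" "(\<Prod>i<m. f0 i) = y" by blast
  have pr: "prime (f i)" if "f \<in> PiE {..<m} (\<lambda>_. P)" "i < m" for f i
    using that assms(2) by (auto simp: PiE_iff)
  have sub: "f i \<in> f0 ` {..<m}" if f: "f \<in> PiE {..<m} (\<lambda>_. P)" "(\<Prod>i<m. f i) = y" "i < m" for f i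
  proof -
    have "f i dvd (\<Prod>i<m. f i)" using f(3) by (intro dvd_prodI) auto
    hence "f i dvd (\<Prod>i<m. f0 i)" unfolding f(2) f0(2) .
    then obtain j where j: "j \<in> {..<m}" "f i dvd f0 j"
      using prime_dvd_prod_iff[OF finite_lessThan pr[OF f(1,3)]] by blast
    hence "f i = f0 j" using primes_dvd_imp_eq[OF pr[OF f(1,3)] pr[OF f0(1)]] by blast
    thus ?thesis using j(1) by (rule image_eqI)
  qed
  have "{f \<in> PiE {..<m} (\<lambda>_. P). (\<Prod>i<m. f i) = y} \<subseteq> PiE {..<m} (\<lambda>_. f0 ` {..<m})"
  proof
    fix f assume "f \<in> {f \<in> PiE {..<m} (\<lambda>_. P). (\<Prod>i<m. f i) = y}"
    hence f: "f \<in> PiE {..<m} (\<lambda>_. P)" "(\<Prod>i<m. f i) = y" by blast+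
    have "f i \<in> f0 ` {..<m}" if "i \<in> {..<m}" for i using sub[OF f] that by (simp only: lessThan_iff)
    moreover have "f i = undefined" if "i \<notin> {..<m}" for i using f(1) that by (rule PiE_arb)
    ultimately show "f \<in> PiE {..<m} (\<lambda>_. f0 ` {..<m})" by (rule PiE_I)
  qed
  hence "card {f \<in> PiE {..<m} (\<lambda>_. P). (\<Prod>i<m. f i) = y} \<le> card (PiE {..<m} (\<lambda>_. f0 ` {..<m}))"
    by (intro card_mono finite_PiE) auto
  also have "\<dots> = card (f0 ` {..<m}) ^ m" by (simp add: card_PiE)
  also have "\<dots> \<le> m ^ m" using card_image_le[of "{..<m}" f0] by (intro power_mono) auto
  finally show ?thesis .
next
  case True
  thus ?thesis unfolding True by simp
qed

text \<open>Expanding the square and applying reciprocity turns the varying modulus 2k + 1 into the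
  argument of a fixed character modulo \<open>e * e'\<close>. For \<open>e = e'\<close> the trivial
  bound gives \<open>N\<close> for each \<open>e\<close>; for \<open>e \<noteq> e'\<close> the
  character is nontrivial, so the sum is at most its modulus, hence at most the square of
  \<open>Z\<close>.\<close>

lemma character_mean_square:
  fixes E :: "nat set" and u :: int
  assumes finE: "finite E" and E: "\<And>e. e \<in> E \<Longrightarrow> odd e \<and> squarefree e \<and> e mod 4 = c \<and> e \<le> Z"
    and u: "u \<in> {1, -1, 2, -2}"
  shows "(\<Sum>k<N. (\<Sum>e\<in>E. jacobi (u * int e) (2 * k + 1))\<^sup>2) \<le> int (card E) * int N + (int (card E))\<^sup>2 * int (Z\<^sup>2)"
proof -
  have "(\<Sum>k<N. (\<Sum>e\<in>E. jacobi (u * int e) (2 * k + 1))\<^sup>2)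
      = (\<Sum>k<N. \<Sum>e\<in>E. \<Sum>e'\<in>E. jacobi (int (2 * k + 1)) (e * e'))"
    unfolding power2_eq_square sum_product using E u
    by (intro sum.cong refl jacobi_product_reciprocity) auto
  also have "\<dots> = (\<Sum>e\<in>E. \<Sum>e'\<in>E. \<Sum>k<N. jacobi (int (2 * k + 1)) (e * e'))"
    by (subst sum.swap) (intro sum.cong refl sum.swap)
  also have "\<dots> \<le> (\<Sum>e\<in>E. \<Sum>e'\<in>E. (if e = e' then int N else 0) + int (Z\<^sup>2))"
  proof (intro sum_mono)
    fix e e' assume e: "e \<in> E" "e' \<in> E"
    show "(\<Sum>k<N. jacobi (int (2 * k + 1)) (e * e')) \<le> (if e = e' then int N else 0) + int (Z\<^sup>2)"
    proof (cases "e = e'")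
      case True
      have "(\<Sum>k<N. jacobi (int (2 * k + 1)) (e * e')) \<le> (\<Sum>k<N. 1)"
      proof (rule sum_mono)
        fix k show "jacobi (int (2 * k + 1)) (e * e') \<le> 1"
          using jacobi_values[of "int (2 * k + 1)" "e * e'"] by auto
      qed
      also have "\<dots> \<le> int N + int (Z\<^sup>2)" by simp
      finally show ?thesis using True by simp
    next
      case False
      then obtain a where "jacobi a (e * e') = -1" using jacobi_nontrivial_product E e by blast
      hence "\<bar>\<Sum>k<N. jacobi (int (2 * k + 1)) (e * e')\<bar> \<le> int (e * e')"
        using E e by (intro jacobi_odd_sum_bound) auto
      also have "int (e * e') \<le> int (Z\<^sup>2)" using E e unfolding power2_eq_square by (intro of_nat_mono mult_mono) auto
      finally show ?thesis using False by simp
    qed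
  qed
  also have "\<dots> = int (card E) * int N + (int (card E))\<^sup>2 * int (Z\<^sup>2)"
    using finE by (simp add: sum.distrib sum.delta' power2_eq_square algebra_simps)
  finally show ?thesis .
qed

text \<open>The m-th power of a character sum over \<open>P\<close> is a sum over m-tuples of
  primes, evaluated at their products. Cauchy-Schwarz and the mean square over odd numbers bound its
  total over \<open>E\<close>. The constant collects 16^m, the square of the 4^m lost in
  \<open>biased\<close>, and m^m, the multiplicity of a product.\<close>

lemma card_few_split_primes_le:
  fixes E P :: "nat set" and u :: int and m Z Y :: nat
  assumes finE: "finite E" and E: "\<And>e. e \<in> E \<Longrightarrow> odd e \<and> squarefree e \<and> e mod 4 = c \<and> e \<le> Z"
    and u: "u \<in> {1, -1, 2, -2}"
    and finP: "finite P" and P: "\<And>p. p \<in> P \<Longrightarrow> prime p \<and> odd p \<and> p \<le> Y"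
    and biased: "\<And>e. e \<in> E \<Longrightarrow> real (card P) \<le> 4 * \<bar>\<Sum>p\<in>P. real_of_int (Legendre (u * int e) (int p))\<bar>"
    and m: "even m" "m > 0"
    and big: "2 * (16 * real m) ^ m * real Z ^ 2 \<le> real (card P) ^ m"
  shows "real (card E) * real (card P) ^ m \<le> 2 * (16 * real m) ^ m * real Y ^ m"
proof -
  define g where "g e n = real_of_int (jacobi (u * int e) n)" for e n
  define T where "T n = (\<Sum>e\<in>E. g e n)" for n
  define F where "F = PiE {..<m} (\<lambda>_. P)"
  define pr where "pr f = (\<Prod>i<m. f i)" for f :: "nat \<Rightarrow> nat"
  have finF: "finite F" unfolding F_def using finP by (intro finite_PiE) auto
  have cF: "card F = card P ^ m" by (simp add: F_def card_PiE)
  have fP: "prime (f i) \<and> odd (f i) \<and> f i \<le> Y" if "f \<in> F" "i < m" for f i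
    using that P by (auto simp: F_def PiE_iff)
  have gprod: "(\<Prod>i\<in>A. g e (f i)) = g e (\<Prod>i\<in>A. f i)" if "\<And>i. i \<in> A \<Longrightarrow> f i > 0" "finite A" for e A and f :: "nat \<Rightarrow> nat"
    using that(2,1)
  proof (induction A)
    case (insert x A)
    thus ?case by (simp add: g_def jacobi_mult_right prod_pos)
  qed (simp add: g_def)
  \<comment> \<open>Since \<open>m\<close> is even, the m-th powers are nonnegative whatever the
    sign of the bias, and different \<open>e\<close> cannot cancel.\<close>
  have "real (card E) * (real (card P) / 4) ^ m \<le> (\<Sum>e\<in>E. (\<Sum>p\<in>P. g e p) ^ m)"
  proof -
    have "(real (card P) / 4) ^ m \<le> (\<Sum>p\<in>P. g e p) ^ m" if "e \<in> E" for e
    proof -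
      have "(\<Sum>p\<in>P. g e p) = (\<Sum>p\<in>P. real_of_int (Legendre (u * int e) (int p)))"
        using P by (intro sum.cong) (auto simp: g_def)
      hence "real (card P) / 4 \<le> \<bar>\<Sum>p\<in>P. g e p\<bar>" using biased[OF that] by simp
      hence "(real (card P) / 4) ^ m \<le> \<bar>\<Sum>p\<in>P. g e p\<bar> ^ m" by (intro power_mono) auto
      thus ?thesis using m(1) by (simp add: power_even_abs)
    qed
    hence "(\<Sum>e\<in>E. (real (card P) / 4) ^ m) \<le> (\<Sum>e\<in>E. (\<Sum>p\<in>P. g e p) ^ m)" by (intro sum_mono)
    thus ?thesis by simp
  qed
  also have "(\<Sum>e\<in>E. (\<Sum>p\<in>P. g e p) ^ m) = (\<Sum>e\<in>E. \<Sum>f\<in>F. g e (pr f))"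
  proof (intro sum.cong refl)
    fix e
    have "(\<Sum>p\<in>P. g e p) ^ m = (\<Prod>i<m. \<Sum>p\<in>P. g e p)" by simp
    also have "\<dots> = (\<Sum>f\<in>F. \<Prod>i<m. g e (f i))" unfolding F_def using finP by (intro prod_sum_PiE) auto
    also have "\<dots> = (\<Sum>f\<in>F. g e (pr f))" unfolding pr_def
      using fP by (intro sum.cong refl gprod) (auto simp: prime_gt_0_nat)
    finally show "(\<Sum>p\<in>P. g e p) ^ m = (\<Sum>f\<in>F. g e (pr f))" .
  qed
  also have "\<dots> = (\<Sum>f\<in>F. T (pr f))" unfolding T_def by (rule sum.swap)
  finally have S: "real (card E) * (real (card P) / 4) ^ m \<le> (\<Sum>f\<in>F. T (pr f))" .
  \<comment> \<open>Tuples are grouped by their product, at most \<open>m ^ m\<close> in each group.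
    By positivity the set of products may then be enlarged to all odd numbers 2k + 1 with k < Y^m,
    where the mean square is known.\<close>
  have sq: "(\<Sum>f\<in>F. (T (pr f))\<^sup>2) \<le> real (m ^ m) * (real (card E) * real (Y ^ m) + (real (card E))\<^sup>2 * real (Z\<^sup>2))"
  proof -
    have prF: "pr ` F \<subseteq> (\<lambda>k. 2 * k + 1) ` {..<Y ^ m}"
    proof
      fix y assume "y \<in> pr ` F"
      then obtain f where f: "f \<in> F" "y = pr f" by blast
      have "odd y" using fP[OF f(1)] unfolding f(2) pr_def by (simp add: even_prod_iff)
      then obtain k where k: "y = 2 * k + 1" by (auto elim: oddE)
      have "y \<le> (\<Prod>i<m. Y)" unfolding f(2) pr_def using fP[OF f(1)] by (intro prod_mono) auto
      hence "k < Y ^ m" using k by simp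
      thus "y \<in> (\<lambda>k. 2 * k + 1) ` {..<Y ^ m}" using k by blast
    qed
    have "(\<Sum>f\<in>F. (T (pr f))\<^sup>2) = (\<Sum>y\<in>pr ` F. \<Sum>f\<in>{f. f \<in> F \<and> pr f = y}. (T (pr f))\<^sup>2)"
      using finF by (rule sum.image_gen)
    also have "\<dots> = (\<Sum>y\<in>pr ` F. real (card {f. f \<in> F \<and> pr f = y}) * (T y)\<^sup>2)"
      by (intro sum.cong refl) simp
    also have "\<dots> \<le> (\<Sum>y\<in>pr ` F. real (m ^ m) * (T y)\<^sup>2)"
    proof (intro sum_mono mult_right_mono of_nat_mono)
      fix y
      show "card {f. f \<in> F \<and> pr f = y} \<le> m ^ m"
        unfolding F_def pr_def using card_prime_tuples_with_product[OF finP] P by blast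
    qed auto
    also have "\<dots> \<le> (\<Sum>y\<in>(\<lambda>k. 2 * k + 1) ` {..<Y ^ m}. real (m ^ m) * (T y)\<^sup>2)"
      using prF by (intro sum_mono2) auto
    also have "\<dots> = (\<Sum>k<Y ^ m. real (m ^ m) * (T (2 * k + 1))\<^sup>2)"
      by (subst sum.reindex) (auto simp: inj_on_def)
    also have "\<dots> = real (m ^ m) * real_of_int (\<Sum>k<Y ^ m. (\<Sum>e\<in>E. jacobi (u * int e) (2 * k + 1))\<^sup>2)"
      by (simp add: T_def g_def sum_distrib_left)
    also have "\<dots> \<le> real (m ^ m) * real_of_int (int (card E) * int (Y ^ m) + (int (card E))\<^sup>2 * int (Z\<^sup>2))"
      using character_mean_square[OF finE E u, of "Y ^ m"] by (intro mult_left_mono) (simp only: of_int_le_iff, simp)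
    finally show ?thesis by simp
  qed
  show ?thesis
  proof (cases "card E = 0")
    case False
    define n where "n = real (card E)"
    define \<pi> where "\<pi> = real (card P) ^ m"
    define M where "M = (16 * real m) ^ m"
    have n0: "n > 0" using False by (simp add: n_def)
    have "(\<Sum>f\<in>F. T (pr f))\<^sup>2 \<le> (\<Sum>f\<in>F. (T (pr f))\<^sup>2) * real (card F)"
      by (rule sum_squared_le_sum_of_squares)
    also have "\<dots> \<le> real (m ^ m) * (n * real (Y ^ m) + n\<^sup>2 * real (Z\<^sup>2)) * \<pi>"
      using sq by (intro mult_mono) (auto simp: cF n_def \<pi>_def)
    finally have CS: "(\<Sum>f\<in>F. T (pr f))\<^sup>2 \<le> real (m ^ m) * (n * real (Y ^ m) + n\<^sup>2 * real (Z\<^sup>2)) * \<pi>" .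
    have "(n * (real (card P) / 4) ^ m)\<^sup>2 \<le> (\<Sum>f\<in>F. T (pr f))\<^sup>2"
      using S unfolding n_def by (intro power_mono) auto
    also have "(n * (real (card P) / 4) ^ m)\<^sup>2 = n\<^sup>2 * \<pi>\<^sup>2 / 16 ^ m"
    proof -
      have "(4::real) ^ m * 4 ^ m = 16 ^ m" by (simp flip: power_mult_distrib)
      thus ?thesis unfolding \<pi>_def by (simp add: power2_eq_square power_divide)
    qed
    finally have "n\<^sup>2 * \<pi>\<^sup>2 / 16 ^ m \<le> real (m ^ m) * (n * real (Y ^ m) + n\<^sup>2 * real (Z\<^sup>2)) * \<pi>" using CS by linarith
    hence "n\<^sup>2 * \<pi>\<^sup>2 \<le> M * (n * real (Y ^ m) + n\<^sup>2 * real (Z\<^sup>2)) * \<pi>"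
      by (simp add: M_def power_mult_distrib field_simps)
    hence "n * \<pi> * (n * \<pi>) \<le> n * \<pi> * (M * (real (Y ^ m) + n * real (Z\<^sup>2)))"
      by (simp add: power2_eq_square algebra_simps)
    moreover have M0: "M > 0" unfolding M_def using m by simp
    have "\<pi> \<ge> 0" by (simp add: \<pi>_def)
    show ?thesis
    proof (cases "\<pi> = 0")
      case True
      thus ?thesis by (simp add: \<pi>_def[symmetric] n_def[symmetric])
    next
      case False
      hence np: "n * \<pi> > 0" using n0 \<open>\<pi> \<ge> 0\<close> by simp
      with calculation have "n * \<pi> \<le> M * (real (Y ^ m) + n * real (Z\<^sup>2))" by (simp only: mult_le_cancel_left_pos)
      \<comment> \<open>By \<open>big\<close> the off-diagonal part is at most half of the left side
        and is absorbed there; this causes the factor 2 in the conclusion.\<close>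
      moreover have "2 * (M * (n * real (Z\<^sup>2))) \<le> n * \<pi>"
        using mult_left_mono[OF big, of n] n0 by (simp add: M_def \<pi>_def mult_ac)
      ultimately have "n * \<pi> \<le> 2 * M * real (Y ^ m)" by (simp add: algebra_simps)
      thus ?thesis by (simp add: n_def \<pi>_def M_def)
    qed
  qed simp
qed

section \<open>Elements of quadratic fields\<close>

text \<open>If b is the denominator of \<open>q\<close>, every power b^k divides the nonzero integer
  \<open>E\<close>, so b = 1.\<close>

lemma rat_powers_bounded_denominator_imp_int:
  fixes q :: rat and E :: int
  assumes "E \<noteq> 0" and "\<And>k. of_int E * q ^ k \<in> \<int>"
  shows "q \<in> \<int>"
proof -
  obtain a b where q: "quotient_of q = (a, b)" by fastforce
  have b: "b > 0" and cop: "coprime a b" and qab: "q = of_int a / of_int b"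
    using q quotient_of_denom_pos quotient_of_coprime quotient_of_div by auto
  have dvd: "b ^ k dvd E" for k
  proof -
    obtain m where "of_int E * q ^ k = of_int m" using assms(2)[of k] by (auto elim: Ints_cases)
    hence "of_int (E * a ^ k) = (of_int (m * b ^ k) :: rat)"
      using b by (simp add: qab power_divide field_simps)
    hence "E * a ^ k = m * b ^ k" using of_int_eq_iff by blast
    hence "b ^ k dvd a ^ k * E" by (metis dvd_triv_right mult.commute)
    moreover have "coprime (b ^ k) (a ^ k)" using cop by (simp add: coprime_commute)
    ultimately show ?thesis using coprime_dvd_mult_right_iff by blast
  qed
  have "b = 1"
  proof (rule ccontr)
    assume "b \<noteq> 1"
    with b have b2: "b \<ge> 2" by simp
    define k where "k = nat \<bar>E\<bar>"
    have "b ^ k \<le> \<bar>E\<bar>" using dvd[of k] assms(1) b by (simp add: zdvd_imp_le)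
    moreover have "(2::int) ^ k \<le> b ^ k" using b2 by (intro power_mono) auto
    moreover have "int k < 2 ^ k" using of_nat_less_two_power by blast
    ultimately show False unfolding k_def by linarith
  qed
  thus ?thesis using qab by simp
qed

text \<open>The square of the denominator of \<open>q\<close> would divide \<open>d\<close>.\<close>

lemma squarefree_mult_rat_square_int:
  fixes d :: int and q :: rat
  assumes "squarefree d" and "of_int d * q\<^sup>2 \<in> \<int>"
  shows "q \<in> \<int>"
proof -
  obtain a b where q: "quotient_of q = (a, b)" by fastforce
  have b: "b > 0" and cop: "coprime a b" and qab: "q = of_int a / of_int b"
    using q quotient_of_denom_pos quotient_of_coprime quotient_of_div by auto
  obtain m where "of_int d * q\<^sup>2 = of_int m" using assms(2) by (auto elim: Ints_cases)
  hence "of_int (d * a\<^sup>2) = (of_int (m * b\<^sup>2) :: rat)"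
    using b by (simp add: qab power_divide field_simps)
  hence "d * a\<^sup>2 = m * b\<^sup>2" using of_int_eq_iff by blast
  hence "b\<^sup>2 dvd a\<^sup>2 * d" by (metis dvd_triv_right mult.commute)
  moreover have "coprime (b\<^sup>2) (a\<^sup>2)" using cop by (simp add: coprime_commute)
  ultimately have "b\<^sup>2 dvd d" using coprime_dvd_mult_right_iff by blast
  hence "b dvd 1" using assms(1) by (auto simp: squarefree_def)
  with b have "b = 1" by simp
  thus ?thesis using qab by simp
qed

lemma int_subgroup_principal:
  fixes S :: "int set"
  assumes "0 \<in> S" and "\<And>x y. x \<in> S \<Longrightarrow> y \<in> S \<Longrightarrow> x - y \<in> S"
  shows "\<exists>g\<ge>0. S = range (\<lambda>k. k * g)"
proof (cases "S = {0}")
  case True thus ?thesis by (intro exI[of _ 0]) auto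
next
  case False
  have neg: "- x \<in> S" if "x \<in> S" for x using assms(2)[OF assms(1) that] by simp
  have add: "x + y \<in> S" if "x \<in> S" "y \<in> S" for x y using assms(2)[OF that(1) neg[OF that(2)]] by simp
  obtain x where "x \<in> S" "x \<noteq> 0" using False assms(1) by blast
  hence ex: "\<exists>n. n > 0 \<and> int n \<in> S"
    using neg[of x] by (intro exI[of _ "nat \<bar>x\<bar>"]) (auto simp: abs_if)
  define g where "g = (LEAST n. n > 0 \<and> int n \<in> S)"
  have g: "g > 0" "int g \<in> S" using LeastI_ex[OF ex] by (auto simp: g_def)
  have gmin: "n \<ge> g" if "n > 0" "int n \<in> S" for n using that by (auto simp: g_def intro: Least_le)
  have multn: "int n * int g \<in> S" for n
    by (induction n) (use assms(1) g add in \<open>auto simp: algebra_simps\<close>)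
  have mult: "k * int g \<in> S" for k
  proof (cases "k \<ge> 0")
    case True thus ?thesis using multn[of "nat k"] by simp
  next
    case False thus ?thesis using neg[OF multn[of "nat (-k)"]] by simp
  qed
  have "y \<in> range (\<lambda>k. k * int g)" if "y \<in> S" for y
  proof -
    have "y - (y div int g) * int g \<in> S" using assms(2)[OF that mult] .
    hence "y mod int g \<in> S" by (simp add: minus_div_mult_eq_mod)
    moreover have "0 \<le> y mod int g" "y mod int g < int g" using g by auto
    ultimately have "y mod int g = 0" using gmin[of "nat (y mod int g)"] by force
    thus ?thesis by (metis div_mult_mod_eq add.right_neutral rangeI)
  qed
  thus ?thesis using mult by (intro exI[of _ "int g"]) auto
qed

definition sqd :: "int \<Rightarrow> complex" where
  "sqd d = csqrt (of_int d)"

definition quad_set :: "int \<Rightarrow> complex set" where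
  "quad_set d = {of_rat a + of_rat b * sqd d | a b. True}"

lemma sqd_mult_self: "sqd d * sqd d = of_int d"
  using power2_csqrt[of "of_int d"] by (simp add: sqd_def power2_eq_square)

text \<open>Every quadratic field has the form \<rat>(\<surd>d) with such a \<open>d\<close>.
  Squarefreeness excludes 0, and together with \<open>d1\<close> it makes the square root
  irrational.\<close>

locale quad =
  fixes d :: int
  assumes sqf: "squarefree d" and d1: "d \<noteq> 1"
begin

abbreviation s :: complex where "s \<equiv> sqd d"
abbreviation K :: "complex set" where "K \<equiv> quad_set d"
abbreviation Ok :: "complex set" where "Ok \<equiv> ring_of_integers K"

lemma d0: "d \<noteq> 0" using sqf by auto

lemma s_s: "s * s = of_rat (of_int d)" by (simp add: sqd_mult_self)

lemma s_irrational: "s \<noteq> of_rat q"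
proof
  assume sq: "s = of_rat q"
  have "of_rat (of_int d) = (of_rat (q * q) :: complex)"
    using s_s unfolding sq by (simp add: of_rat_mult)
  hence e: "of_int d = q * q" using of_rat_eq_iff by blast
  obtain a b where q: "quotient_of q = (a, b)" by fastforce
  have b: "b > 0" and cop: "coprime a b" and qab: "q = of_int a / of_int b"
    using q quotient_of_denom_pos quotient_of_coprime quotient_of_div by auto
  have "of_int (d * b\<^sup>2) = (of_int (a\<^sup>2) :: rat)"
    using e b by (simp add: qab power2_eq_square field_simps)
  hence "d * b\<^sup>2 = a\<^sup>2" using of_int_eq_iff by blast
  hence "b\<^sup>2 dvd a\<^sup>2" by (metis dvd_triv_right)
  hence "b\<^sup>2 dvd 1" using cop
    by (metis coprime_power_left_iff coprime_power_right_iff coprime_common_divisor dvd_refl)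
  hence "b = 1" using b by (simp add: power2_eq_square zmult_eq_1_iff)
  with \<open>d * b\<^sup>2 = a\<^sup>2\<close> have da: "d = a\<^sup>2" by simp
  hence "a dvd 1" using sqf by (auto simp: squarefree_def)
  hence "d = 1" using da by (auto simp: power2_eq_square abs_if split: if_splits)
  thus False using d1 by simp
qed

lemma rep_unique:
  "of_rat a + of_rat b * s = of_rat a' + of_rat b' * s \<longleftrightarrow> a = a' \<and> b = b'"
proof
  assume e: "of_rat a + of_rat b * s = of_rat a' + of_rat b' * s"
  have e2: "of_rat (b - b') * s = of_rat (a' - a)" using e by (simp add: of_rat_diff algebra_simps)
  have "b = b'"
  proof (rule ccontr)
    assume ne: "b \<noteq> b'"
    have "s = of_rat ((a' - a) / (b - b'))"
      using e2 ne by (simp add: of_rat_divide field_simps)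
    thus False using s_irrational by blast
  qed
  thus "a = a' \<and> b = b'" using e by simp
qed simp

text \<open>Coordinates, conjugate, trace and norm, with arbitrary values outside \<open>K\<close>.\<close>

definition rp :: "complex \<Rightarrow> rat" where "rp z = (SOME a. \<exists>b. z = of_rat a + of_rat b * s)"
definition ip :: "complex \<Rightarrow> rat" where "ip z = (SOME b. \<exists>a. z = of_rat a + of_rat b * s)"
definition cj :: "complex \<Rightarrow> complex" where "cj z = of_rat (rp z) - of_rat (ip z) * s"
definition tr :: "complex \<Rightarrow> rat" where "tr z = 2 * rp z"
definition nm :: "complex \<Rightarrow> rat" where "nm z = (rp z)\<^sup>2 - of_int d * (ip z)\<^sup>2"

lemma rp_rep [simp]: "rp (of_rat a + of_rat b * s) = a"
  unfolding rp_def by (rule some_equality) (auto simp: rep_unique)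
lemma ip_rep [simp]: "ip (of_rat a + of_rat b * s) = b"
  unfolding ip_def by (rule some_equality) (auto simp: rep_unique)
lemma cj_rep [simp]: "cj (of_rat a + of_rat b * s) = of_rat a - of_rat b * s"
  by (simp add: cj_def)

lemma K_cases: assumes "z \<in> K" obtains a b where "z = of_rat a + of_rat b * s"
  using assms by (auto simp: quad_set_def)
lemma K_eq: "z \<in> K \<Longrightarrow> z = of_rat (rp z) + of_rat (ip z) * s"
  by (elim K_cases) simp
lemma rep_in_K [simp, intro]: "of_rat a + of_rat b * s \<in> K" by (auto simp: quad_set_def)
lemma rat_in_K [simp, intro]: "of_rat a \<in> K" using rep_in_K[of a 0] by simp
lemma int_in_K [simp, intro]: "of_int a \<in> K" using rat_in_K[of "of_int a"] by simp
lemma zero_one_in_K [simp, intro]: "0 \<in> K" "1 \<in> K" using int_in_K[of 0] int_in_K[of 1] by auto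
lemma s_in_K [simp, intro]: "s \<in> K" using rep_in_K[of 0 1] by simp

lemma rep_add: "(of_rat a + of_rat b * s) + (of_rat a' + of_rat b' * s) = of_rat (a + a') + of_rat (b + b') * s"
  by (simp add: of_rat_add algebra_simps)
lemma rep_mult: "(of_rat a + of_rat b * s) * (of_rat a' + of_rat b' * s)
    = of_rat (a * a' + of_int d * b * b') + of_rat (a * b' + b * a') * s"
proof -
  have "(of_rat a + of_rat b * s) * (of_rat a' + of_rat b' * s)
    = of_rat (a * a') + of_rat b * of_rat b' * (s * s) + of_rat (a * b' + b * a') * s"
    by (simp add: of_rat_add of_rat_mult algebra_simps)
  also have "\<dots> = of_rat (a * a' + of_int d * b * b') + of_rat (a * b' + b * a') * s"
    unfolding s_s by (simp add: of_rat_add of_rat_mult algebra_simps)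
  finally show ?thesis .
qed
lemma rep_uminus: "- (of_rat a + of_rat b * s) = of_rat (-a) + of_rat (-b) * s"
  by (simp add: of_rat_minus)

lemma K_add [intro, simp]: "x \<in> K \<Longrightarrow> y \<in> K \<Longrightarrow> x + y \<in> K"
  by (elim K_cases) (simp only: rep_add rep_in_K)
lemma K_mult [intro, simp]: "x \<in> K \<Longrightarrow> y \<in> K \<Longrightarrow> x * y \<in> K"
  by (elim K_cases) (simp only: rep_mult rep_in_K)
lemma K_uminus [intro, simp]: "x \<in> K \<Longrightarrow> - x \<in> K"
  by (elim K_cases) (simp only: rep_uminus rep_in_K)
lemma K_diff [intro, simp]: "x \<in> K \<Longrightarrow> y \<in> K \<Longrightarrow> x - y \<in> K"
  using K_add[of x "-y"] by simp
lemma K_power [intro, simp]: "x \<in> K \<Longrightarrow> x ^ n \<in> K"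
  by (induction n) auto

lemma cj_in_K [intro, simp]: "x \<in> K \<Longrightarrow> cj x \<in> K"
  using rep_in_K[of "rp x" "- ip x"] by (simp add: cj_def of_rat_minus)
lemma cj_rat [simp]: "cj (of_rat a) = of_rat a" using cj_rep[of a 0] by simp
lemma cj_int [simp]: "cj (of_int a) = of_int a" using cj_rat[of "of_int a"] by simp
lemma cj_01 [simp]: "cj 0 = 0" "cj 1 = 1" using cj_int[of 0] cj_int[of 1] by auto
lemma cj_s [simp]: "cj s = - s" using cj_rep[of 0 1] by simp
lemma cj_add [simp]: "x \<in> K \<Longrightarrow> y \<in> K \<Longrightarrow> cj (x + y) = cj x + cj y"
  by (elim K_cases) (simp only: rep_add cj_rep, simp add: of_rat_add algebra_simps)
lemma cj_cj [simp]: "x \<in> K \<Longrightarrow> cj (cj x) = x"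
proof (elim K_cases)
  fix a b assume x: "x = of_rat a + of_rat b * s"
  show ?thesis using cj_rep[of a "-b"] by (simp add: x of_rat_minus)
qed
lemma cj_mult [simp]: "x \<in> K \<Longrightarrow> y \<in> K \<Longrightarrow> cj (x * y) = cj x * cj y"
proof (elim K_cases)
  fix a b a' b' assume x: "x = of_rat a + of_rat b * s" "y = of_rat a' + of_rat b' * s"
  have "cj x * cj y = (of_rat a + of_rat (-b) * s) * (of_rat a' + of_rat (-b') * s)"
    by (simp add: x of_rat_minus)
  also have "\<dots> = cj (x * y)"
    unfolding x rep_mult cj_rep by (simp add: of_rat_minus of_rat_add of_rat_mult of_rat_diff algebra_simps)
  finally show ?thesis ..
qed
lemma cj_uminus [simp]: "x \<in> K \<Longrightarrow> cj (- x) = - cj x"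
  using cj_mult[of "-1" x] cj_int[of "-1"] int_in_K[of "-1"] by simp
lemma cj_diff [simp]: "x \<in> K \<Longrightarrow> y \<in> K \<Longrightarrow> cj (x - y) = cj x - cj y"
  using cj_add[of x "-y"] by simp
lemma cj_power [simp]: "x \<in> K \<Longrightarrow> cj (x ^ n) = cj x ^ n"
  by (induction n) auto

lemma tr_eq: "x \<in> K \<Longrightarrow> x + cj x = of_rat (tr x)"
  by (elim K_cases) (simp add: tr_def of_rat_mult)
lemma nm_eq: "x \<in> K \<Longrightarrow> x * cj x = of_rat (nm x)"
proof (elim K_cases)
  fix a b assume x: "x = of_rat a + of_rat b * s"
  have "x * cj x = (of_rat a + of_rat b * s) * (of_rat a + of_rat (-b) * s)" by (simp add: x of_rat_minus)
  also have "\<dots> = of_rat (nm x)" unfolding rep_mult nm_def x by (simp add: power2_eq_square)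
  finally show ?thesis .
qed
lemma nm_mult: assumes "x \<in> K" "y \<in> K" shows "nm (x * y) = nm x * nm y"
proof -
  have "(of_rat (nm (x * y)) :: complex) = of_rat (nm x * nm y)"
    using assms nm_eq[of "x * y"] by (simp add: of_rat_mult nm_eq[symmetric])
  thus ?thesis by simp
qed
lemma nm_power: "x \<in> K \<Longrightarrow> nm (x ^ n) = nm x ^ n"
proof (induction n)
  case 0 have "nm 1 = 1" using rp_rep[of 1 0] ip_rep[of 1 0] by (simp add: nm_def)
  thus ?case by simp
qed (simp add: nm_mult)
lemma nm_rat [simp]: "nm (of_rat a) = a\<^sup>2"
  using rp_rep[of a 0] ip_rep[of a 0] by (simp add: nm_def)
lemma tr_rat [simp]: "tr (of_rat a) = 2 * a"
  using rp_rep[of a 0] by (simp add: tr_def)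

lemma nm_cj: "x \<in> K \<Longrightarrow> nm (cj x) = nm x"
  using nm_eq[of x] nm_eq[of "cj x"] by (simp add: mult.commute)
lemma tr_cj: "x \<in> K \<Longrightarrow> tr (cj x) = tr x"
  using tr_eq[of x] tr_eq[of "cj x"] by (simp add: add.commute)

lemma cj_eq_0_iff [simp]: "x \<in> K \<Longrightarrow> cj x = 0 \<longleftrightarrow> x = 0"
  by (metis cj_cj cj_01(1))
lemma nm_eq_0_iff: "x \<in> K \<Longrightarrow> nm x = 0 \<longleftrightarrow> x = 0"
  using nm_eq[of x] by (metis cj_eq_0_iff mult_eq_0_iff of_rat_eq_0_iff)
lemma K_inverse [intro, simp]: "x \<in> K \<Longrightarrow> inverse x \<in> K"
proof (cases "x = 0")
  case False
  assume x: "x \<in> K"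
  have "inverse x = of_rat (inverse (nm x)) * cj x"
    using False x nm_eq_0_iff[OF x] by (simp add: of_rat_inverse nm_eq[OF x, symmetric])
  thus ?thesis using x by auto
qed simp
lemma K_divide [intro, simp]: "x \<in> K \<Longrightarrow> y \<in> K \<Longrightarrow> x / y \<in> K"
  by (simp add: divide_inverse)
lemma cj_inverse [simp]: assumes "x \<in> K" shows "cj (inverse x) = inverse (cj x)"
proof (cases "x = 0")
  case False
  have "cj x * cj (inverse x) = cj (x * inverse x)" using assms by simp
  also have "\<dots> = 1" using False by simp
  finally show ?thesis by (metis inverse_unique)
qed simp
lemma cj_divide [simp]: "x \<in> K \<Longrightarrow> y \<in> K \<Longrightarrow> cj (x / y) = cj x / cj y"
  by (simp add: divide_inverse)

section \<open>Integrality in quadratic fields\<close>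

text \<open>The order \<int>[\<surd>d]. Membership in it is a statement about integer coordinates,
  so it measures denominators before the algebraic integers of \<open>K\<close> are known to form a
  ring.\<close>

definition Zs :: "complex set" where "Zs = {of_int m + of_int n * s | m n. True}"

lemma Zs_0 [simp]: "0 \<in> Zs" by (auto simp: Zs_def intro!: exI[of _ 0])
lemma Zs_add: "x \<in> Zs \<Longrightarrow> y \<in> Zs \<Longrightarrow> x + y \<in> Zs"
  unfolding Zs_def
  by clarsimp (metis (no_types, opaque_lifting) add.assoc add.left_commute distrib_right of_int_add)
lemma Zs_mult: assumes "x \<in> Zs" "y \<in> Zs" shows "x * y \<in> Zs"
proof -
  obtain a b a' b' where x: "x = of_int a + of_int b * s" "y = of_int a' + of_int b' * s"
    using assms by (auto simp: Zs_def)
  have "x * y = of_int (a * a' + d * b * b') + of_int (a * b' + b * a') * s"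
    using sqd_mult_self[of d] by (simp add: x algebra_simps)
  thus ?thesis unfolding Zs_def by blast
qed
lemma Zs_int [simp]: "of_int m \<in> Zs"
  unfolding Zs_def by (rule CollectI, rule exI[of _ m], rule exI[of _ 0]) simp
lemma Zs_nat [simp]: "of_nat m \<in> Zs" using Zs_int[of "int m"] by simp
lemma Zs_s [simp]: "s \<in> Zs"
  unfolding Zs_def by (rule CollectI, rule exI[of _ 0], rule exI[of _ 1]) simp
lemma Zs_sum: "(\<And>i. i \<in> A \<Longrightarrow> f i \<in> Zs) \<Longrightarrow> sum f A \<in> Zs"
  by (induction A rule: infinite_finite_induct) (auto intro: Zs_add)
lemma Zs_uminus: "x \<in> Zs \<Longrightarrow> - x \<in> Zs" using Zs_mult[OF Zs_int[of "-1"], of x] by simp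

lemma K_denominator: assumes "z \<in> K" obtains D :: int where "D > 0" "of_int D * z \<in> Zs"
proof -
  obtain a b where z: "z = of_rat a + of_rat b * s" using assms by (rule K_cases)
  obtain p q where pq: "quotient_of a = (p, q)" by fastforce
  obtain p' q' where pq': "quotient_of b = (p', q')" by fastforce
  have q: "q > 0" "q' > 0" "a = of_int p / of_int q" "b = of_int p' / of_int q'"
    using pq pq' quotient_of_denom_pos quotient_of_div by auto
  have "of_int (q * q') * z = of_int (p * q') + of_int (p' * q) * s"
    using q(1,2) unfolding z q(3,4) by (simp add: of_rat_divide field_simps)
  hence "of_int (q * q') * z \<in> Zs" unfolding Zs_def by blast
  thus ?thesis using that[of "q * q'"] q by simp
qed

text \<open>Integrality in a form that is visibly inherited by sums and products.\<close>

definition bounded_powers :: "complex \<Rightarrow> bool" where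
  "bounded_powers z \<longleftrightarrow> (\<exists>D::int. D > 0 \<and> (\<forall>k. of_int D * z ^ k \<in> Zs))"

text \<open>A single denominator clears the powers below the degree of a monic equation; the
  equation rewrites every higher power as an integer combination of lower ones.\<close>

lemma algebraic_int_bounded_powers:
  assumes "z \<in> K" "algebraic_int z" shows "bounded_powers z"
proof -
  obtain p where p: "lead_coeff p = 1" "\<forall>i. coeff p i \<in> \<int>" "poly p z = 0"
    using assms(2) by (auto elim: algebraic_int.cases)
  define n where "n = degree p"
  have "\<forall>i. \<exists>D::int. D > 0 \<and> of_int D * z ^ i \<in> Zs"
    using K_denominator[OF K_power[OF assms(1)]] by metis
  then obtain Df :: "nat \<Rightarrow> int" where Df: "\<And>i. Df i > 0" "\<And>i. of_int (Df i) * z ^ i \<in> Zs" by metis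
  define D where "D = (\<Prod>i<n. Df i)"
  have D: "D > 0" unfolding D_def using Df(1) by (intro prod_pos) auto
  have small: "of_int D * z ^ i \<in> Zs" if "i < n" for i
  proof -
    have "D = (\<Prod>j\<in>{..<n} - {i}. Df j) * Df i"
      unfolding D_def using that by (subst prod.remove[of _ i]) (auto simp: mult.commute)
    hence "of_int D * z ^ i = of_int (\<Prod>j\<in>{..<n} - {i}. Df j) * (of_int (Df i) * z ^ i)" by simp
    thus ?thesis using Zs_mult[OF Zs_int Df(2)] by metis
  qed
  have "of_int D * z ^ k \<in> Zs" for k
  proof (induction k rule: less_induct)
    case (less k)
    show ?case
    proof (cases "k < n")
      case False
      have "(\<Sum>i\<le>n. coeff p i * z ^ i) = 0" using p(3) by (simp add: poly_altdef n_def)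
      moreover have "(\<Sum>i\<le>n. coeff p i * z ^ i) = (\<Sum>i<n. coeff p i * z ^ i) + z ^ n"
        using p(1) by (simp add: lessThan_Suc_atMost[symmetric] n_def)
      ultimately have zn: "z ^ n = - (\<Sum>i<n. coeff p i * z ^ i)" by (simp add: eq_neg_iff_add_eq_0 add.commute)
      have "z ^ k = z ^ (k - n) * z ^ n" using False by (simp add: power_add[symmetric])
      also have "\<dots> = - (\<Sum>i<n. coeff p i * z ^ (k - n + i))"
        unfolding zn by (simp add: sum_distrib_left power_add algebra_simps)
      finally have "of_int D * z ^ k = - (\<Sum>i<n. coeff p i * (of_int D * z ^ (k - n + i)))"
        by (simp add: sum_distrib_left algebra_simps)
      moreover have "coeff p i * (of_int D * z ^ (k - n + i)) \<in> Zs" if "i < n" for i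
      proof -
        obtain c where "coeff p i = of_int c" using p(2) by (auto elim: Ints_cases)
        thus ?thesis using less[of "k - n + i"] False that by (auto intro: Zs_mult)
      qed
      ultimately show ?thesis by (auto intro!: Zs_uminus Zs_sum)
    qed (use small in auto)
  qed
  thus ?thesis using D unfolding bounded_powers_def by blast
qed

lemma bounded_powers_add:
  assumes "bounded_powers x" "bounded_powers y" shows "bounded_powers (x + y)"
proof -
  obtain D E where D: "D > 0" "\<And>k. of_int D * x ^ k \<in> Zs" and E: "E > 0" "\<And>k. of_int E * y ^ k \<in> Zs"
    using assms unfolding bounded_powers_def by blast
  have "of_int (D * E) * (x + y) ^ k \<in> Zs" for k
  proof -
    have "of_int (D * E) * (x + y) ^ k
        = (\<Sum>i\<le>k. of_nat (k choose i) * ((of_int D * x ^ i) * (of_int E * y ^ (k - i))))"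
      by (simp add: binomial_ring sum_distrib_left algebra_simps)
    also have "\<dots> \<in> Zs" by (intro Zs_sum Zs_mult[OF Zs_nat Zs_mult[OF D(2) E(2)]])
    finally show ?thesis .
  qed
  thus ?thesis unfolding bounded_powers_def using D(1) E(1) by (intro exI[of _ "D * E"]) auto
qed

lemma bounded_powers_mult:
  assumes "bounded_powers x" "bounded_powers y" shows "bounded_powers (x * y)"
proof -
  obtain D E where D: "D > 0" "\<And>k. of_int D * x ^ k \<in> Zs" and E: "E > 0" "\<And>k. of_int E * y ^ k \<in> Zs"
    using assms unfolding bounded_powers_def by blast
  have "of_int (D * E) * (x * y) ^ k \<in> Zs" for k
    using Zs_mult[OF D(2)[of k] E(2)[of k]] by (simp add: power_mult_distrib algebra_simps)
  thus ?thesis unfolding bounded_powers_def using D(1) E(1) by (intro exI[of _ "D * E"]) auto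
qed

text \<open>Taking norms turns a common denominator \<open>D\<close> for the powers of
  \<open>z\<close> into the common denominator D^2 for the powers of a rational number.\<close>

lemma bounded_powers_nm:
  assumes "z \<in> K" "bounded_powers z" shows "nm z \<in> \<int>"
proof -
  obtain D where D: "D > 0" "\<And>k. of_int D * z ^ k \<in> Zs"
    using assms unfolding bounded_powers_def by blast
  show ?thesis
  proof (rule rat_powers_bounded_denominator_imp_int)
    show "D * D \<noteq> 0" using D by simp
    fix k
    obtain m n where mn: "of_int D * z ^ k = of_int m + of_int n * s" using D(2)[of k] by (auto simp: Zs_def)
    have "nm (of_int D * z ^ k) = of_int (m\<^sup>2 - d * n\<^sup>2)"
      using rp_rep[of "of_int m" "of_int n"] ip_rep[of "of_int m" "of_int n"] by (simp add: mn nm_def)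
    moreover have "nm (of_int D * z ^ k) = of_int (D * D) * nm z ^ k"
      using assms nm_mult[OF int_in_K K_power[OF assms(1)]] nm_rat[of "of_int D"]
      by (simp add: nm_power power2_eq_square)
    ultimately show "of_int (D * D) * nm z ^ k \<in> \<int>" by (metis Ints_of_int)
  qed
qed

text \<open>The norm of \<open>z + 1\<close> is \<open>nm z + tr z + 1\<close>, so the trace is a
  combination of norms of elements with bounded powers.\<close>

lemma bounded_powers_tr:
  assumes "z \<in> K" "bounded_powers z" shows "tr z \<in> \<int>"
proof -
  have b1: "bounded_powers 1" unfolding bounded_powers_def by (intro exI[of _ 1]) (use Zs_int[of 1] in auto)
  have "(of_rat (nm (z + 1)) :: complex) = of_rat (nm z + tr z + 1)"
    using assms(1) by (simp add: of_rat_add nm_eq[symmetric] tr_eq[symmetric] algebra_simps)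
  hence "tr z = nm (z + 1) - nm z - 1" by simp
  moreover have "nm (z + 1) \<in> \<int>" "nm z \<in> \<int>"
    using bounded_powers_nm bounded_powers_add[OF _ b1] assms by auto
  ultimately show ?thesis by simp
qed

text \<open>Trace and norm are the coefficients of the quadratic equation of \<open>z\<close>. This
  criterion treats all residues of \<open>d\<close> modulo 4 alike.\<close>

lemma Ok_iff: "z \<in> Ok \<longleftrightarrow> z \<in> K \<and> tr z \<in> \<int> \<and> nm z \<in> \<int>"
proof
  assume "z \<in> Ok"
  thus "z \<in> K \<and> tr z \<in> \<int> \<and> nm z \<in> \<int>"
    using algebraic_int_bounded_powers bounded_powers_tr bounded_powers_nm
    by (auto simp: ring_of_integers_def)
next
  assume z: "z \<in> K \<and> tr z \<in> \<int> \<and> nm z \<in> \<int>"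
  then obtain t n where tn: "tr z = of_int t" "nm z = of_int n" by (auto elim!: Ints_cases)
  have "algebraic_int z"
  proof (rule algebraic_int.intros)
    let ?p = "[:of_int n, - of_int t, 1:] :: complex poly"
    show "lead_coeff ?p = 1" by simp
    show "\<forall>i. coeff ?p i \<in> \<int>" by (auto simp: coeff_pCons split: nat.split)
    have "poly ?p z = z * z - (z + cj z) * z + z * cj z"
      using tr_eq[of z] nm_eq[of z] z tn by (simp add: algebra_simps)
    thus "poly ?p z = 0" by (simp add: algebra_simps)
  qed
  thus "z \<in> Ok" using z by (simp add: ring_of_integers_def)
qed

lemma Ok_K: "z \<in> Ok \<Longrightarrow> z \<in> K" by (simp add: ring_of_integers_def)

lemma Ok_bounded: "z \<in> Ok \<longleftrightarrow> z \<in> K \<and> bounded_powers z"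
proof
  show "z \<in> Ok \<Longrightarrow> z \<in> K \<and> bounded_powers z"
    using algebraic_int_bounded_powers by (auto simp: ring_of_integers_def)
  assume z: "z \<in> K \<and> bounded_powers z"
  thus "z \<in> Ok" using bounded_powers_nm bounded_powers_tr Ok_iff by blast
qed

lemma Ok_add [intro]: "x \<in> Ok \<Longrightarrow> y \<in> Ok \<Longrightarrow> x + y \<in> Ok"
  by (auto simp: Ok_bounded intro: bounded_powers_add)
lemma Ok_mult [intro]: "x \<in> Ok \<Longrightarrow> y \<in> Ok \<Longrightarrow> x * y \<in> Ok"
  by (auto simp: Ok_bounded intro: bounded_powers_mult)
lemma Ok_int [simp, intro]: "of_int m \<in> Ok"
  using nm_rat[of "of_int m"] tr_rat[of "of_int m"] by (auto simp: Ok_iff)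
lemma Ok_01 [simp, intro]: "0 \<in> Ok" "1 \<in> Ok" using Ok_int[of 0] Ok_int[of 1] by auto
lemma Ok_uminus [intro]: "x \<in> Ok \<Longrightarrow> - x \<in> Ok" using Ok_mult[OF Ok_int[of "-1"]] by simp
lemma Ok_cj [intro]: "x \<in> Ok \<Longrightarrow> cj x \<in> Ok" by (auto simp: Ok_iff tr_cj nm_cj)
lemma Ok_s [simp, intro]: "s \<in> Ok"
  using rp_rep[of 0 1] ip_rep[of 0 1] by (auto simp: Ok_iff tr_def nm_def)

lemma Ok_nm: assumes "x \<in> Ok" obtains n where "x * cj x = of_int n" "nm x = of_int n"
  using assms nm_eq[of x] by (auto simp: Ok_iff elim!: Ints_cases)
lemma Ok_rat: "of_rat q \<in> Ok \<longleftrightarrow> q \<in> \<int>"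
proof
  assume "of_rat q \<in> Ok"
  hence "of_int 1 * q\<^sup>2 \<in> \<int>" using nm_rat[of q] by (auto simp: Ok_iff)
  thus "q \<in> \<int>" using squarefree_mult_rat_square_int[of 1 q] by simp
qed (auto elim!: Ints_cases)

text \<open>The discriminant of the equation of \<open>z\<close> is \<open>d\<close> times the
  square of \<open>2 * ip z\<close>, and a squarefree \<open>d\<close> cannot cancel a squared
  denominator.\<close>

lemma Ok_half_ints: assumes "z \<in> Ok" obtains m n where "2 * z = of_int m + of_int n * s"
proof -
  have zK: "z \<in> K" using assms Ok_K by blast
  obtain m N where m: "2 * rp z = of_int m" "nm z = of_int N"
    using assms by (auto simp: Ok_iff tr_def elim!: Ints_cases)
  have "of_int d * (2 * ip z)\<^sup>2 = (2 * rp z)\<^sup>2 - 4 * nm z" by (simp add: nm_def power2_eq_square algebra_simps)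
  also have "\<dots> = of_int (m\<^sup>2 - 4 * N)" by (simp add: m)
  finally have "2 * ip z \<in> \<int>" using squarefree_mult_rat_square_int[OF sqf] by (metis Ints_of_int)
  then obtain n where n: "2 * ip z = of_int n" by (auto elim: Ints_cases)
  have "2 * z = of_rat (2 * rp z) + of_rat (2 * ip z) * s"
    by (subst K_eq[OF zK]) (simp add: of_rat_mult algebra_simps)
  thus ?thesis using that m n by simp
qed

end

section \<open>Bases of lattices and fractional ideals\<close>

context quad begin

lemma Zs_eq_iff: "of_int m + of_int n * s = of_int m' + of_int n' * s \<longleftrightarrow> m = m' \<and> n = n'"
  using rep_unique[of "of_int m" "of_int n" "of_int m'" "of_int n'"] by simp

text \<open>Hermite normal form: after scaling by \<open>M\<close> the lattice lies in \<int> +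
  \<int>\<surd>d. One basis vector generates its intersection with \<int>, the other realizes the
  smallest positive coefficient of \<surd>d. Stability under multiplication by \<surd>d makes the
  rank equal to 2.\<close>

lemma lattice_basis:
  assumes LK: "L \<subseteq> K" and L0: "0 \<in> L" and Ldiff: "\<And>x y. x \<in> L \<Longrightarrow> y \<in> L \<Longrightarrow> x - y \<in> L"
    and Ls: "\<And>x. x \<in> L \<Longrightarrow> s * x \<in> L" and M: "(M::int) > 0" "\<And>x. x \<in> L \<Longrightarrow> of_int M * x \<in> Zs"
    and z: "z \<in> L" "z \<noteq> 0"
  shows "\<exists>\<alpha> \<beta>. \<alpha> \<in> L \<and> \<beta> \<in> L \<and> L = {of_int x * \<alpha> + of_int y * \<beta> | x y. True} \<and> \<alpha> * cj \<beta> - \<beta> * cj \<alpha> \<noteq> 0"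
proof -
  have Lneg: "- x \<in> L" if "x \<in> L" for x using Ldiff[OF L0 that] by simp
  have Ladd: "x + y \<in> L" if "x \<in> L" "y \<in> L" for x y using Ldiff[OF that(1) Lneg[OF that(2)]] by simp
  have Lnat: "of_nat n * x \<in> L" if "x \<in> L" for n x
    by (induction n) (use that L0 Ladd in \<open>auto simp: algebra_simps\<close>)
  have Lint: "of_int n * x \<in> L" if "x \<in> L" for n x
  proof (cases "n \<ge> 0")
    case True thus ?thesis using Lnat[OF that, of "nat n"] by simp
  next
    case False thus ?thesis using Lneg[OF Lnat[OF that, of "nat (-n)"]] by simp
  qed
  define A where "A = {n. \<exists>m. \<exists>x\<in>L. of_int M * x = of_int m + of_int n * s}"
  define B where "B = {m. \<exists>x\<in>L. of_int M * x = of_int m}"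
  have "\<exists>g\<ge>0. A = range (\<lambda>k. k * g)"
  proof (rule int_subgroup_principal)
    show "0 \<in> A" unfolding A_def using L0 by (intro CollectI exI[of _ 0] bexI[of _ 0]) auto
    fix n n' assume "n \<in> A" "n' \<in> A"
    then obtain m x m' x' where "x \<in> L" "of_int M * x = of_int m + of_int n * s"
      "x' \<in> L" "of_int M * x' = of_int m' + of_int n' * s" unfolding A_def by blast
    thus "n - n' \<in> A" unfolding A_def
      by (intro CollectI exI[of _ "m - m'"] bexI[of _ "x - x'"]) (auto simp: algebra_simps intro: Ldiff)
  qed
  then obtain g where g: "g \<ge> 0" "A = range (\<lambda>k. k * g)" by blast
  have "\<exists>h\<ge>0. B = range (\<lambda>k. k * h)"
  proof (rule int_subgroup_principal)
    show "0 \<in> B" unfolding B_def using L0 by (intro CollectI bexI[of _ 0]) auto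
    fix m m' assume "m \<in> B" "m' \<in> B"
    then obtain x x' where "x \<in> L" "of_int M * x = of_int m" "x' \<in> L" "of_int M * x' = of_int m'"
      unfolding B_def by blast
    thus "m - m' \<in> B" unfolding B_def
      by (intro CollectI bexI[of _ "x - x'"]) (auto simp: algebra_simps intro: Ldiff)
  qed
  then obtain h where h: "h \<ge> 0" "B = range (\<lambda>k. k * h)" by blast
  obtain m n where mn: "of_int M * z = of_int m + of_int n * s" using M(2)[OF z(1)] unfolding Zs_def by blast
  have mn0: "m \<noteq> 0 \<or> n \<noteq> 0" using mn z(2) M(1) by auto
  \<comment> \<open>Multiplying \<open>M * z\<close> by its conjugate uses only integers and
    \<open>s\<close>, so the norm gives a nonzero element of \<open>B\<close>.\<close>
  have "of_int (m\<^sup>2 - d * n\<^sup>2) = of_int M * (of_int m * z - of_int n * (s * z))"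
  proof -
    have "of_int M * (of_int m * z - of_int n * (s * z)) = (of_int M * z) * (of_int m - of_int n * s)"
      by (simp add: algebra_simps)
    also have "\<dots> = of_int m * of_int m - of_int n * of_int n * (s * s)" unfolding mn by (simp add: algebra_simps)
    finally show ?thesis by (simp add: sqd_mult_self power2_eq_square)
  qed
  hence "m\<^sup>2 - d * n\<^sup>2 \<in> B" unfolding B_def
    by (intro CollectI bexI[of _ "of_int m * z - of_int n * (s * z)"]) (use z Ls Lint Ldiff in auto)
  moreover have "m\<^sup>2 - d * n\<^sup>2 \<noteq> 0"
  proof
    assume "m\<^sup>2 - d * n\<^sup>2 = 0"
    hence "nm (of_int M * z) = 0"
      using rp_rep[of "of_int m" "of_int n"] ip_rep[of "of_int m" "of_int n"]
      by (simp add: mn nm_def flip: of_int_power of_int_mult)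
    hence "of_int M * z = 0" using nm_eq_0_iff LK z by auto
    thus False using M(1) z(2) by simp
  qed
  ultimately have h0: "h > 0" using h by (auto simp: order_le_less)
  have g0: "g > 0"
  proof (rule ccontr)
    \<comment> \<open>If all coefficients of \<open>s\<close> vanished, those of \<open>z\<close>
      and of \<open>s * z\<close> would too; but they are \<open>n\<close> and
      \<open>m\<close>.\<close>
    assume "\<not> g > 0"
    hence A0: "A = {0}" using g by auto
    moreover have "n \<in> A" unfolding A_def using mn z by blast
    moreover have "m \<in> A"
    proof -
      have "of_int M * (s * z) = of_int (n * d) + of_int m * s"
      proof -
        have "of_int M * (s * z) = s * (of_int m + of_int n * s)" unfolding mn[symmetric] by simp
        thus ?thesis using sqd_mult_self[of d] by (simp add: algebra_simps)
      qed
      thus ?thesis unfolding A_def using Ls[OF z(1)] by blast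
    qed
    ultimately show False using mn0 by auto
  qed
  have "g \<in> A" using g(2) by (metis mult_1 rangeI)
  then obtain m0 \<beta> where \<beta>: "\<beta> \<in> L" "of_int M * \<beta> = of_int m0 + of_int g * s" unfolding A_def by blast
  have "h \<in> B" using h(2) by (metis mult_1 rangeI)
  then obtain \<alpha> where \<alpha>: "\<alpha> \<in> L" "of_int M * \<alpha> = of_int h" unfolding B_def by blast
  have "x \<in> {of_int x * \<alpha> + of_int y * \<beta> | x y. True}" if x: "x \<in> L" for x
  proof -
    obtain m n where mn: "of_int M * x = of_int m + of_int n * s" using M(2)[OF x] unfolding Zs_def by blast
    hence "n \<in> A" unfolding A_def using x by blast
    then obtain k where k: "n = k * g" using g by auto
    have "of_int M * (x - of_int k * \<beta>) = of_int M * x - of_int k * (of_int M * \<beta>)" by (simp add: algebra_simps)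
    also have "\<dots> = of_int (m - k * m0)" unfolding mn \<beta>(2) by (simp add: k algebra_simps)
    finally have e: "of_int M * (x - of_int k * \<beta>) = of_int (m - k * m0)" .
    hence "m - k * m0 \<in> B" unfolding B_def using x \<beta>(1) Lint Ldiff by blast
    then obtain j where j: "m - k * m0 = j * h" using h by auto
    have "of_int M * (x - of_int k * \<beta>) = of_int M * (of_int j * \<alpha>)"
      unfolding e j using \<alpha>(2) by (simp add: mult.left_commute)
    hence "x - of_int k * \<beta> = of_int j * \<alpha>" using M(1) by simp
    hence "x = of_int j * \<alpha> + of_int k * \<beta>" by (simp add: algebra_simps)
    thus ?thesis by blast
  qed
  moreover have "of_int x * \<alpha> + of_int y * \<beta> \<in> L" for x y using \<alpha> \<beta> Lint Ladd by blast
  moreover have "\<alpha> * cj \<beta> - \<beta> * cj \<alpha> \<noteq> 0"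
  proof
    assume "\<alpha> * cj \<beta> - \<beta> * cj \<alpha> = 0"
    moreover have "\<alpha> \<in> K" "\<beta> \<in> K" using \<alpha> \<beta> LK by auto
    moreover have "cj (of_int M * \<alpha>) = of_int h" using \<alpha>(2) by simp
    hence "of_int M * cj \<alpha> = of_int h" using \<open>\<alpha> \<in> K\<close> by simp
    moreover have "cj (of_int M * \<beta>) = of_int m0 - of_int g * s"
      using \<beta>(2) cj_rep[of "of_int m0" "of_int g"] by simp
    hence "of_int M * cj \<beta> = of_int m0 - of_int g * s" using \<open>\<beta> \<in> K\<close> by simp
    ultimately have "of_int h * (of_int m0 - of_int g * s) = (of_int m0 + of_int g * s) * (of_int h :: complex)"
      using \<alpha>(2) \<beta>(2) by (metis (no_types, opaque_lifting) eq_iff_diff_eq_0 mult.assoc mult.commute)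
    hence "2 * of_int h * of_int g * s = (0::complex)" by (simp add: algebra_simps)
    thus False using h0 g0 s_irrational[of 0] by simp
  qed
  ultimately show ?thesis using \<alpha>(1) \<beta>(1) by blast
qed

lemma fractional_idealD:
  assumes "fractional_ideal K I"
  shows "I \<subseteq> K" "0 \<in> I" "I \<noteq> {0}" "\<And>x y. x \<in> I \<Longrightarrow> y \<in> I \<Longrightarrow> x + y \<in> I"
    "\<And>r x. r \<in> Ok \<Longrightarrow> x \<in> I \<Longrightarrow> r * x \<in> I" "\<And>x. x \<in> I \<Longrightarrow> - x \<in> I"
    "\<And>x y. x \<in> I \<Longrightarrow> y \<in> I \<Longrightarrow> x - y \<in> I" "\<And>n x. x \<in> I \<Longrightarrow> of_int n * x \<in> I"
proof -
  show *: "I \<subseteq> K" "0 \<in> I" "I \<noteq> {0}" "\<And>x y. x \<in> I \<Longrightarrow> y \<in> I \<Longrightarrow> x + y \<in> I"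
    "\<And>r x. r \<in> Ok \<Longrightarrow> x \<in> I \<Longrightarrow> r * x \<in> I"
    using assms by (auto simp: fractional_ideal_def)
  show neg: "- x \<in> I" if "x \<in> I" for x using *(5)[OF Ok_int[of "-1"] that] by simp
  show "x - y \<in> I" if "x \<in> I" "y \<in> I" for x y using *(4)[OF that(1) neg[OF that(2)]] by simp
  show "of_int n * x \<in> I" if "x \<in> I" for n x using *(5)[OF Ok_int that] .
qed

lemma fractional_ideal_basis:
  assumes I: "fractional_ideal K I"
  obtains \<alpha> \<beta> where "\<alpha> \<in> I" "\<beta> \<in> I" "I = {of_int x * \<alpha> + of_int y * \<beta> | x y. True}"
    "\<alpha> * cj \<beta> - \<beta> * cj \<alpha> \<noteq> 0"
proof -
  note D = fractional_idealD[OF I]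
  obtain b where b: "b \<in> Ok" "b \<noteq> 0" "\<And>x. x \<in> I \<Longrightarrow> b * x \<in> Ok"
    using I unfolding fractional_ideal_def by blast
  obtain n where n: "b * cj b = of_int n" using Ok_nm[OF b(1)] by blast
  have n0: "n \<noteq> 0" using n b(2) Ok_K[OF b(1)] by auto
  obtain z where z: "z \<in> I" "z \<noteq> 0" using D(2,3) by blast
  \<comment> \<open>The norm \<open>n\<close> of a denominator is an integer denominator; the factor
    2 passes from the ring of integers to \<open>Zs\<close>.\<close>
  have M: "of_int (2 * \<bar>n\<bar>) * x \<in> Zs" if "x \<in> I" for x
  proof -
    have "cj b * (b * x) \<in> Ok" using b that by blast
    moreover have "cj b * (b * x) = of_int n * x" unfolding n[symmetric] by (simp add: mult_ac)
    ultimately have "of_int n * x \<in> Ok" by (simp only:)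
    hence "of_int \<bar>n\<bar> * x \<in> Ok" using Ok_uminus[of "of_int n * x"] by (cases "n \<ge> 0") auto
    then obtain k l where "2 * (of_int \<bar>n\<bar> * x) = of_int k + of_int l * s" by (rule Ok_half_ints)
    thus ?thesis unfolding Zs_def by (auto simp: mult.assoc)
  qed
  have "0 < 2 * \<bar>n\<bar>" using n0 by simp
  from lattice_basis[OF D(1,2,7) D(5)[OF Ok_s] this M z] that show ?thesis by blast
qed

lemma fractional_ideal_Ok: "fractional_ideal K Ok"
proof -
  have "Ok \<noteq> {0}"
  proof
    assume "Ok = {0}"
    hence "(1::complex) \<in> {0}" using Ok_01(2) by (simp only:)
    thus False by simp
  qed
  thus ?thesis unfolding fractional_ideal_def using Ok_K by (auto intro!: bexI[of _ 1] intro: Ok_add Ok_mult)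
qed

lemma int_span_pair: "int_mod.span {\<alpha>, \<beta>} = {of_int x * \<alpha> + of_int y * \<beta> | x y. True}"
proof -
  have "x \<in> int_mod.span {\<alpha>, \<beta>} \<longleftrightarrow> (\<exists>k l. x - int_scale k \<alpha> = int_scale l \<beta>)" for x
    by (auto simp: int_mod.span_insert int_mod.span_singleton image_iff simp del: int_mod.span_breakdown_eq)
  thus ?thesis by (auto simp: int_scale_def algebra_simps set_eq_iff)
qed

text \<open>Cramer's rule for the relation and its conjugate.\<close>

lemma pair_lin_indep:
  assumes "\<alpha> \<in> K" "\<beta> \<in> K" "\<alpha> * cj \<beta> - \<beta> * cj \<alpha> \<noteq> 0" "of_rat p * \<alpha> + of_rat q * \<beta> = 0"
  shows "p = 0 \<and> q = 0"
proof -
  have e': "of_rat p * cj \<alpha> + of_rat q * cj \<beta> = 0"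
    using arg_cong[OF assms(4), of cj] assms(1,2) by simp
  have "of_rat p * (\<alpha> * cj \<beta> - \<beta> * cj \<alpha>)
      = (of_rat p * \<alpha> + of_rat q * \<beta>) * cj \<beta> - (of_rat p * cj \<alpha> + of_rat q * cj \<beta>) * \<beta>"
    by (simp add: algebra_simps)
  hence "p = 0" unfolding assms(4) e' using assms(3) by simp
  moreover have "of_rat q * (\<alpha> * cj \<beta> - \<beta> * cj \<alpha>)
      = (of_rat p * cj \<alpha> + of_rat q * cj \<beta>) * \<alpha> - (of_rat p * \<alpha> + of_rat q * \<beta>) * cj \<alpha>"
    by (simp add: algebra_simps)
  hence "q = 0" unfolding assms(4) e' using assms(3) by simp
  ultimately show ?thesis by simp
qed

text \<open>This guarantees that the choice operator in \<open>discriminant\<close> really selects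
  an integral basis.\<close>

lemma integral_basis_exists: "\<exists>ws. integral_basis K ws"
proof -
  obtain \<alpha> \<beta> where ab: "\<alpha> \<in> Ok" "\<beta> \<in> Ok" "Ok = {of_int x * \<alpha> + of_int y * \<beta> | x y. True}"
    "\<alpha> * cj \<beta> - \<beta> * cj \<alpha> \<noteq> 0" using fractional_ideal_basis[OF fractional_ideal_Ok] by metis
  have ne: "\<alpha> \<noteq> \<beta>" using ab(4) by auto
  have "int_mod.independent {\<alpha>, \<beta>}"
  proof
    assume "int_mod.dependent {\<alpha>, \<beta>}"
    then obtain t u where tu: "finite t" "t \<subseteq> {\<alpha>, \<beta>}" "(\<Sum>v\<in>t. int_scale (u v) v) = 0" "\<exists>v\<in>t. u v \<noteq> 0"
      unfolding int_mod.dependent_explicit by blast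
    define w where "w v = (if v \<in> t then u v else 0)" for v
    have "(\<Sum>v\<in>{\<alpha>, \<beta>}. int_scale (w v) v) = (\<Sum>v\<in>t. int_scale (u v) v)"
      using tu(2) by (intro sum.mono_neutral_cong_right) (auto simp: w_def)
    hence "of_rat (of_int (w \<alpha>)) * \<alpha> + of_rat (of_int (w \<beta>)) * \<beta> = 0"
      using tu(3) ne by (simp add: int_scale_def)
    hence "w \<alpha> = 0 \<and> w \<beta> = 0" using pair_lin_indep[OF Ok_K[OF ab(1)] Ok_K[OF ab(2)] ab(4)] by fastforce
    thus False using tu(2,4) by (auto simp: w_def)
  qed
  hence "integral_basis K [\<alpha>, \<beta>]" unfolding integral_basis_def using ne ab(3) int_span_pair by simp
  thus ?thesis by blast
qed

lemma rat_indep_1_s: "rat_vs.independent {1, s}"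
proof -
  have "s \<noteq> 1" "s \<notin> rat_vs.span {1}"
    using s_irrational s_irrational[of 1] by (auto simp: rat_vs.span_singleton rat_scale_def)
  hence "rat_vs.independent (insert s {1})" using rat_vs.independent_insert[of s "{1}"] by auto
  thus ?thesis by (simp add: insert_commute)
qed

lemma rat_span_1_s: "rat_vs.span {1, s} = K"
proof -
  have "x \<in> rat_vs.span {1, s} \<longleftrightarrow> (\<exists>k l. x - rat_scale k 1 = rat_scale l s)" for x
    by (auto simp: rat_vs.span_insert rat_vs.span_singleton image_iff)
  thus ?thesis by (auto simp: rat_scale_def quad_set_def algebra_simps set_eq_iff)
qed

lemma K_independent_card:
  assumes "rat_vs.independent B" "B \<subseteq> K" shows "finite B \<and> card B \<le> 2"
  using rat_vs.independent_span_bound[of "{1, s}" B] assms rat_span_1_s s_irrational[of 1] by simp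

lemma K_spanning_card:
  assumes "finite B" "K \<subseteq> rat_vs.span B" shows "card B \<ge> 2"
proof -
  have "{1, s} \<subseteq> rat_vs.span B" using assms(2) by auto
  thus ?thesis using rat_vs.independent_span_bound[OF assms(1) rat_indep_1_s] s_irrational[of 1] by simp
qed

end

section \<open>Trace and discriminant\<close>

lemma det_mat_2: "det (mat 2 2 f) = f (0, 0) * f (1, 1) - f (0, 1) * f (1, 0)"
proof -
  let ?A = "mat 2 2 f"
  have d1: "det (mat_delete ?A 0 j) = mat_delete ?A 0 j $$ (0, 0)" if "j < 2" for j
  proof -
    have c: "mat_delete ?A 0 j \<in> carrier_mat 1 1" using mat_delete_carrier[of ?A 2 2 0 j] by simp
    have "upper_triangular (mat_delete ?A 0 j)" using c by auto
    from det_upper_triangular[OF this c] show ?thesis using c by (simp add: diag_mat_def)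
  qed
  have "det ?A = (\<Sum>j<2. ?A $$ (0, j) * cofactor ?A 0 j)"
    by (rule laplace_expansion_row) auto
  also have "\<dots> = ?A $$ (0, 0) * cofactor ?A 0 0 + ?A $$ (0, 1) * cofactor ?A 0 1"
    by (simp add: numeral_2_eq_2)
  also have "cofactor ?A 0 0 = f (1, 1)" unfolding cofactor_def by (subst d1) (simp_all add: mat_delete_def)
  also have "cofactor ?A 0 1 = - f (1, 0)" unfolding cofactor_def by (subst d1) (simp_all add: mat_delete_def)
  finally show ?thesis by simp
qed

context quad begin

text \<open>For the arbitrarily chosen basis the trace is a rational linear function of
  \<open>x\<close>, so it is enough to know that it takes the values 2 at 1 and 0 at
  \<open>s\<close>.\<close>

lemma field_trace_eq:
  assumes x: "x \<in> K" shows "field_trace K x = tr x"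
proof -
  define B where "B = (SOME B. rat_vs.independent B \<and> rat_vs.span B = K)"
  have B: "rat_vs.independent B" "rat_vs.span B = K"
    using someI_ex[of "\<lambda>B. rat_vs.independent B \<and> rat_vs.span B = K"] rat_indep_1_s rat_span_1_s
    unfolding B_def by blast+
  have BK: "B \<subseteq> K" using B(2) rat_vs.span_superset by blast
  have finB: "finite B" and cB: "card B = 2"
    using K_independent_card[OF B(1) BK] K_spanning_card[of B] B(2) by auto
  obtain b1 b2 where b: "B = {b1, b2}" "b1 \<noteq> b2" using cB by (auto simp: card_2_iff)
  let ?r = "rat_vs.representation B"
  define t where "t y = (\<Sum>b\<in>B. ?r (y * b) b)" for y
  have ft: "field_trace K x = t x" by (simp add: field_trace_def B_def Let_def t_def)
  have sp: "y * b \<in> rat_vs.span B" if "y \<in> K" "b \<in> B" for y b using that BK B(2) by auto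
  have tadd: "t (y + z) = t y + t z" if "y \<in> K" "z \<in> K" for y z
  proof -
    have "?r ((y + z) * b) b = ?r (y * b) b + ?r (z * b) b" if "b \<in> B" for b
      using rat_vs.representation_add[OF B(1) sp sp] \<open>y \<in> K\<close> \<open>z \<in> K\<close> that by (simp add: distrib_right)
    thus ?thesis unfolding t_def by (simp add: sum.distrib)
  qed
  have tsc: "t (of_rat q * y) = q * t y" if "y \<in> K" for q y
  proof -
    have "?r (of_rat q * y * b) b = q * ?r (y * b) b" if "b \<in> B" for b
      using rat_vs.representation_scale[OF B(1) sp[OF \<open>y \<in> K\<close> that], of q]
      by (simp add: rat_scale_def mult.assoc)
    thus ?thesis unfolding t_def by (simp add: sum_distrib_left)
  qed
  have t1: "t 1 = 2"
  proof -
    have "t 1 = (\<Sum>b\<in>B. 1)" unfolding t_def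
      by (intro sum.cong refl) (simp add: rat_vs.representation_basis[OF B(1)])
    thus ?thesis using cB by simp
  qed
  have expand: "y = of_rat (?r y b1) * b1 + of_rat (?r y b2) * b2" if "y \<in> K" for y
    using rat_vs.sum_representation_eq[OF B(1), of y B] that B(2) finB b by (simp add: rat_scale_def)
  have indep: "q = 0" if "of_rat p * b1 + of_rat q * b2 = 0" for p q
  proof -
    have "(\<Sum>v\<in>B. rat_scale ((\<lambda>v. if v = b1 then p else q) v) v) = 0"
      using that b by (simp add: rat_scale_def)
    from rat_vs.independentD[OF B(1) finB subset_refl this, of b2] show ?thesis using b by simp
  qed
  \<comment> \<open>The matrix with entries p, q, r, u of multiplication by \<open>s\<close> has
    square \<open>d\<close>; its off-diagonal entry yields \<open>q * (p + u) = 0\<close>. If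
    \<open>q\<close> were 0, then \<open>b1\<close> would be an eigenvector with rational
    eigenvalue, against the irrationality of \<open>s\<close>.\<close>
  have ts: "t s = 0"
  proof -
    define p q r u where "p = ?r (s * b1) b1" "q = ?r (s * b1) b2" "r = ?r (s * b2) b1" "u = ?r (s * b2) b2"
    have b12: "b1 \<in> K" "b2 \<in> K" using BK b by auto
    have e1: "s * b1 = of_rat p * b1 + of_rat q * b2" and e2: "s * b2 = of_rat r * b1 + of_rat u * b2"
      unfolding p_q_r_u_def using expand[of "s * b1"] expand[of "s * b2"] b12 by auto
    have "of_rat (of_int d) * b1 = s * (s * b1)" using s_s by (simp add: mult.assoc[symmetric])
    also have "\<dots> = of_rat p * (s * b1) + of_rat q * (s * b2)"
      by (subst e1) (simp add: algebra_simps)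
    also have "\<dots> = of_rat p * (of_rat p * b1 + of_rat q * b2) + of_rat q * (of_rat r * b1 + of_rat u * b2)"
      by (simp only: e1 e2)
    finally have "of_rat (p * p + q * r - of_int d) * b1 + of_rat (p * q + q * u) * b2 = 0"
      by (simp add: of_rat_add of_rat_mult of_rat_diff algebra_simps)
    hence "p * q + q * u = 0" by (rule indep)
    hence pq: "q * (p + u) = 0" by (simp only: distrib_left mult.commute[of p])
    have "q \<noteq> 0"
    proof
      assume "q = 0"
      hence "(s - of_rat p) * b1 = 0" using e1 by (simp add: algebra_simps)
      moreover have "b1 \<noteq> 0" using rat_vs.dependent_zero[of B] B(1) b by auto
      ultimately show False using s_irrational[of p] by simp
    qed
    hence "p + u = 0" using pq by simp
    thus ?thesis unfolding t_def b(1) p_q_r_u_def using b(2) by simp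
  qed
  obtain a c where xa: "x = of_rat a + of_rat c * s" using x by (rule K_cases)
  have "t x = t (of_rat a * 1) + t (of_rat c * s)" unfolding xa by (subst tadd[symmetric]) auto
  also have "\<dots> = 2 * a" by (simp add: tsc t1 ts del: mult_1_right)
  finally show ?thesis unfolding ft by (simp add: xa tr_def)
qed

lemma common_denominator:
  fixes u :: "complex \<Rightarrow> rat"
  assumes "finite t" shows "\<exists>D::int. D > 0 \<and> (\<forall>v\<in>t. of_int D * u v \<in> \<int>)"
  using assms
proof (induction t)
  case empty show ?case by (intro exI[of _ 1]) simp
next
  case (insert x t)
  then obtain D :: int where D: "D > 0" "\<forall>v\<in>t. of_int D * u v \<in> \<int>" by blast
  obtain a b where q: "quotient_of (u x) = (a, b)" by fastforce
  have b: "b > 0" "u x = of_int a / of_int b" using q quotient_of_denom_pos quotient_of_div by auto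
  have "of_int (D * b) * u v \<in> \<int>" if "v \<in> insert x t" for v
  proof (cases "v = x")
    case True thus ?thesis using b by simp
  next
    case False
    hence "of_int D * u v \<in> \<int>" using D(2) that by blast
    hence "of_int b * (of_int D * u v) \<in> \<int>" by (rule Ints_mult[OF Ints_of_int])
    thus ?thesis by (simp add: mult_ac)
  qed
  thus ?case using D b by (intro exI[of _ "D * b"]) auto
qed

lemma int_independent_imp_rat_independent:
  assumes "int_mod.independent S" shows "rat_vs.independent S"
proof
  assume "rat_vs.dependent S"
  then obtain t u where tu: "finite t" "t \<subseteq> S" "(\<Sum>v\<in>t. rat_scale (u v) v) = 0" "\<exists>v\<in>t. u v \<noteq> 0"
    unfolding rat_vs.dependent_explicit by blast
  obtain D :: int where D: "D > 0" "\<forall>v\<in>t. of_int D * u v \<in> \<int>" using common_denominator[OF tu(1)] by blast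
  define w where "w v = \<lfloor>of_int D * u v\<rfloor>" for v
  have w: "of_int (w v) = of_int D * u v" if "v \<in> t" for v
    using D(2) that unfolding w_def by (metis of_int_floor_cancel Ints_cases)
  have "(\<Sum>v\<in>t. int_scale (w v) v) = of_int D * (\<Sum>v\<in>t. rat_scale (u v) v)"
    unfolding sum_distrib_left
  proof (intro sum.cong refl)
    fix v assume "v \<in> t"
    have "(of_int (w v) :: complex) = of_rat (of_int (w v))" by simp
    also have "\<dots> = of_int D * of_rat (u v)" unfolding w[OF \<open>v \<in> t\<close>] by (simp add: of_rat_mult)
    finally show "int_scale (w v) v = of_int D * rat_scale (u v) v" by (simp add: int_scale_def rat_scale_def)
  qed
  hence "(\<Sum>v\<in>t. int_scale (w v) v) = 0" using tu(3) by simp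
  moreover obtain v where v: "v \<in> t" "u v \<noteq> 0" using tu(4) by blast
  ultimately have "w v = 0" using int_mod.independentD[OF assms tu(1,2)] by blast
  thus False using w[OF v(1)] v(2) D(1) by simp
qed

text \<open>The discriminant is \<open>d\<close> times the square of 2q, where q is the determinant
  of an integral basis in the coordinates 1, \<open>s\<close>. It is an integer and \<open>d\<close>
  is squarefree, so 2q is a nonzero integer. Hence fields with discriminant up to x come from
  indices \<open>d\<close> up to x.\<close>

lemma abs_disc_ge: "abs_disc K \<ge> \<bar>real_of_int d\<bar>"
proof -
  define ws where "ws = (SOME ws. integral_basis K ws)"
  have ws: "integral_basis K ws" unfolding ws_def using integral_basis_exists by (rule someI_ex)
  have W: "distinct ws" "int_mod.independent (set ws)" "int_mod.span (set ws) = Ok"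
    using ws by (auto simp: integral_basis_def)
  have wO: "set ws \<subseteq> Ok" using W(3) int_mod.span_superset by blast
  have sub: "int_mod.span (set ws) \<subseteq> rat_vs.span (set ws)"
  proof (rule int_mod.span_minimal)
    show "set ws \<subseteq> rat_vs.span (set ws)" by (rule rat_vs.span_superset)
    show "int_mod.subspace (rat_vs.span (set ws))"
      unfolding int_mod.subspace_def
    proof (intro conjI allI ballI)
      fix c x assume "x \<in> rat_vs.span (set ws)"
      from rat_vs.span_scale[OF this, of "of_int c"] show "int_scale c x \<in> rat_vs.span (set ws)"
        by (simp add: rat_scale_def int_scale_def)
    qed (auto intro: rat_vs.span_zero rat_vs.span_add)
  qed
  have "{1, s} \<subseteq> rat_vs.span (set ws)" using sub W(3) by auto
  hence "K \<subseteq> rat_vs.span (set ws)" using rat_span_1_s rat_vs.span_minimal[OF _ rat_vs.subspace_span] by metis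
  hence "card (set ws) \<ge> 2" by (intro K_spanning_card) auto
  moreover have "card (set ws) \<le> 2"
    using K_independent_card[OF int_independent_imp_rat_independent[OF W(2)]] wO Ok_K by blast
  ultimately have len: "length ws = 2" using distinct_card[OF W(1)] by simp
  obtain w0 w1 where w01: "ws = [w0, w1]" using len by (auto simp: numeral_2_eq_2 length_Suc_conv)
  have wK: "w0 \<in> K" "w1 \<in> K" using wO Ok_K w01 by auto
  obtain a b where w0: "w0 = of_rat a + of_rat b * s" using wK(1) by (rule K_cases)
  obtain a' b' where w1: "w1 = of_rat a' + of_rat b' * s" using wK(2) by (rule K_cases)
  define q where "q = a * b' - a' * b"
  have "discriminant K = det (mat 2 2 (\<lambda>(i, j). field_trace K (ws ! i * ws ! j)))"
    by (simp add: discriminant_def ws_def[symmetric] Let_def len)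
  also have "\<dots> = tr (w0 * w0) * tr (w1 * w1) - tr (w0 * w1) * tr (w1 * w0)"
    using wK by (simp add: det_mat_2 w01 field_trace_eq)
  finally have disc': "discriminant K = tr (w0 * w0) * tr (w1 * w1) - tr (w0 * w1) * tr (w1 * w0)" .
  also have "\<dots> = of_int d * (2 * q)\<^sup>2"
    unfolding w0 w1 rep_mult tr_def rp_rep by (simp add: q_def power2_eq_square algebra_simps)
  finally have disc: "discriminant K = of_int d * (2 * q)\<^sup>2" .
  have trint: "tr (x * y) \<in> \<int>" if "x \<in> Ok" "y \<in> Ok" for x y using Ok_mult[OF that] Ok_iff by blast
  have w01O: "w0 \<in> Ok" "w1 \<in> Ok" using wO w01 by auto
  have "tr (w0 * w0) * tr (w1 * w1) - tr (w0 * w1) * tr (w1 * w0) \<in> \<int>"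
    by (intro Ints_diff Ints_mult trint w01O)
  hence "of_int d * (2 * q)\<^sup>2 \<in> \<int>"
    unfolding disc'[symmetric] disc .
  hence "2 * q \<in> \<int>" by (rule squarefree_mult_rat_square_int[OF sqf])
  then obtain j where j: "2 * q = of_int j" by (auto elim: Ints_cases)
  have "q \<noteq> 0"
  proof
    assume "q = 0"
    hence det0: "a * b' = a' * b" by (simp add: q_def)
    have rind: "rat_vs.independent {w0, w1}" "w0 \<noteq> w1"
      using int_independent_imp_rat_independent[OF W(2)] W(1) w01 by auto
    have lin: "p = 0 \<and> r = 0" if "of_rat p * w0 + of_rat r * w1 = 0" for p r
    proof -
      have "(\<Sum>v\<in>{w0, w1}. rat_scale ((\<lambda>v. if v = w0 then p else r) v) v) = 0"
        using that rind(2) by (simp add: rat_scale_def)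
      from rat_vs.independentD[OF rind(1) _ subset_refl this, of w0]
        rat_vs.independentD[OF rind(1) _ subset_refl this, of w1] show ?thesis using rind(2) by simp
    qed
    have "(of_rat (a' * b) :: complex) = of_rat (a * b')" using det0 by simp
    hence "of_rat b' * w0 + of_rat (- b) * w1 = 0" "of_rat a' * w0 + of_rat (- a) * w1 = 0"
      unfolding w0 w1 by (simp_all add: of_rat_minus of_rat_mult algebra_simps)
    hence "b = 0" "a = 0" using lin[of b' "- b"] lin[of a' "- a"] by auto
    hence "w0 = 0" using w0 by simp
    thus False using lin[of 1 0] by simp
  qed
  hence "j \<noteq> 0" using j by auto
  hence "j\<^sup>2 \<ge> 1" by (simp add: int_one_le_iff_zero_less)
  hence "\<bar>d\<bar> * 1 \<le> \<bar>d\<bar> * j\<^sup>2" by (intro mult_left_mono) auto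
  hence "\<bar>d\<bar> \<le> \<bar>d * j\<^sup>2\<bar>" by (simp add: abs_mult)
  moreover have "discriminant K = of_int (d * j\<^sup>2)" using disc j by simp
  ultimately show ?thesis unfolding abs_disc_def
    by (metis of_int_abs of_int_le_iff of_rat_of_int_eq)
qed

end

text \<open>Some element outside the rationals generates the field, and completing the square
  replaces it by the square root of a rational number a/b, which generates the same field as the
  square root of the squarefree part of ab.\<close>

lemma quadratic_field_imp_quad_set:
  assumes "quadratic_field L"
  shows "\<exists>d. squarefree d \<and> d \<noteq> 1 \<and> L = quad_set d"
proof -
  have sf: "subfield L (ring_of_type_algebra :: complex ring)" and dim: "rat_vs.dim L = 2"
    and "\<exists>B. finite B \<and> rat_vs.span B = L"
    using assms by (auto simp: quadratic_field_def number_field_def)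
  then obtain B0 where B0: "finite B0" "rat_vs.span B0 = L" by blast
  have sub: "rat_vs.subspace L" using B0(2) rat_vs.subspace_span by blast
  note sr = subringE[OF subfieldE(1)[OF sf]]
  have L1: "1 \<in> L" using sr(3) by (simp add: ring_of_type_algebra_def)
  have Lmult: "x * y \<in> L" if "x \<in> L" "y \<in> L" for x y using sr(6)[OF that] by (simp add: ring_of_type_algebra_def)
  have Ladd: "x + y \<in> L" if "x \<in> L" "y \<in> L" for x y using sr(7)[OF that] by (simp add: ring_of_type_algebra_def)
  have Lsc: "of_rat q * x \<in> L" if "x \<in> L" for q x
    using rat_vs.subspace_scale[OF sub that, of q] by (simp add: rat_scale_def)
  have Lrat: "of_rat q \<in> L" for q using Lsc[OF L1] by simp
  obtain B where B: "B \<subseteq> L" "rat_vs.independent B" "L \<subseteq> rat_vs.span B" "card B = 2"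
    using rat_vs.basis_exists[of L] dim by metis
  have finB: "finite B" using B(4) card.infinite by fastforce
  have bound: "card S \<le> 2" if "rat_vs.independent S" "S \<subseteq> L" for S
    using rat_vs.independent_span_bound[OF finB that(1)] that(2) B(3,4) by (metis order_trans)
  have span1: "rat_vs.span {1} = range of_rat"
    by (auto simp: rat_vs.span_singleton rat_scale_def image_def)
  have "\<exists>x\<in>L. x \<notin> range of_rat"
  proof (rule ccontr)
    assume "\<not> ?thesis"
    hence "B \<subseteq> rat_vs.span {1}" using B(1) span1 by blast
    from rat_vs.independent_span_bound[OF _ B(2) this] show False using B(4) by simp
  qed
  then obtain x where x: "x \<in> L" "x \<notin> range of_rat" by blast
  have i1: "rat_vs.independent {1::complex}" by (simp add: rat_vs.independent_insert)
  have ne1: "x \<noteq> 1" using x(2) by (metis of_rat_1 rangeI)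
  have ind: "rat_vs.independent {x, 1}" using i1 x(2) span1 ne1 by (simp add: rat_vs.independent_insert)
  have Lsp: "y \<in> rat_vs.span {x, 1}" if "y \<in> L" for y
  proof (rule ccontr)
    assume ny: "y \<notin> rat_vs.span {x, 1}"
    hence "rat_vs.independent {y, x, 1}" using ind rat_vs.independent_insertI by blast
    hence "card {y, x, 1} \<le> 2" using bound x L1 that by auto
    moreover have "y \<notin> {x, 1}" using ny rat_vs.span_superset by blast
    ultimately show False using ne1 by simp
  qed
  have rep: "\<exists>a b. y = of_rat a + of_rat b * x" if yL: "y \<in> L" for y
  proof -
    obtain b where "y - rat_scale b x \<in> rat_vs.span {1}"
      using Lsp[OF yL] rat_vs.span_insert[of x "{1}"] by auto
    then obtain a where "y - rat_scale b x = of_rat a" using span1 by auto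
    thus ?thesis by (intro exI[of _ a] exI[of _ b]) (simp add: rat_scale_def algebra_simps)
  qed
  obtain p q where pq: "x * x = of_rat p + of_rat q * x" using rep[OF Lmult[OF x(1) x(1)]] by blast
  \<comment> \<open>Completing the square in \<open>x * x = of_rat p + of_rat q * x\<close>, scaled
    by 2 to avoid fractions.\<close>
  define y where "y = 2 * x - of_rat q"
  have yy: "y * y = of_rat (4 * p + q * q)"
  proof -
    have "y * y = 4 * (x * x) - 4 * of_rat q * x + of_rat q * of_rat q" by (simp add: y_def algebra_simps)
    thus ?thesis unfolding pq by (simp add: of_rat_add of_rat_mult algebra_simps)
  qed
  have xy: "x = of_rat (q / 2) + of_rat (1 / 2) * y" by (simp add: y_def of_rat_divide field_simps)
  obtain a b where ab: "quotient_of (4 * p + q * q) = (a, b)" by fastforce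
  have b0: "b > 0" and abq: "4 * p + q * q = of_int a / of_int b"
    using ab quotient_of_denom_pos quotient_of_div by auto
  define d where "d = squarefree_part (a * b)"
  define f where "f = square_part (a * b)"
  have decomp: "a * b = d * f\<^sup>2" unfolding d_def f_def by (rule squarefree_decompose)
  have by2: "(of_int b * y) * (of_int b * y) = of_int f * of_int f * (sqd d * sqd d)"
  proof -
    have "(of_int b * y) * (of_int b * y) = of_int b * of_int b * (y * y)" by simp
    also have "\<dots> = of_int (a * b)" unfolding yy abq using b0 by (simp add: of_rat_divide)
    also have "\<dots> = of_int f * of_int f * (sqd d * sqd d)"
      unfolding decomp sqd_mult_self by (simp add: power2_eq_square)
    finally show ?thesis .
  qed
  hence "(of_int b * y)\<^sup>2 = (of_int f * sqd d)\<^sup>2" by (simp add: power2_eq_square mult_ac)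
  then obtain e :: int where e: "e \<in> {1, -1}" "of_int b * y = of_int e * (of_int f * sqd d)"
    by (metis insertCI mult_1 mult_minus1 of_int_1 of_int_minus power2_eq_iff)
  have ynr: "y \<noteq> of_rat r" for r
  proof
    assume "y = of_rat r"
    hence "x = of_rat (q / 2 + 1 / 2 * r)" using xy by (simp only: of_rat_add of_rat_mult)
    thus False using x(2) by blast
  qed
  have y_eq: "y = of_rat (of_int (e * f) / of_int b) * sqd d"
    using e(2) b0 by (simp add: of_rat_divide of_rat_mult field_simps)
  have f0: "f \<noteq> 0" using y_eq ynr[of 0] by auto
  have d1: "d \<noteq> 1"
  proof
    assume "d = 1"
    hence "sqd d = of_rat 1" by (simp add: sqd_def)
    hence "y = of_rat (of_int (e * f) / of_int b * 1)" using y_eq by (metis of_rat_mult)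
    thus False using ynr by blast
  qed
  have sq: "squarefree d" unfolding d_def by (rule squarefree_squarefree_part)
  have ef: "e * f \<noteq> 0" using e f0 by auto
  have s_eq: "sqd d = of_rat (of_int b / of_int (e * f)) * y"
    unfolding y_eq using ef b0 by (simp add: of_rat_divide)
  have yL: "y \<in> L" unfolding y_def using Ladd[OF Lsc[OF x(1), of 2] Lrat[of "- q"]] by (simp add: of_rat_minus)
  have "L = quad_set d"
  proof (intro equalityI subsetI)
    fix z assume "z \<in> L"
    then obtain a' b' where "z = of_rat a' + of_rat b' * x" using rep by blast
    also have "\<dots> = of_rat (a' + b' * (q / 2)) + of_rat (b' * (1 / 2) * (of_int (e * f) / of_int b)) * sqd d"
      by (subst xy, subst y_eq) (simp only: of_rat_add of_rat_mult, simp only: algebra_simps)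
    finally show "z \<in> quad_set d" unfolding quad_set_def by blast
  next
    fix z assume "z \<in> quad_set d"
    then obtain a' b' where "z = of_rat a' + of_rat b' * sqd d" unfolding quad_set_def by blast
    moreover have "sqd d \<in> L" unfolding s_eq by (rule Lsc[OF yL])
    ultimately show "z \<in> L" using Ladd Lsc Lrat by simp
  qed
  thus ?thesis using sq d1 by blast
qed

section \<open>Fractional ideals\<close>

text \<open>\<open>n\<close> is the positive generator of the subgroup \<int>A + \<int>T + \<int>C
  of the rationals, the content of a quadratic form with these coefficients.\<close>

lemma common_unit_of_three_rats:
  fixes A T C :: rat
  assumes "A \<noteq> 0"
  shows "\<exists>n>0. A / n \<in> \<int> \<and> T / n \<in> \<int> \<and> C / n \<in> \<int> \<and> (\<exists>x y z::int. n = of_int x * A + of_int y * T + of_int z * C)"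
proof -
  have den: "\<exists>D::int. D > 0 \<and> of_int D * q \<in> \<int>" for q :: rat
  proof -
    obtain a b where q: "quotient_of q = (a, b)" by fastforce
    have "b > 0" "q = of_int a / of_int b" using q quotient_of_denom_pos quotient_of_div by auto
    thus ?thesis by (intro exI[of _ b]) simp
  qed
  obtain D1 D2 D3 :: int where D: "D1 > 0" "of_int D1 * A \<in> \<int>" "D2 > 0" "of_int D2 * T \<in> \<int>" "D3 > 0" "of_int D3 * C \<in> \<int>"
    using den by metis
  define M where "M = D1 * D2 * D3"
  have M: "M > 0" using D by (simp add: M_def)
  obtain a' where a': "of_int D1 * A = of_int a'" using D by (auto elim: Ints_cases)
  obtain t' where t': "of_int D2 * T = of_int t'" using D by (auto elim: Ints_cases)
  obtain c' where c': "of_int D3 * C = of_int c'" using D by (auto elim: Ints_cases)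
  define a t c where "a = a' * D2 * D3" and "t = t' * D1 * D3" and "c = c' * D1 * D2"
  have a: "of_int M * A = of_int a" and t: "of_int M * T = of_int t" and c: "of_int M * C = of_int c"
    by (simp_all add: M_def a_def t_def c_def a'[symmetric] t'[symmetric] c'[symmetric] mult_ac)
  define g where "g = gcd a (gcd t c)"
  have "of_int a \<noteq> (0::rat)" using assms M unfolding a[symmetric] by simp
  hence "a \<noteq> 0" by simp
  hence g: "g > 0" by (simp add: g_def)
  define n where "n = (of_int g :: rat) / of_int M"
  have n: "n > 0" using g M by (simp add: n_def)
  obtain u v where uv: "u * a + v * gcd t c = g" using bezout_int[of a "gcd t c"] by (auto simp: g_def)
  obtain u' v' where uv': "u' * t + v' * c = gcd t c" using bezout_int[of t c] by auto
  have "g = u * a + (v * u') * t + (v * v') * c" using uv uv' by (simp add: algebra_simps flip: uv')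
  hence "(of_int g :: rat) = of_int u * of_int a + of_int (v * u') * of_int t + of_int (v * v') * of_int c"
    by (metis of_int_add of_int_mult)
  hence "n * of_int M = (of_int u * A + of_int (v * u') * T + of_int (v * v') * C) * of_int M"
    using M by (simp add: n_def a[symmetric] t[symmetric] c[symmetric] algebra_simps)
  hence "n = of_int u * A + of_int (v * u') * T + of_int (v * v') * C" using M by simp
  moreover have "z / n \<in> \<int>" if zw: "of_int M * z = of_int w" "g dvd w" for z w
  proof -
    obtain k where "w = g * k" using zw(2) by blast
    hence "z * of_int M = of_int g * of_int k" using zw(1) by (simp add: mult.commute)
    hence "z / n = of_int k" using M g by (simp add: n_def field_simps)
    thus ?thesis by simp
  qed
  hence "A / n \<in> \<int> \<and> T / n \<in> \<int> \<and> C / n \<in> \<int>"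
    using a t c by (auto simp: g_def intro: dvd_trans[OF gcd_dvd2])
  ultimately show ?thesis using n by blast
qed

lemma int_subspace_iff:
  "int_mod.subspace S \<longleftrightarrow> 0 \<in> S \<and> (\<forall>x\<in>S. \<forall>y\<in>S. x + y \<in> S) \<and> (\<forall>c. \<forall>x\<in>S. of_int c * x \<in> S)"
  by (simp add: int_mod.subspace_def int_scale_def)

context quad begin

abbreviation fi :: "complex set \<Rightarrow> bool" where "fi \<equiv> fractional_ideal K"
abbreviation G where "G \<equiv> fractional_ideal_group K"

definition imul :: "complex set \<Rightarrow> complex set \<Rightarrow> complex set" where
  "imul I J = int_mod.span {a * b | a b. a \<in> I \<and> b \<in> J}"

definition pideal :: "complex \<Rightarrow> complex set" where
  "pideal x = (\<lambda>r. x * r) ` Ok"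

lemma G_simps [simp]: "carrier G = {I. fi I}" "I \<otimes>\<^bsub>G\<^esub> J = imul I J" "\<one>\<^bsub>G\<^esub> = Ok"
  by (simp_all add: fractional_ideal_group_def imul_def)

lemma imul_mem: "a \<in> I \<Longrightarrow> b \<in> J \<Longrightarrow> a * b \<in> imul I J"
  unfolding imul_def by (rule int_mod.span_base) blast

lemma imul_subspace: "int_mod.subspace (imul I J)"
  unfolding imul_def by (rule int_mod.subspace_span)

lemma imul_least:
  assumes "int_mod.subspace S" "\<And>a b. a \<in> I \<Longrightarrow> b \<in> J \<Longrightarrow> a * b \<in> S" shows "imul I J \<subseteq> S"
  unfolding imul_def using assms by (intro int_mod.span_minimal) auto

lemma subspace_preimage: "int_mod.subspace S \<Longrightarrow> int_mod.subspace {x. c * x \<in> S}"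
  unfolding int_subspace_iff by (auto simp: distrib_left mult.left_commute[of c "of_int _"])

lemma imul_commute: "imul I J = imul J I"
proof -
  have "imul I J \<subseteq> imul J I" for I J
    by (rule imul_least[OF imul_subspace]) (metis imul_mem mult.commute)
  thus ?thesis by blast
qed

lemma imul_assoc: "imul (imul I J) L = imul I (imul J L)"
proof -
  have *: "imul (imul I J) L \<subseteq> imul I (imul J L)" for I J L
  proof (rule imul_least[OF imul_subspace])
    fix x c assume x: "x \<in> imul I J" and c: "c \<in> L"
    have "imul I J \<subseteq> {x. c * x \<in> imul I (imul J L)}"
    proof (rule imul_least[OF subspace_preimage[OF imul_subspace]])
      fix a b assume "a \<in> I" "b \<in> J"
      hence "a * (b * c) \<in> imul I (imul J L)" using c by (intro imul_mem)
      thus "a * b \<in> {x. c * x \<in> imul I (imul J L)}" by (simp add: mult_ac)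
    qed
    thus "x * c \<in> imul I (imul J L)" using x by (auto simp: mult.commute)
  qed
  have "imul I (imul J L) = imul (imul L J) I" by (metis imul_commute)
  also have "\<dots> \<subseteq> imul L (imul J I)" by (rule *)
  also have "\<dots> = imul (imul I J) L" by (metis imul_commute)
  finally show ?thesis using *[of I J L] by blast
qed

lemma fi_subspace: "fi I \<Longrightarrow> int_mod.subspace I"
  unfolding int_subspace_iff using fractional_idealD[of I] by blast

lemma K_subspace: "int_mod.subspace K"
  unfolding int_subspace_iff by auto
lemma Ok_subspace: "int_mod.subspace Ok"
  by (rule fi_subspace[OF fractional_ideal_Ok])

lemma fiI:
  assumes "I \<subseteq> K" "int_mod.subspace I" "z \<in> I" "z \<noteq> 0" "\<And>r x. r \<in> Ok \<Longrightarrow> x \<in> I \<Longrightarrow> r * x \<in> I"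
    "b \<in> Ok" "b \<noteq> 0" "\<And>x. x \<in> I \<Longrightarrow> b * x \<in> Ok"
  shows "fi I"
  using assms unfolding fractional_ideal_def int_subspace_iff by blast

lemma fiE:
  assumes "fi I"
  obtains b z where "b \<in> Ok" "b \<noteq> 0" "\<And>x. x \<in> I \<Longrightarrow> b * x \<in> Ok" "z \<in> I" "z \<noteq> 0"
  using assms unfolding fractional_ideal_def by blast

lemma fi_imul: assumes "fi I" "fi J" shows "fi (imul I J)"
proof -
  obtain b z where b: "b \<in> Ok" "b \<noteq> 0" "\<And>x. x \<in> I \<Longrightarrow> b * x \<in> Ok" "z \<in> I" "z \<noteq> 0" using fiE[OF assms(1)] by metis
  obtain b' z' where b': "b' \<in> Ok" "b' \<noteq> 0" "\<And>x. x \<in> J \<Longrightarrow> b' * x \<in> Ok" "z' \<in> J" "z' \<noteq> 0" using fiE[OF assms(2)] by metis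
  note D = fractional_idealD[OF assms(1)] and D' = fractional_idealD[OF assms(2)]
  show ?thesis
  proof (rule fiI[where z = "z * z'" and b = "b * b'"])
    show "imul I J \<subseteq> K" using D(1) D'(1) by (intro imul_least[OF K_subspace]) auto
    show "int_mod.subspace (imul I J)" by (rule imul_subspace)
    show "z * z' \<in> imul I J" using b b' by (intro imul_mem)
    show "z * z' \<noteq> 0" using b b' by simp
    show "b * b' \<in> Ok" "b * b' \<noteq> 0" using b b' by auto
    fix r x assume r: "r \<in> Ok" and x: "x \<in> imul I J"
    have "imul I J \<subseteq> {x. r * x \<in> imul I J}"
    proof (rule imul_least[OF subspace_preimage[OF imul_subspace]])
      fix a c assume "a \<in> I" "c \<in> J"
      hence "(r * a) * c \<in> imul I J" using D(5)[OF r] by (intro imul_mem)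
      thus "a * c \<in> {x. r * x \<in> imul I J}" by (simp add: mult.assoc)
    qed
    thus "r * x \<in> imul I J" using x by blast
  next
    fix x assume x: "x \<in> imul I J"
    have "imul I J \<subseteq> {x. (b * b') * x \<in> Ok}"
    proof (rule imul_least[OF subspace_preimage[OF Ok_subspace]])
      fix a c assume "a \<in> I" "c \<in> J"
      hence "(b * a) * (b' * c) \<in> Ok" using b b' by blast
      thus "a * c \<in> {x. (b * b') * x \<in> Ok}" by (simp add: mult_ac)
    qed
    thus "(b * b') * x \<in> Ok" using x by blast
  qed
qed

lemma imul_one: assumes "fi I" shows "imul Ok I = I"
proof
  show "imul Ok I \<subseteq> I" using fractional_idealD(5)[OF assms] by (intro imul_least[OF fi_subspace[OF assms]])
  show "I \<subseteq> imul Ok I" using imul_mem[OF Ok_01(2)] by fastforce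
qed

lemma Zs_Ok: "z \<in> Zs \<Longrightarrow> z \<in> Ok" unfolding Zs_def by (auto intro!: Ok_add Ok_mult)

lemma pideal_mem: "r \<in> Ok \<Longrightarrow> x * r \<in> pideal x" unfolding pideal_def by (rule imageI)
lemma pideal_self: "x \<in> pideal x" using pideal_mem[OF Ok_01(2), of x] by simp
lemma pideal_1: "pideal 1 = Ok" by (simp add: pideal_def)

lemma fi_pideal: assumes "x \<in> K" "x \<noteq> 0" shows "fi (pideal x)"
proof -
  obtain D :: int where D: "D > 0" "of_int D * x \<in> Zs" using K_denominator[OF assms(1)] .
  show ?thesis
  proof (rule fiI[where z = x and b = "of_int D"])
    show "pideal x \<subseteq> K" using assms Ok_K by (auto simp: pideal_def)
    show "int_mod.subspace (pideal x)" unfolding int_subspace_iff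
    proof (intro conjI ballI allI)
      show "0 \<in> pideal x" using pideal_mem[OF Ok_01(1), of x] by simp
      fix u v assume "u \<in> pideal x" "v \<in> pideal x"
      then obtain r r' where "r \<in> Ok" "r' \<in> Ok" "u = x * r" "v = x * r'" by (auto simp: pideal_def)
      thus "u + v \<in> pideal x" using pideal_mem[of "r + r'" x] by (auto simp: distrib_left)
    next
      fix c :: int and u assume "u \<in> pideal x"
      then obtain r where "r \<in> Ok" "u = x * r" by (auto simp: pideal_def)
      thus "of_int c * u \<in> pideal x" using pideal_mem[OF Ok_mult[OF Ok_int[of c]], of r x] by (simp add: mult.left_commute)
    qed
    show "x \<in> pideal x" by (rule pideal_self)
    fix r y assume r: "r \<in> Ok" and "y \<in> pideal x"
    then obtain r' where "r' \<in> Ok" "y = x * r'" by (auto simp: pideal_def)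
    thus "r * y \<in> pideal x" using pideal_mem[OF Ok_mult[OF r], of r' x] by (simp add: mult.left_commute)
  next
    fix y assume "y \<in> pideal x"
    then obtain r' where "r' \<in> Ok" "y = x * r'" by (auto simp: pideal_def)
    thus "of_int D * y \<in> Ok" using Ok_mult[OF Zs_Ok[OF D(2)], of r'] by (simp add: mult.assoc)
  qed (use assms D in auto)
qed

lemma subspace_image: assumes "int_mod.subspace S" shows "int_mod.subspace ((\<lambda>z. c * z) ` S)"
  unfolding int_subspace_iff
proof (intro conjI ballI allI)
  show "0 \<in> (\<lambda>z. c * z) ` S" using assms by (auto simp: int_subspace_iff intro!: image_eqI[of _ _ 0])
  fix x y assume "x \<in> (\<lambda>z. c * z) ` S" "y \<in> (\<lambda>z. c * z) ` S"
  thus "x + y \<in> (\<lambda>z. c * z) ` S" using assms by (auto simp: int_subspace_iff distrib_left[symmetric])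
next
  fix k :: int and x assume "x \<in> (\<lambda>z. c * z) ` S"
  thus "of_int k * x \<in> (\<lambda>z. c * z) ` S" using assms by (auto simp: int_subspace_iff mult.left_commute[of "of_int k"])
qed

lemma imul_pideal: assumes "fi I" shows "imul (pideal x) I = (\<lambda>z. x * z) ` I"
proof
  show "imul (pideal x) I \<subseteq> (\<lambda>z. x * z) ` I"
  proof (rule imul_least[OF subspace_image[OF fi_subspace[OF assms]]])
    fix a b assume "a \<in> pideal x" "b \<in> I"
    then obtain r where "r \<in> Ok" "a = x * r" by (auto simp: pideal_def)
    thus "a * b \<in> (\<lambda>z. x * z) ` I" using fractional_idealD(5)[OF assms \<open>r \<in> Ok\<close> \<open>b \<in> I\<close>]
      by (metis imageI mult.assoc)
  qed
  show "(\<lambda>z. x * z) ` I \<subseteq> imul (pideal x) I" using imul_mem[OF pideal_self] by blast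
qed

lemma pideal_mult: assumes "x \<in> K" "y \<in> K" "y \<noteq> 0" shows "imul (pideal x) (pideal y) = pideal (x * y)"
  unfolding imul_pideal[OF fi_pideal[OF assms(2,3)]] by (simp add: pideal_def image_image mult.assoc)

definition icj :: "complex set \<Rightarrow> complex set" where "icj I = cj ` I"

lemma icj_icj: "I \<subseteq> K \<Longrightarrow> icj (icj I) = I"
  unfolding icj_def image_image by (force simp: subset_iff image_iff)

lemma icj_subset_K: "I \<subseteq> K \<Longrightarrow> icj I \<subseteq> K" by (auto simp: icj_def)

lemma fi_icj: assumes "fi I" shows "fi (icj I)"
proof -
  obtain b z where b: "b \<in> Ok" "b \<noteq> 0" "\<And>x. x \<in> I \<Longrightarrow> b * x \<in> Ok" "z \<in> I" "z \<noteq> 0" using fiE[OF assms(1)] by metis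
  note D = fractional_idealD[OF assms(1)]
  have IK: "x \<in> K" if "x \<in> I" for x using D(1) that by blast
  show ?thesis
  proof (rule fiI[where z = "cj z" and b = "cj b"])
    show "icj I \<subseteq> K" using icj_subset_K[OF D(1)] .
    show "int_mod.subspace (icj I)" unfolding int_subspace_iff
    proof (intro conjI ballI allI)
      show "0 \<in> icj I" using D(2) unfolding icj_def by (metis cj_01(1) imageI)
      fix x y assume "x \<in> icj I" "y \<in> icj I"
      then obtain u v where "u \<in> I" "v \<in> I" "x = cj u" "y = cj v" by (auto simp: icj_def)
      thus "x + y \<in> icj I" using D(4)[of u v] IK unfolding icj_def by (metis cj_add imageI)
    next
      fix c :: int and x assume "x \<in> icj I"
      then obtain u where "u \<in> I" "x = cj u" by (auto simp: icj_def)
      thus "of_int c * x \<in> icj I" using D(8)[of u c] IK unfolding icj_def by (metis cj_mult cj_int int_in_K imageI)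
    qed
    show "cj z \<in> icj I" using b by (auto simp: icj_def)
    show "cj z \<noteq> 0" "cj b \<in> Ok" "cj b \<noteq> 0" using b IK Ok_K by auto
    fix r x assume r: "r \<in> Ok" and "x \<in> icj I"
    then obtain u where u: "u \<in> I" "x = cj u" by (auto simp: icj_def)
    have "cj (cj r * u) = r * x" using u IK Ok_K[OF r] by simp
    thus "r * x \<in> icj I" using D(5)[OF Ok_cj[OF r] u(1)] unfolding icj_def by (metis imageI)
  next
    fix x assume "x \<in> icj I"
    then obtain u where u: "u \<in> I" "x = cj u" by (auto simp: icj_def)
    have "cj (b * u) = cj b * x" using u IK Ok_K[OF b(1)] by simp
    thus "cj b * x \<in> Ok" using b(3)[OF u(1)] Ok_cj by metis
  qed
qed

lemma icj_pideal: assumes "x \<in> K" shows "icj (pideal x) = pideal (cj x)"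
proof -
  have "icj (pideal x) = (\<lambda>r. cj x * cj r) ` Ok"
    unfolding icj_def pideal_def image_image using assms Ok_K by (intro image_cong refl) auto
  also have "\<dots> = (\<lambda>r. cj x * r) ` (cj ` Ok)" by (simp add: image_image)
  also have "cj ` Ok = Ok"
  proof
    show "cj ` Ok \<subseteq> Ok" using Ok_cj by auto
    show "Ok \<subseteq> cj ` Ok" using Ok_cj Ok_K by (metis cj_cj image_eqI subsetI)
  qed
  finally show ?thesis by (simp add: pideal_def)
qed

lemma icj_imul: assumes "fi I" "fi J" shows "icj (imul I J) = imul (icj I) (icj J)"
proof -
  have *: "icj (imul I J) \<subseteq> imul (icj I) (icj J)" if "fi I" "fi J" for I J
  proof -
    have IK: "I \<subseteq> K" "J \<subseteq> K" using that fractional_idealD(1) by blast+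
    have sub: "int_mod.subspace {x \<in> K. cj x \<in> imul (icj I) (icj J)}"
      using imul_subspace[of "icj I" "icj J"] unfolding int_subspace_iff by auto
    have "imul I J \<subseteq> {x \<in> K. cj x \<in> imul (icj I) (icj J)}"
      by (rule imul_least[OF sub]) (use IK imul_mem[of _ "icj I" _ "icj J"] in \<open>auto simp: icj_def subset_iff\<close>)
    thus ?thesis by (auto simp: icj_def)
  qed
  have "imul (icj I) (icj J) = icj (icj (imul (icj I) (icj J)))"
    using icj_icj fractional_idealD(1) fi_imul fi_icj assms by metis
  also have "\<dots> \<subseteq> icj (imul (icj (icj I)) (icj (icj J)))"
    using *[OF fi_icj[OF assms(1)] fi_icj[OF assms(2)]] unfolding icj_def by (rule image_mono)
  also have "\<dots> = icj (imul I J)" using icj_icj fractional_idealD(1) assms by metis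
  finally show ?thesis using *[OF assms] by blast
qed

text \<open>\<open>n\<close> is the content of the norm form on a basis \<alpha>, \<beta>. It lies
  in the product as a combination of norms and traces of products of basis elements; conversely
  \<open>n\<close> divides all these products. This one identity provides both the norm and the
  inverse of an ideal.\<close>

lemma ideal_mult_conj:
  assumes "fi I" shows "\<exists>n>0. imul I (icj I) = pideal (of_rat n)"
proof -
  obtain \<alpha> \<beta> where ab: "\<alpha> \<in> I" "\<beta> \<in> I" "I = {of_int x * \<alpha> + of_int y * \<beta> | x y. True}"
    "\<alpha> * cj \<beta> - \<beta> * cj \<alpha> \<noteq> 0" using fractional_ideal_basis[OF assms] by metis
  have IK: "\<alpha> \<in> K" "\<beta> \<in> K" using ab(1,2) fractional_idealD(1)[OF assms] by auto
  have a0: "nm \<alpha> \<noteq> 0" using ab(4) nm_eq_0_iff[OF IK(1)] by auto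
  define T where "T = tr (\<alpha> * cj \<beta>)"
  obtain n x y z where n: "n > 0" "nm \<alpha> / n \<in> \<int>" "T / n \<in> \<int>" "nm \<beta> / n \<in> \<int>"
    and nxyz: "n = of_int x * nm \<alpha> + of_int y * T + of_int z * nm \<beta>"
    using common_unit_of_three_rats[OF a0, of T "nm \<beta>"] by blast
  have fJ: "fi (imul I (icj I))" by (intro fi_imul fi_icj assms)
  note DJ = fractional_idealD[OF fJ]
  have mem: "u * cj v \<in> imul I (icj I)" if "u \<in> I" "v \<in> I" for u v
    using that by (intro imul_mem) (auto simp: icj_def)
  have T_eq: "of_rat T = \<alpha> * cj \<beta> + \<beta> * cj \<alpha>"
    unfolding T_def using IK by (subst tr_eq[symmetric]) auto
  have "of_rat n = of_int x * (\<alpha> * cj \<alpha>) + of_int y * (\<alpha> * cj \<beta> + \<beta> * cj \<alpha>) + of_int z * (\<beta> * cj \<beta>)"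
    by (subst nxyz) (simp add: of_rat_add of_rat_mult T_eq nm_eq IK)
  also have "\<dots> \<in> imul I (icj I)" using mem ab(1,2) by (intro DJ(4) DJ(8)) auto
  finally have nJ: "of_rat n \<in> imul I (icj I)" .
  have sub1: "pideal (of_rat n) \<subseteq> imul I (icj I)"
    using DJ(5)[OF _ nJ] by (auto simp: pideal_def mult.commute)
  have fn: "fi (pideal (of_rat n))" using n(1) by (intro fi_pideal) auto
  note Dn = fractional_idealD[OF fn]
  have inn: "u \<in> pideal (of_rat n)" if "u / of_rat n \<in> Ok" for u
    using pideal_mem[OF that, of "of_rat n"] n(1) by simp
  have g1: "\<alpha> * cj \<alpha> \<in> pideal (of_rat n)" "\<beta> * cj \<beta> \<in> pideal (of_rat n)"
    using n by (auto intro!: inn simp: nm_eq IK Ok_rat simp flip: of_rat_divide)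
  have dz: "of_rat q * u \<in> K" if "u \<in> K" for q u using that by simp
  \<comment> \<open>The form of Gauss's lemma used here: after division by \<open>n\<close> the
    mixed product has integral trace by the choice of \<open>n\<close>, and its norm is the product
    of the integers \<open>nm \<alpha> / n\<close> and \<open>nm \<beta> / n\<close>.\<close>
  have g2: "\<alpha> * cj \<beta> \<in> pideal (of_rat n)"
  proof (rule inn)
    let ?u = "\<alpha> * cj \<beta> / of_rat n"
    have uK: "?u \<in> K" using IK by auto
    have "(of_rat (tr ?u) :: complex) = of_rat (T / n)"
      using tr_eq[OF uK] IK by (simp add: T_eq of_rat_divide add_divide_distrib mult.commute[of \<beta>])
    hence "tr ?u = T / n" by simp
    moreover have "(of_rat (nm ?u) :: complex) = of_rat ((nm \<alpha> / n) * (nm \<beta> / n))"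
      using nm_eq[OF uK, symmetric] IK by (simp add: of_rat_divide of_rat_mult nm_eq[symmetric] mult_ac)
    hence "nm ?u = (nm \<alpha> / n) * (nm \<beta> / n)" by (simp only: of_rat_eq_iff)
    moreover have "(nm \<alpha> / n) * (nm \<beta> / n) \<in> \<int>" using n by (intro Ints_mult)
    ultimately show "?u \<in> Ok" using n(3) uK unfolding Ok_iff by (simp only:)
  qed
  have g3: "\<beta> * cj \<alpha> \<in> pideal (of_rat n)"
  proof -
    have "cj (\<alpha> * cj \<beta>) \<in> icj (pideal (of_rat n))" using g2 by (auto simp: icj_def)
    thus ?thesis using IK by (simp add: icj_pideal mult.commute)
  qed
  have "imul I (icj I) \<subseteq> pideal (of_rat n)"
  proof (rule imul_least[OF fi_subspace[OF fn]])
    fix u v assume "u \<in> I" "v \<in> icj I"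
    then obtain w where w: "w \<in> I" "v = cj w" by (auto simp: icj_def)
    obtain k l k' l' where kl: "u = of_int k * \<alpha> + of_int l * \<beta>" "w = of_int k' * \<alpha> + of_int l' * \<beta>"
      using \<open>u \<in> I\<close> w(1) ab(3) by blast
    have "u * v = of_int (k * k') * (\<alpha> * cj \<alpha>) + of_int (k * l') * (\<alpha> * cj \<beta>)
        + of_int (l * k') * (\<beta> * cj \<alpha>) + of_int (l * l') * (\<beta> * cj \<beta>)"
      unfolding w kl using IK by (simp add: algebra_simps)
    also have "\<dots> \<in> pideal (of_rat n)" using g1 g2 g3 by (intro Dn(4) Dn(8))
    finally show "u * v \<in> pideal (of_rat n)" .
  qed
  thus ?thesis using sub1 n(1) by blast
qed

section \<open>The ideal norm and the class group\<close>

lemma pideal_pos_rat_inj: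
  assumes "pideal (of_rat n) = pideal (of_rat m)" "n > 0" "m > 0" shows "n = m"
proof -
  have *: "\<exists>k. n = m * of_int k" if "pideal (of_rat n) = pideal (of_rat m)" "n > 0" "m > 0" for n m
  proof -
    have "of_rat n \<in> pideal (of_rat m)" using pideal_self that by metis
    then obtain r where r: "r \<in> Ok" "of_rat n = of_rat m * r" by (auto simp: pideal_def)
    hence "r = of_rat (n / m)" using that by (simp add: of_rat_divide field_simps)
    hence "n / m \<in> \<int>" using r(1) Ok_rat by blast
    then obtain k where "n / m = of_int k" by (auto elim: Ints_cases)
    thus ?thesis using that by (intro exI[of _ k]) (simp add: field_simps)
  qed
  obtain k where k: "n = m * of_int k" using *[OF assms] by blast
  obtain k' where k': "m = n * of_int k'" using *[OF assms(1)[symmetric] assms(3,2)] by blast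
  have "m = m * of_int (k * k')" using k k' by (metis mult.assoc of_int_mult)
  hence "k * k' = 1" using assms(3) by (metis mult_cancel_left1 of_int_eq_1_iff order_less_irrefl)
  moreover have "k > 0" using k assms by (simp add: zero_less_mult_iff)
  ultimately have "k = 1" by (metis zmult_eq_1_iff zero_less_one not_one_less_zero less_minus_one_simps(3))
  thus ?thesis using k by simp
qed

text \<open>The absolute norm of a fractional ideal. Defined by the product with the conjugate
  ideal, it is multiplicative at once.\<close>

definition inm :: "complex set \<Rightarrow> rat" where
  "inm I = (THE n. n > 0 \<and> imul I (icj I) = pideal (of_rat n))"

lemma inm: assumes "fi I" shows "inm I > 0" "imul I (icj I) = pideal (of_rat (inm I))"
proof -
  have "\<exists>!n. n > 0 \<and> imul I (icj I) = pideal (of_rat n)"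
    using ideal_mult_conj[OF assms] pideal_pos_rat_inj by metis
  from theI'[OF this] show "inm I > 0" "imul I (icj I) = pideal (of_rat (inm I))" by (simp_all add: inm_def)
qed

lemma inm_unique: "fi I \<Longrightarrow> n > 0 \<Longrightarrow> imul I (icj I) = pideal (of_rat n) \<Longrightarrow> inm I = n"
  using inm pideal_pos_rat_inj by metis

lemma inm_imul: assumes "fi I" "fi J" shows "inm (imul I J) = inm I * inm J"
proof (rule inm_unique[OF fi_imul[OF assms]])
  show "inm I * inm J > 0" using inm assms by simp
  have "imul (imul I J) (icj (imul I J)) = imul (imul I (icj I)) (imul J (icj J))"
    unfolding icj_imul[OF assms] by (metis imul_assoc imul_commute)
  also have "\<dots> = pideal (of_rat (inm I * inm J))"
    using inm[OF assms(1)] inm[OF assms(2)] by (simp add: pideal_mult of_rat_mult)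
  finally show "imul (imul I J) (icj (imul I J)) = pideal (of_rat (inm I * inm J))" .
qed

lemma pideal_uminus: "pideal (- x) = pideal x"
proof -
  have "pideal (- x) \<subseteq> pideal x" for x
  proof
    fix u assume "u \<in> pideal (- x)"
    then obtain r where "r \<in> Ok" "u = x * (- r)" by (auto simp: pideal_def)
    thus "u \<in> pideal x" using pideal_mem[OF Ok_uminus] by metis
  qed
  from this[of x] this[of "- x"] show ?thesis by auto
qed

lemma inm_pideal: assumes "x \<in> K" "x \<noteq> 0" shows "inm (pideal x) = \<bar>nm x\<bar>"
proof (rule inm_unique[OF fi_pideal[OF assms]])
  show "\<bar>nm x\<bar> > 0" using nm_eq_0_iff assms by simp
  have "imul (pideal x) (icj (pideal x)) = pideal (of_rat (nm x))"
    using assms by (simp add: icj_pideal pideal_mult nm_eq)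
  thus "imul (pideal x) (icj (pideal x)) = pideal (of_rat \<bar>nm x\<bar>)"
    by (cases "nm x \<ge> 0") (simp_all add: of_rat_minus pideal_uminus)
qed

lemma inm_icj: assumes "fi I" shows "inm (icj I) = inm I"
  by (rule inm_unique[OF fi_icj[OF assms]])
     (use inm[OF assms] icj_icj[OF fractional_idealD(1)[OF assms]] imul_commute in auto)

text \<open>The inverse of \<open>I\<close> is the conjugate ideal divided by the norm of
  \<open>I\<close>.\<close>

lemma comm_group_G: "comm_group G"
proof (rule comm_groupI)
  fix I assume "I \<in> carrier G"
  hence I: "fi I" by simp
  let ?J = "imul (pideal (of_rat (1 / inm I))) (icj I)"
  have i0: "of_rat (1 / inm I) \<noteq> (0::complex)" using inm(1)[OF I] by simp
  have J: "fi ?J" using i0 by (intro fi_imul fi_pideal fi_icj I) auto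
  have "imul ?J I = imul (pideal (of_rat (1 / inm I))) (imul I (icj I))"
    by (metis imul_assoc imul_commute)
  also have "\<dots> = pideal (of_rat (1 / inm I) * of_rat (inm I))"
    unfolding inm(2)[OF I] using inm(1)[OF I] by (intro pideal_mult) auto
  also have "\<dots> = Ok" using inm(1)[OF I] pideal_1 by (simp flip: of_rat_mult)
  finally show "\<exists>J\<in>carrier G. J \<otimes>\<^bsub>G\<^esub> I = \<one>\<^bsub>G\<^esub>" using J by auto
next
  fix I J show "I \<otimes>\<^bsub>G\<^esub> J = J \<otimes>\<^bsub>G\<^esub> I" by (simp only: G_simps imul_commute)
qed (auto simp: fi_imul fractional_ideal_Ok imul_assoc imul_one)

sublocale G: comm_group G by (rule comm_group_G)

lemma inm_Ok: "inm Ok = 1"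
  using inm_pideal[of 1] nm_rat[of 1] by (simp add: pideal_1)

lemma fi_pow: "fi I \<Longrightarrow> fi (I [^]\<^bsub>G\<^esub> (n::nat))" using G.nat_pow_closed[of I n] by simp

lemma inm_pow: assumes "fi I" shows "inm (I [^]\<^bsub>G\<^esub> (n::nat)) = inm I ^ n"
  by (induction n) (simp_all add: inm_Ok inm_imul fi_pow assms)

lemma pideal_pow: assumes "x \<in> K" "x \<noteq> 0" shows "pideal x [^]\<^bsub>G\<^esub> (n::nat) = pideal (x ^ n)"
  by (induction n) (simp_all add: pideal_1 pideal_mult assms mult.commute)

lemma principal_ideals_eq: "principal_ideals K = pideal ` (K - {0})"
  by (auto simp: principal_ideals_def pideal_def)

lemma subgroup_principal: "subgroup (principal_ideals K) G"
proof (rule G.subgroupI)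
  show "principal_ideals K \<subseteq> carrier G" by (auto simp: principal_ideals_eq fi_pideal)
  show "principal_ideals K \<noteq> {}" unfolding principal_ideals_eq using zero_one_in_K by auto
  fix I assume "I \<in> principal_ideals K"
  then obtain x where x: "x \<in> K" "x \<noteq> 0" "I = pideal x" by (auto simp: principal_ideals_eq)
  have "pideal (inverse x) \<otimes>\<^bsub>G\<^esub> I = \<one>\<^bsub>G\<^esub>" using x by (simp add: pideal_mult pideal_1)
  hence "inv\<^bsub>G\<^esub> I = pideal (inverse x)" using x by (intro G.inv_equality) (auto simp: fi_pideal)
  thus "inv\<^bsub>G\<^esub> I \<in> principal_ideals K" using x by (auto simp: principal_ideals_eq)
next
  fix I J assume "I \<in> principal_ideals K" "J \<in> principal_ideals K"
  then obtain x y where "x \<in> K" "x \<noteq> 0" "I = pideal x" "y \<in> K" "y \<noteq> 0" "J = pideal y"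
    by (auto simp: principal_ideals_eq)
  thus "I \<otimes>\<^bsub>G\<^esub> J \<in> principal_ideals K" by (auto simp: principal_ideals_eq pideal_mult)
qed

text \<open>The generator \<gamma> is left unnormalized: it may be changed by any unit, and the
  weight chosen later depends on it accordingly.\<close>

lemma torsion_representative:
  assumes "c \<in> class_group_torsion K l"
  shows "\<exists>A \<gamma>. fi A \<and> c = principal_ideals K #>\<^bsub>G\<^esub> A \<and> \<gamma> \<in> K \<and> \<gamma> \<noteq> 0 \<and> A [^]\<^bsub>G\<^esub> l = pideal \<gamma>"
proof -
  let ?H = "principal_ideals K"
  interpret N: normal ?H G using G.subgroup_imp_normal[OF subgroup_principal] .
  have c: "c \<in> rcosets\<^bsub>G\<^esub> ?H" "c [^]\<^bsub>G Mod ?H\<^esub> l = ?H"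
    using assms by (auto simp: class_group_torsion_def class_group_def FactGroup_def)
  then obtain A where A: "A \<in> carrier G" "c = ?H #>\<^bsub>G\<^esub> A" by (auto simp: RCOSETS_def)
  have pow: "(?H #>\<^bsub>G\<^esub> A) [^]\<^bsub>G Mod ?H\<^esub> (n::nat) = ?H #>\<^bsub>G\<^esub> (A [^]\<^bsub>G\<^esub> n)" for n
  proof (induction n)
    case 0
    show ?case using G.coset_mult_one[OF N.subset] by (simp add: FactGroup_def)
  next
    case (Suc n)
    thus ?case using N.rcos_sum[of "A [^]\<^bsub>G\<^esub> n" A] A(1) G.nat_pow_closed[OF A(1)]
      by (simp add: FactGroup_def)
  qed
  have "?H #>\<^bsub>G\<^esub> (A [^]\<^bsub>G\<^esub> l) = ?H" using c(2) pow A(2) by simp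
  hence "A [^]\<^bsub>G\<^esub> l \<in> ?H"
    using G.coset_join1[OF _ G.nat_pow_closed[OF A(1)] subgroup_principal] by blast
  thus ?thesis using A by (auto simp: principal_ideals_eq)
qed

lemma coset_eq_of_principal_multiple:
  assumes "fi A" "x \<in> K" "x \<noteq> 0" "B = imul (pideal x) A"
  shows "principal_ideals K #>\<^bsub>G\<^esub> B = principal_ideals K #>\<^bsub>G\<^esub> A"
proof -
  have "pideal x \<in> principal_ideals K" using assms by (auto simp: principal_ideals_eq)
  hence "B \<in> principal_ideals K #>\<^bsub>G\<^esub> A" unfolding assms(4) r_coset_def by auto
  from G.repr_independence[OF this _ subgroup_principal] show ?thesis using assms(1) by simp
qed

text \<open>The norm form divided by the ideal norm has integer coefficients. The last claim
  compares its discriminant with that of \<int>[\<surd>d]: \<open>j\<close> is the index-like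
  integer for which the form has discriminant 4d / j^2.\<close>

lemma basis_form_integral:
  assumes "fi I" "\<alpha> \<in> I" "\<beta> \<in> I" "I = {of_int x * \<alpha> + of_int y * \<beta> | x y. True}"
  shows "nm \<alpha> / inm I \<in> \<int>" "nm \<beta> / inm I \<in> \<int>" "tr (\<alpha> * cj \<beta>) / inm I \<in> \<int>"
    "\<exists>j::int. j \<noteq> 0 \<and> 2 * of_rat (inm I) * s = of_int j * (\<alpha> * cj \<beta> - \<beta> * cj \<alpha>)"
proof -
  let ?n = "inm I"
  note n = inm[OF assms(1)]
  have IK: "\<alpha> \<in> K" "\<beta> \<in> K" using assms(2,3) fractional_idealD(1)[OF assms(1)] by auto
  have inOk: "u * cj v / of_rat ?n \<in> Ok" if "u \<in> I" "v \<in> I" for u v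
  proof -
    have "u * cj v \<in> imul I (icj I)" using that by (intro imul_mem) (auto simp: icj_def)
    then obtain r where "r \<in> Ok" "u * cj v = of_rat ?n * r" unfolding n(2) by (auto simp: pideal_def)
    thus ?thesis using n(1) by simp
  qed
  have "of_rat (nm \<alpha> / ?n) \<in> Ok" "of_rat (nm \<beta> / ?n) \<in> Ok"
    using inOk[OF assms(2,2)] inOk[OF assms(3,3)] by (simp_all add: of_rat_divide nm_eq IK)
  thus "nm \<alpha> / ?n \<in> \<int>" "nm \<beta> / ?n \<in> \<int>" by (simp_all only: Ok_rat)
  let ?u = "\<alpha> * cj \<beta> / of_rat ?n"
  have uK: "?u \<in> K" using IK by auto
  have "(of_rat (tr ?u) :: complex) = of_rat (tr (\<alpha> * cj \<beta>) / ?n)"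
    using tr_eq[OF uK, symmetric] tr_eq[of "\<alpha> * cj \<beta>", symmetric] IK by (simp add: of_rat_divide add_divide_distrib)
  hence "tr ?u = tr (\<alpha> * cj \<beta>) / ?n" by (simp only: of_rat_eq_iff)
  thus "tr (\<alpha> * cj \<beta>) / ?n \<in> \<int>" using inOk[OF assms(2,3)] unfolding Ok_iff by simp
  \<comment> \<open>On products of basis elements with conjugates, z minus its conjugate is an
    integer multiple of one determinant. The set \<open>?S\<close> spreads this to the whole ideal
    product, which contains \<open>of_rat ?n * s\<close>.\<close>
  let ?S = "{z \<in> K. \<exists>k. z - cj z = of_int k * (\<alpha> * cj \<beta> - \<beta> * cj \<alpha>)}"
  have sub: "int_mod.subspace ?S" unfolding int_subspace_iff
  proof (intro conjI ballI allI)
    show "0 \<in> ?S" by (auto intro!: exI[of _ 0])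
    fix x y assume "x \<in> ?S" "y \<in> ?S"
    then obtain k k' where "x \<in> K" "y \<in> K" "x - cj x = of_int k * (\<alpha> * cj \<beta> - \<beta> * cj \<alpha>)"
      "y - cj y = of_int k' * (\<alpha> * cj \<beta> - \<beta> * cj \<alpha>)" by blast
    moreover have "(x + y) - cj (x + y) = (x - cj x) + (y - cj y)"
      using \<open>x \<in> K\<close> \<open>y \<in> K\<close> by (simp add: algebra_simps)
    with calculation have "(x + y) - cj (x + y) = of_int (k + k') * (\<alpha> * cj \<beta> - \<beta> * cj \<alpha>)"
      by (simp only: of_int_add distrib_right)
    ultimately show "x + y \<in> ?S" by blast
  next
    fix c :: int and x assume "x \<in> ?S"
    then obtain k where "x \<in> K" "x - cj x = of_int k * (\<alpha> * cj \<beta> - \<beta> * cj \<alpha>)" by blast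
    moreover from this have "of_int c * x - cj (of_int c * x) = of_int (c * k) * (\<alpha> * cj \<beta> - \<beta> * cj \<alpha>)"
      by (metis (no_types, lifting) cj_int cj_mult int_in_K mult.assoc of_int_mult right_diff_distrib)
    ultimately show "of_int c * x \<in> ?S" by blast
  qed
  have "imul I (icj I) \<subseteq> ?S"
  proof (rule imul_least[OF sub])
    fix u v assume "u \<in> I" "v \<in> icj I"
    then obtain w where w: "w \<in> I" "v = cj w" by (auto simp: icj_def)
    obtain k l k' l' where kl: "u = of_int k * \<alpha> + of_int l * \<beta>" "w = of_int k' * \<alpha> + of_int l' * \<beta>"
      using \<open>u \<in> I\<close> w(1) assms(4) by blast
    have "u * v - cj (u * v) = of_int (k * l' - l * k') * (\<alpha> * cj \<beta> - \<beta> * cj \<alpha>)"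
      unfolding w kl using IK by (simp add: algebra_simps)
    moreover have "u * v \<in> K" unfolding w kl using IK by auto
    ultimately show "u * v \<in> ?S" by blast
  qed
  moreover have "of_rat ?n * s \<in> imul I (icj I)" unfolding n(2) by (rule pideal_mem) simp
  ultimately obtain j where "of_rat ?n * s - cj (of_rat ?n * s) = of_int j * (\<alpha> * cj \<beta> - \<beta> * cj \<alpha>)" by blast
  hence j: "2 * of_rat ?n * s = of_int j * (\<alpha> * cj \<beta> - \<beta> * cj \<alpha>)" by (simp add: mult_ac)
  moreover have "j \<noteq> 0"
  proof
    assume "j = 0"
    hence "2 * of_rat ?n * s = 0" using j by simp
    thus False using n(1) s_irrational[of 0] by simp
  qed
  ultimately show "\<exists>j::int. j \<noteq> 0 \<and> 2 * of_rat ?n * s = of_int j * (\<alpha> * cj \<beta> - \<beta> * cj \<alpha>)" by blast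
qed

end

section \<open>Reduced bases of ideals\<close>

text \<open>In a code \<open>(u, (j, B), A)\<close> the form has first coefficients \<open>A, B\<close> and discriminant \<open>4 d / j\<^sup>2\<close>, and
  \<open>u\<close> is the rounded logarithm.\<close>

definition ideal_codes :: "int \<Rightarrow> nat \<Rightarrow> (int \<times> (int \<times> int) \<times> int) set" where
  "ideal_codes d l = {u. real_of_int \<bar>u\<bar> \<le> real l * ln (3 * sqrt \<bar>of_int d\<bar>) + 1} \<times>
     (SIGMA (j, B) : {-2..2} \<times> {B. B\<^sup>2 \<le> 25 * \<bar>d\<bar>}. {A. j\<^sup>2 * B\<^sup>2 - 4 * d \<noteq> 0 \<and> A dvd (j\<^sup>2 * B\<^sup>2 - 4 * d)})"

lemma mem_ideal_codes:
  "(u, (j, B), A) \<in> ideal_codes d l \<longleftrightarrow>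
     real_of_int \<bar>u\<bar> \<le> real l * ln (3 * sqrt \<bar>of_int d\<bar>) + 1 \<and> \<bar>j\<bar> \<le> 2 \<and> B\<^sup>2 \<le> 25 * \<bar>d\<bar> \<and>
     j\<^sup>2 * B\<^sup>2 - 4 * d \<noteq> 0 \<and> A dvd (j\<^sup>2 * B\<^sup>2 - 4 * d)"
  by (auto simp: ideal_codes_def)

lemma squarefree_square_dvd_4_mult:
  fixes d j :: int
  assumes "squarefree d" "j\<^sup>2 dvd 4 * d" shows "\<bar>j\<bar> \<le> 2"
proof (cases "even j")
  case True
  then obtain i where i: "j = 2 * i" by blast
  have "i\<^sup>2 dvd d" using assms(2) unfolding i by (simp add: power_mult_distrib)
  hence "i dvd 1" using assms(1) by (auto simp: squarefree_def)
  thus ?thesis using i by auto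
next
  case False
  hence "coprime (j\<^sup>2) (4::int)" using coprime_power_right_iff[of j 2 2] by (simp add: coprime_right_2_iff_odd)
  hence "j\<^sup>2 dvd d" using assms(2) coprime_dvd_mult_right_iff by blast
  hence "j dvd 1" using assms(1) by (auto simp: squarefree_def)
  thus ?thesis by auto
qed

lemma of_rat_complex: "(of_rat a :: complex) = of_real (of_rat a)"
  by (cases a) (simp add: of_rat_rat)

lemma cmod_sq_lin_comb:
  "(cmod (of_int x * \<alpha> + of_int y * \<beta>))\<^sup>2
     = (of_int x)\<^sup>2 * (cmod \<alpha>)\<^sup>2 + 2 * of_int x * of_int y * Re (\<alpha> * cnj \<beta>) + (of_int y)\<^sup>2 * (cmod \<beta>)\<^sup>2"
  unfolding cmod_power2 by (simp add: power2_eq_square algebra_simps)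

context quad begin

lemma K_real: assumes "d > 0" "z \<in> K" shows "Im z = 0"
proof -
  have "of_int d = (of_real (real_of_int d) :: complex)" by simp
  hence "s = of_real (sqrt (of_int d))" unfolding sqd_def using assms(1) by (simp only: csqrt_of_real_nonneg[of "real_of_int d"] of_int_0_le_iff) simp
  moreover note of_rat_complex
  ultimately show ?thesis using assms(2) by (elim K_cases) (metis Im_complex_of_real of_real_add of_real_mult)
qed

lemma cj_eq_cnj: assumes "d < 0" "z \<in> K" shows "cj z = cnj z"
proof -
  have "cnj s * cnj s = s * s" using s_s by (metis complex_cnj_mult complex_cnj_of_int of_rat_of_int_eq)
  hence "cnj s = s \<or> cnj s = - s" by (metis square_eq_iff)
  moreover have "cnj s \<noteq> s"
  proof
    assume "cnj s = s"
    hence "Im s = 0" by (metis cnj.simps(2) equal_neg_zero)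
    hence "Re (s * s) \<ge> 0" by simp
    thus False using assms(1) sqd_mult_self[of d] by simp
  qed
  ultimately have cs: "cnj s = - s" by blast
  have cr: "cnj (of_rat a) = of_rat a" for a
  proof -
    show ?thesis by (simp add: of_rat_complex)
  qed
  show ?thesis using assms(2) by (elim K_cases) (simp add: cs cr)
qed

text \<open>The weight does not change the discriminant of the form, see \<open>wnorm_disc\<close>; in the imaginary case the
  two absolute values agree and the only admissible weight is \<open>1\<close>.\<close>

definition wnorm :: "real \<Rightarrow> complex \<Rightarrow> real" where
  "wnorm w z = (cmod z)\<^sup>2 / w + w * (cmod (cj z))\<^sup>2"

text \<open>The middle coefficient of \<open>wnorm w\<close> as a binary quadratic form on the
  lattice spanned by \<alpha> and \<beta>.\<close>

definition wcross :: "real \<Rightarrow> complex \<Rightarrow> complex \<Rightarrow> real" where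
  "wcross w \<alpha> \<beta> = 2 * (Re (\<alpha> * cnj \<beta>) / w + w * Re (cj \<alpha> * cnj (cj \<beta>)))"

lemma wnorm_lin_comb:
  assumes "\<alpha> \<in> K" "\<beta> \<in> K"
  shows "wnorm w (of_int x * \<alpha> + of_int y * \<beta>)
    = wnorm w \<alpha> * (of_int x)\<^sup>2 + wcross w \<alpha> \<beta> * of_int x * of_int y + wnorm w \<beta> * (of_int y)\<^sup>2"
proof -
  have "cj (of_int x * \<alpha> + of_int y * \<beta>) = of_int x * cj \<alpha> + of_int y * cj \<beta>" using assms by simp
  thus ?thesis unfolding wnorm_def wcross_def cmod_sq_lin_comb
    by (simp add: cmod_sq_lin_comb add_divide_distrib algebra_simps)
qed

text \<open>In the real case this is the Gram determinant of two vectors in the plane, whose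
  coordinates are scaled by factors of product 1. In the imaginary case conjugation in
  \<open>K\<close> is complex conjugation and both terms of the norm coincide.\<close>

lemma wnorm_disc:
  assumes "\<alpha> \<in> K" "\<beta> \<in> K" "w > 0" "d < 0 \<Longrightarrow> w = 1"
  shows "4 * wnorm w \<alpha> * wnorm w \<beta> - (wcross w \<alpha> \<beta>)\<^sup>2 = 4 * (cmod (\<alpha> * cj \<beta> - \<beta> * cj \<alpha>))\<^sup>2"
proof (cases "d > 0")
  case True
  have real: "z = of_real (Re z)" if "z \<in> K" for z
    using K_real[OF True that] by (intro complex_eqI) auto
  define p1 q1 p2 q2 where "p1 = Re \<alpha>" "q1 = Re \<beta>" "p2 = Re (cj \<alpha>)" "q2 = Re (cj \<beta>)"
  have p2: "cj \<alpha> = of_real p2" and q2: "cj \<beta> = of_real q2" and p1: "\<alpha> = of_real p1" and q1: "\<beta> = of_real q1"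
    unfolding p1_q1_p2_q2_def using real assms(1,2) by auto
  have "\<alpha> * cj \<beta> - \<beta> * cj \<alpha> = of_real (p1 * q2 - q1 * p2)"
    unfolding p2 q2 by (simp add: p1 q1)
  hence "cmod (\<alpha> * cj \<beta> - \<beta> * cj \<alpha>) = \<bar>p1 * q2 - q1 * p2\<bar>" by (simp only: norm_of_real)
  moreover have "4 * (p1\<^sup>2 / w + w * p2\<^sup>2) * (q1\<^sup>2 / w + w * q2\<^sup>2) - (2 * (p1 * q1 / w + w * (p2 * q2)))\<^sup>2
      = 4 * (p1 * q2 - q1 * p2)\<^sup>2"
    using assms(3) by (simp add: field_simps power2_eq_square)
  ultimately show ?thesis unfolding wnorm_def wcross_def p2 q2 unfolding p1 q1 by simp
next
  case False
  hence d: "d < 0" using d0 by simp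
  have w: "w = 1" using assms(4) d by simp
  have c: "cj \<alpha> = cnj \<alpha>" "cj \<beta> = cnj \<beta>" using cj_eq_cnj[OF d] assms(1,2) by auto
  show ?thesis unfolding wnorm_def wcross_def c w cmod_power2 by (simp add: power2_eq_square algebra_simps)
qed

text \<open>The unimodular change of basis produced by form reduction preserves the lattice as well
  as the determinant \<open>\<alpha> * cj \<beta> - \<beta> * cj \<alpha>\<close>.\<close>

lemma ideal_reduced_basis:
  assumes I: "fi I" and w: "w > 0" "d < 0 \<Longrightarrow> w = 1"
  shows "\<exists>\<alpha> \<beta>. \<alpha> \<in> I \<and> \<beta> \<in> I \<and> I = {of_int x * \<alpha> + of_int y * \<beta> | x y. True} \<and> \<alpha> * cj \<beta> - \<beta> * cj \<alpha> \<noteq> 0 \<and>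
    wnorm w \<alpha> \<le> wnorm w \<beta> \<and> 3 * wnorm w \<alpha> * wnorm w \<beta> \<le> 4 * (cmod (\<alpha> * cj \<beta> - \<beta> * cj \<alpha>))\<^sup>2"
proof -
  obtain \<alpha> \<beta> where ab: "\<alpha> \<in> I" "\<beta> \<in> I" "I = {of_int x * \<alpha> + of_int y * \<beta> | x y. True}"
    "\<alpha> * cj \<beta> - \<beta> * cj \<alpha> \<noteq> 0" using fractional_ideal_basis[OF I] by metis
  note D = fractional_idealD[OF I]
  have IK: "\<alpha> \<in> K" "\<beta> \<in> K" using ab D(1) by auto
  have a0: "\<alpha> \<noteq> 0" using ab(4) by auto
  have pos: "wnorm w \<alpha> > 0" unfolding wnorm_def using a0 w(1) by (intro add_pos_nonneg) auto
  have disc: "4 * wnorm w \<alpha> * wnorm w \<beta> - (wcross w \<alpha> \<beta>)\<^sup>2 = 4 * (cmod (\<alpha> * cj \<beta> - \<beta> * cj \<alpha>))\<^sup>2"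
    by (rule wnorm_disc[OF IK w])
  also have "\<dots> > 0" using ab(4) by simp
  finally have dpos: "4 * wnorm w \<alpha> * wnorm w \<beta> - (wcross w \<alpha> \<beta>)\<^sup>2 > 0" .
  obtain p q r t :: int where pt: "p * t - q * r = 1"
    and le: "wnorm w (of_int p * \<alpha> + of_int q * \<beta>) \<le> wnorm w (of_int r * \<alpha> + of_int t * \<beta>)"
    and prod: "3 * wnorm w (of_int p * \<alpha> + of_int q * \<beta>) * wnorm w (of_int r * \<alpha> + of_int t * \<beta>) \<le> 4 * (cmod (\<alpha> * cj \<beta> - \<beta> * cj \<alpha>))\<^sup>2"
    using reduced_binary_form_exists[OF pos dpos] unfolding wnorm_lin_comb[OF IK] disc by blast
  define \<alpha>' \<beta>' where "\<alpha>' = of_int p * \<alpha> + of_int q * \<beta>" and "\<beta>' = of_int r * \<alpha> + of_int t * \<beta>"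
  have mem: "\<alpha>' \<in> I" "\<beta>' \<in> I" unfolding \<alpha>'_def \<beta>'_def using ab D by blast+
  have a_eq: "\<alpha> = of_int t * \<alpha>' + of_int (- q) * \<beta>'"
  proof -
    have "of_int t * \<alpha>' + of_int (- q) * \<beta>' = of_int (p * t - q * r) * \<alpha>" by (simp add: \<alpha>'_def \<beta>'_def algebra_simps)
    thus ?thesis using pt by simp
  qed
  have b_eq: "\<beta> = of_int (- r) * \<alpha>' + of_int p * \<beta>'"
  proof -
    have "of_int (- r) * \<alpha>' + of_int p * \<beta>' = of_int (p * t - q * r) * \<beta>" by (simp add: \<alpha>'_def \<beta>'_def algebra_simps)
    thus ?thesis using pt by simp
  qed
  have "I = {of_int x * \<alpha>' + of_int y * \<beta>' | x y. True}"
  proof (intro equalityI subsetI)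
    fix z assume "z \<in> I"
    then obtain x y where "z = of_int x * \<alpha> + of_int y * \<beta>" using ab(3) by blast
    also have "\<dots> = of_int (x * t - y * r) * \<alpha>' + of_int (y * p - x * q) * \<beta>'"
      by (subst a_eq, subst b_eq) (simp add: algebra_simps)
    finally show "z \<in> {of_int x * \<alpha>' + of_int y * \<beta>' | x y. True}" by blast
  next
    fix z assume "z \<in> {of_int x * \<alpha>' + of_int y * \<beta>' | x y. True}"
    then obtain x y where "z = of_int x * \<alpha>' + of_int y * \<beta>'" by blast
    thus "z \<in> I" using D(4)[OF D(8)[OF mem(1)] D(8)[OF mem(2)]] by (simp only:)
  qed
  moreover have cross: "\<alpha>' * cj \<beta>' - \<beta>' * cj \<alpha>' = \<alpha> * cj \<beta> - \<beta> * cj \<alpha>"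
  proof -
    have "\<alpha>' * cj \<beta>' - \<beta>' * cj \<alpha>' = of_int (p * t - q * r) * (\<alpha> * cj \<beta> - \<beta> * cj \<alpha>)"
      using IK by (simp add: \<alpha>'_def \<beta>'_def algebra_simps)
    thus ?thesis using pt by simp
  qed
  ultimately show ?thesis using mem le prod ab(4) unfolding \<alpha>'_def[symmetric] \<beta>'_def[symmetric] by (metis (no_types, lifting))
qed

text \<open>The lattice \<int> + \<int>\<theta> whose second generator is the quotient
  \<beta>/\<alpha> of a basis, expressed by the coefficients of the norm form. An ideal is thus
  determined by three integers up to the scaling factor \<alpha>.\<close>

definition lat :: "int \<Rightarrow> int \<Rightarrow> int \<Rightarrow> complex set" where
  "lat j B A = {of_int x + of_int y * ((of_int B - 2 * s / of_int j) / (2 * of_int A)) | x y. True}"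

lemma cmod_mult_cj: "z \<in> K \<Longrightarrow> cmod z * cmod (cj z) = \<bar>of_rat (nm z)\<bar>"
proof -
  assume "z \<in> K"
  hence "cmod (z * cj z) = cmod (of_real (of_rat (nm z)))" by (simp only: nm_eq of_rat_complex)
  thus ?thesis by (simp only: norm_mult norm_of_real)
qed

text \<open>From j^2 (B^2 - 4AC) = 4d and squarefreeness there are few \<open>j\<close>; reducedness
  bounds \<open>B\<close> by a multiple of the square root of |d|; and \<open>A\<close> is confined
  to divisors of a nonzero integer fixed by \<open>j\<close> and \<open>B\<close>. This is what
  makes the codes so few.\<close>

lemma ideal_form_data:
  assumes I: "fi I" and w: "w > 0" "d < 0 \<Longrightarrow> w = 1"
  shows "\<exists>\<alpha> j A B. \<alpha> \<in> K \<and> \<alpha> \<noteq> 0 \<and> A \<noteq> 0 \<and> nm \<alpha> = inm I * of_int A \<and> \<bar>j\<bar> \<le> 2 \<and> B\<^sup>2 \<le> 25 * \<bar>d\<bar> \<and>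
    j\<^sup>2 * B\<^sup>2 - 4 * d \<noteq> 0 \<and> A dvd (j\<^sup>2 * B\<^sup>2 - 4 * d) \<and> I = (\<lambda>z. \<alpha> * z) ` lat j B A \<and>
    (cmod \<alpha>)\<^sup>2 \<le> 3 * sqrt \<bar>of_int d\<bar> * (w * of_rat (inm I)) \<and>
    w * (cmod (cj \<alpha>))\<^sup>2 \<le> 3 * sqrt \<bar>of_int d\<bar> * of_rat (inm I)"
proof -
  obtain \<alpha> \<beta> where ab: "\<alpha> \<in> I" "\<beta> \<in> I" "I = {of_int x * \<alpha> + of_int y * \<beta> | x y. True}"
    and cr0: "\<alpha> * cj \<beta> - \<beta> * cj \<alpha> \<noteq> 0" and le: "wnorm w \<alpha> \<le> wnorm w \<beta>"
    and pr: "3 * wnorm w \<alpha> * wnorm w \<beta> \<le> 4 * (cmod (\<alpha> * cj \<beta> - \<beta> * cj \<alpha>))\<^sup>2"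
    using ideal_reduced_basis[OF I w] by blast
  define n where "n = inm I"
  define N where "N = (of_rat n :: real)"
  have n: "n > 0" using inm(1)[OF I] by (simp add: n_def)
  have N: "N > 0" using n by (simp add: N_def)
  have Nc: "of_rat n = (of_real N :: complex)" unfolding N_def by (rule of_rat_complex)
  note bf = basis_form_integral[OF I ab, folded n_def]
  have IK: "\<alpha> \<in> K" "\<beta> \<in> K" using ab fractional_idealD(1)[OF I] by auto
  obtain A where A: "nm \<alpha> = n * of_int A" using bf(1) n by (auto elim!: Ints_cases simp: field_simps)
  obtain C where C: "nm \<beta> = n * of_int C" using bf(2) n by (auto elim!: Ints_cases simp: field_simps)
  obtain B where B: "tr (\<alpha> * cj \<beta>) = n * of_int B" using bf(3) n by (auto elim!: Ints_cases simp: field_simps)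
  obtain j :: int where j: "j \<noteq> 0" "2 * of_rat n * s = of_int j * (\<alpha> * cj \<beta> - \<beta> * cj \<alpha>)" using bf(4) by blast
  have a0: "\<alpha> \<noteq> 0" "\<beta> \<noteq> 0" using cr0 by auto
  have A0: "A \<noteq> 0" using A nm_eq_0_iff[OF IK(1)] a0 by auto
  have C0: "C \<noteq> 0" using C nm_eq_0_iff[OF IK(2)] a0 by auto
  have Bc: "\<alpha> * cj \<beta> + \<beta> * cj \<alpha> = of_rat n * of_int B"
    using tr_eq[of "\<alpha> * cj \<beta>"] IK B by (simp add: of_rat_mult mult.commute)
  have Ac: "\<alpha> * cj \<alpha> = of_rat n * of_int A" using nm_eq[OF IK(1)] A by (simp add: of_rat_mult)
  have Cc: "\<beta> * cj \<beta> = of_rat n * of_int C" using nm_eq[OF IK(2)] C by (simp add: of_rat_mult)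
  have n0: "(of_rat n :: complex) \<noteq> 0" using n by simp
  have disc: "(\<alpha> * cj \<beta> - \<beta> * cj \<alpha>)\<^sup>2 = (of_rat n)\<^sup>2 * of_int (B\<^sup>2 - 4 * A * C)"
  proof -
    have "(\<alpha> * cj \<beta> - \<beta> * cj \<alpha>)\<^sup>2 = (\<alpha> * cj \<beta> + \<beta> * cj \<alpha>)\<^sup>2 - 4 * (\<alpha> * cj \<alpha>) * (\<beta> * cj \<beta>)"
      by (simp add: power2_eq_square algebra_simps)
    thus ?thesis unfolding Bc Ac Cc by (simp add: power2_eq_square algebra_simps)
  qed
  have "(of_rat n)\<^sup>2 * of_int (4 * d) = (2 * of_rat n * s)\<^sup>2"
    by (simp add: power2_eq_square sqd_mult_self)
  also have "\<dots> = (of_rat n)\<^sup>2 * of_int (j\<^sup>2 * (B\<^sup>2 - 4 * A * C))"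
    unfolding j(2) power_mult_distrib disc by simp
  finally have "(of_int (4 * d) :: complex) = of_int (j\<^sup>2 * (B\<^sup>2 - 4 * A * C))" using n0 by simp
  hence jd: "4 * d = j\<^sup>2 * (B\<^sup>2 - 4 * A * C)" by (simp only: of_int_eq_iff)
  hence "j\<^sup>2 dvd 4 * d" by simp
  hence j2: "\<bar>j\<bar> \<le> 2" using squarefree_square_dvd_4_mult[OF sqf] by blast
  have M: "j\<^sup>2 * B\<^sup>2 - 4 * d = A * (4 * j\<^sup>2 * C)" unfolding jd by (simp add: algebra_simps)
  have M0: "j\<^sup>2 * B\<^sup>2 - 4 * d \<noteq> 0" unfolding M using A0 C0 j(1) by simp
  have Mdvd: "A dvd (j\<^sup>2 * B\<^sup>2 - 4 * d)" unfolding M by simp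
  \<comment> \<open>Sum and difference of \<open>\<alpha> * cj \<beta>\<close> and
    \<open>\<beta> * cj \<alpha>\<close> are known in terms of \<open>B\<close> and
    \<open>s / j\<close>, so their half difference gives \<beta>/\<alpha>.\<close>
  have theta: "\<beta> = \<alpha> * ((of_int B - 2 * s / of_int j) / (2 * of_int A))"
  proof -
    have "2 * s / of_int j = (\<alpha> * cj \<beta> - \<beta> * cj \<alpha>) / of_rat n" using j n0 by (simp add: field_simps)
    moreover have "of_int B = (\<alpha> * cj \<beta> + \<beta> * cj \<alpha>) / of_rat n" using Bc n0 by simp
    moreover have "of_int A = \<alpha> * cj \<alpha> / of_rat n" using Ac n0 by simp
    ultimately have "(of_int B - 2 * s / of_int j) / (2 * of_int A)
        = ((\<alpha> * cj \<beta> + \<beta> * cj \<alpha>) / of_rat n - (\<alpha> * cj \<beta> - \<beta> * cj \<alpha>) / of_rat n) / (2 * (\<alpha> * cj \<alpha> / of_rat n))"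
      by (simp only:)
    also have "\<dots> = (2 * (\<beta> * cj \<alpha>) / of_rat n) / (2 * (\<alpha> * cj \<alpha>) / of_rat n)"
      by (simp add: diff_divide_distrib[symmetric])
    also have "\<dots> = \<beta> / \<alpha>" using n0 a0 IK by simp
    finally show ?thesis using a0 by simp
  qed
  have lat: "I = (\<lambda>z. \<alpha> * z) ` lat j B A"
  proof -
    have "I = {\<alpha> * (of_int x + of_int y * ((of_int B - 2 * s / of_int j) / (2 * of_int A))) | x y. True}"
      unfolding ab(3) by (subst theta) (auto simp: algebra_simps)
    thus ?thesis unfolding lat_def by blast
  qed
  define \<Delta> where "\<Delta> = cmod (\<alpha> * cj \<beta> - \<beta> * cj \<alpha>)"
  have cs: "(cmod s)\<^sup>2 = \<bar>of_int d\<bar>"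
    by (metis norm_mult norm_of_int power2_eq_square sqd_mult_self)
  have "\<Delta>\<^sup>2 \<le> (of_int j * \<Delta>)\<^sup>2"
  proof -
    have "(1::real) \<le> (of_int j)\<^sup>2" using j(1) by (metis int_one_le_iff_zero_less of_int_1_le_iff of_int_power zero_less_power2)
    thus ?thesis unfolding power_mult_distrib using mult_right_mono[of 1 "(of_int j)\<^sup>2" "\<Delta>\<^sup>2"] by simp
  qed
  also have "(of_int j * \<Delta>)\<^sup>2 = (cmod (2 * of_rat n * s))\<^sup>2"
    unfolding j(2) \<Delta>_def by (simp add: norm_mult power_mult_distrib)
  also have "\<dots> = 4 * N\<^sup>2 * \<bar>of_int d\<bar>"
    unfolding norm_mult power_mult_distrib cs Nc by simp
  finally have \<Delta>: "\<Delta>\<^sup>2 \<le> 4 * N\<^sup>2 * \<bar>of_int d\<bar>" .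
  have F: "wnorm w \<alpha> \<ge> 0" "wnorm w \<beta> \<ge> 0" using w(1) by (auto simp: wnorm_def)
  have FF: "wnorm w \<alpha> * wnorm w \<beta> \<le> 16 / 3 * (N\<^sup>2 * \<bar>of_int d\<bar>)" using pr \<Delta> by (simp add: \<Delta>_def)
  have fa: "(cmod z)\<^sup>2 \<le> w * wnorm w z" "w * (cmod (cj z))\<^sup>2 \<le> wnorm w z" for z
    using w(1) by (auto simp: wnorm_def algebra_simps)
  have "(wnorm w \<alpha>)\<^sup>2 \<le> wnorm w \<alpha> * wnorm w \<beta>" using le F by (simp add: power2_eq_square mult_left_mono)
  \<comment> \<open>The reduction bound has 16/3 in place of 9; rounding up to a square gives the
    constant 3 in the length of the short vector.\<close>
  also have "\<dots> \<le> 9 * (N\<^sup>2 * \<bar>of_int d\<bar>)"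
  proof -
    have "0 \<le> N\<^sup>2 * \<bar>real_of_int d\<bar>" by simp
    thus ?thesis using FF by linarith
  qed
  also have "\<dots> = (3 * sqrt \<bar>of_int d\<bar> * N)\<^sup>2" by (simp add: power_mult_distrib)
  finally have Fa: "wnorm w \<alpha> \<le> 3 * sqrt \<bar>of_int d\<bar> * N" by (rule power2_le_imp_le) (use N in simp)
  have c1: "(cmod \<alpha>)\<^sup>2 \<le> 3 * sqrt \<bar>of_int d\<bar> * (w * N)"
  proof -
    have "w * wnorm w \<alpha> \<le> w * (3 * sqrt \<bar>of_int d\<bar> * N)" using Fa w(1) by (intro mult_left_mono) auto
    also have "\<dots> = 3 * sqrt \<bar>of_int d\<bar> * (w * N)" by (simp only: mult_ac)
    finally show ?thesis using fa(1)[of \<alpha>] by linarith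
  qed
  have c2: "w * (cmod (cj \<alpha>))\<^sup>2 \<le> 3 * sqrt \<bar>of_int d\<bar> * N" using fa(2)[of \<alpha>] Fa by simp
  \<comment> \<open>Pairing one value of \<alpha> with the conjugate value of \<beta> makes the
    weight cancel. This gives B^2 at most 64/3 times |d|, rounded up to 25.\<close>
  have B25: "B\<^sup>2 \<le> 25 * \<bar>d\<bar>"
  proof -
    have x: "(cmod x * cmod (cj y))\<^sup>2 \<le> wnorm w x * wnorm w y" for x y
    proof -
      have "(cmod x)\<^sup>2 * (w * (cmod (cj y))\<^sup>2) \<le> (w * wnorm w x) * wnorm w y"
        using fa(1)[of x] fa(2)[of y] w(1) by (intro mult_mono) (auto simp: wnorm_def)
      hence "w * ((cmod x)\<^sup>2 * (cmod (cj y))\<^sup>2) \<le> w * (wnorm w x * wnorm w y)" by (simp add: mult_ac)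
      thus ?thesis using w(1) by (simp add: power_mult_distrib)
    qed
    have "N * \<bar>of_int B\<bar> = cmod (\<alpha> * cj \<beta> + \<beta> * cj \<alpha>)"
      unfolding Bc Nc by (simp add: norm_mult N less_imp_le)
    also have "\<dots> \<le> cmod \<alpha> * cmod (cj \<beta>) + cmod \<beta> * cmod (cj \<alpha>)"
      using norm_triangle_ineq[of "\<alpha> * cj \<beta>" "\<beta> * cj \<alpha>"] by (simp add: norm_mult)
    finally have "(N * \<bar>of_int B\<bar>)\<^sup>2 \<le> (cmod \<alpha> * cmod (cj \<beta>) + cmod \<beta> * cmod (cj \<alpha>))\<^sup>2"
      using N by (intro power_mono) auto
    also have "\<dots> \<le> 2 * (cmod \<alpha> * cmod (cj \<beta>))\<^sup>2 + 2 * (cmod \<beta> * cmod (cj \<alpha>))\<^sup>2"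
      using sum_squares_bound[of "cmod \<alpha> * cmod (cj \<beta>)" "cmod \<beta> * cmod (cj \<alpha>)"]
      by (simp add: power2_sum)
    also have "\<dots> \<le> 4 * (wnorm w \<alpha> * wnorm w \<beta>)" using x[of \<alpha> \<beta>] x[of \<beta> \<alpha>] by (simp add: mult.commute)
    also have "\<dots> \<le> 64 / 3 * (N\<^sup>2 * \<bar>of_int d\<bar>)" using FF by linarith
    finally have "N\<^sup>2 * (of_int B)\<^sup>2 \<le> N\<^sup>2 * (64 / 3 * \<bar>of_int d\<bar>)" by (simp add: power_mult_distrib)
    hence "(of_int B)\<^sup>2 \<le> 64 / 3 * \<bar>real_of_int d\<bar>" using N by simp
    also have "\<dots> \<le> 25 * \<bar>of_int d\<bar>" by simp
    finally have "real_of_int (B\<^sup>2) \<le> of_int (25 * \<bar>d\<bar>)" by simp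
    thus ?thesis by (simp only: of_int_le_iff)
  qed
  show ?thesis
    by (rule exI[of _ \<alpha>], rule exI[of _ j], rule exI[of _ A], rule exI[of _ B])
       (use IK(1) a0(1) A0 A j2 B25 M0 Mdvd lat c1 c2 in \<open>simp add: n_def N_def\<close>)
qed

end

section \<open>Counting torsion classes\<close>

context quad begin

text \<open>The constant \<open>exp 1\<close> comes from rounding \<open>l * t\<close> in the codes to an integer.\<close>

definition ideal_collision :: "nat \<Rightarrow> complex set \<Rightarrow> complex set \<Rightarrow> bool" where
  "ideal_collision l P P' \<longleftrightarrow> (\<exists>\<eta>\<in>K. \<eta> \<noteq> 0 \<and>
     imul (P' [^]\<^bsub>G\<^esub> l) (icj P [^]\<^bsub>G\<^esub> l) = pideal \<eta> \<and>
     (cmod \<eta>)\<^sup>2 \<le> exp 1 * of_rat (inm P * inm P') ^ l \<and>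
     (cmod (cj \<eta>))\<^sup>2 \<le> exp 1 * of_rat (inm P * inm P') ^ l)"

text \<open>Reduction of the ideal \<open>A P\<close> yields a short vector \<alpha> with x =
  |\<alpha>|^2 / (w n) between 1/D and D, and t = ln x. The weight is chosen so that (w n)^l equals
  |\<gamma>|^2 times the l-th power of the norm of \<open>P\<close>; the two final equations express
  the absolute values of \<alpha> through \<gamma>, \<open>P\<close>, \<open>a\<close> and t
  alone.\<close>

lemma ideal_code:
  assumes A: "fi A" "A [^]\<^bsub>G\<^esub> l = pideal \<gamma>" "\<gamma> \<in> K" "\<gamma> \<noteq> 0" and P: "fi P" and l: "l \<ge> 1"
  shows "\<exists>\<alpha> t j a b. (\<lfloor>real l * t\<rfloor>, (j, b), a) \<in> ideal_codes d l \<and> \<alpha> \<in> K \<and> \<alpha> \<noteq> 0 \<and> a \<noteq> 0 \<and>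
    imul A P = (\<lambda>z. \<alpha> * z) ` lat j b a \<and>
    (cmod \<alpha>)\<^sup>2 ^ l = exp (real l * t) * (cmod \<gamma>)\<^sup>2 * of_rat (inm P) ^ l \<and>
    (cmod (cj \<alpha>))\<^sup>2 ^ l = of_int a ^ (2 * l) * exp (- (real l * t)) * (cmod (cj \<gamma>))\<^sup>2 * of_rat (inm P) ^ l"
proof -
  define I where "I = imul A P"
  have I: "fi I" unfolding I_def using A(1) P by (rule fi_imul)
  define g1 g2 where "g1 = cmod \<gamma>" and "g2 = cmod (cj \<gamma>)"
  have g: "g1 > 0" "g2 > 0" using A by (auto simp: g1_def g2_def)
  \<comment> \<open>The l-th root balances the two absolute values of \<gamma>. In the imaginary
    case they agree and the weight is 1, as required there.\<close>
  define w where "w = root l (g1 / g2)"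
  have w: "w > 0" using g l by (simp add: w_def)
  have w1: "w = 1" if "d < 0"
    using cj_eq_cnj[OF that A(3)] g l by (simp add: w_def g1_def g2_def)
  have wl: "w ^ l = g1 / g2" using g l unfolding w_def by (intro real_root_pow_pos2) auto
  define n where "n = (of_rat (inm I) :: real)"
  have n: "n > 0" using inm(1)[OF I] by (simp add: n_def)
  define N where "N = (of_rat (inm P) :: real)"
  have nl: "n ^ l = g1 * g2 * N ^ l"
  proof -
    have "inm A ^ l = \<bar>nm \<gamma>\<bar>" using inm_pow[OF A(1), of l] inm_pideal[OF A(3,4)] A(2) by simp
    hence "(of_rat (inm A) :: real) ^ l = \<bar>of_rat (nm \<gamma>)\<bar>" by (metis of_rat_power abs_of_rat)
    also have "\<dots> = g1 * g2" using cmod_mult_cj[OF A(3)] by (simp add: g1_def g2_def)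
    finally show ?thesis unfolding n_def N_def I_def inm_imul[OF A(1) P]
      by (simp add: of_rat_mult power_mult_distrib)
  qed
  define D where "D = 3 * sqrt \<bar>real_of_int d\<bar>"
  have D1: "D \<ge> 1"
  proof -
    have "1 \<le> \<bar>d\<bar>" using d0 by simp
    hence "1 \<le> \<bar>real_of_int d\<bar>" by linarith
    hence "1 \<le> sqrt \<bar>real_of_int d\<bar>" by simp
    thus ?thesis unfolding D_def by linarith
  qed
  obtain \<alpha> j a b where \<alpha>: "\<alpha> \<in> K" "\<alpha> \<noteq> 0" and a: "a \<noteq> 0" "nm \<alpha> = inm I * of_int a"
    and jb: "\<bar>j\<bar> \<le> 2" "b\<^sup>2 \<le> 25 * \<bar>d\<bar>" "j\<^sup>2 * b\<^sup>2 - 4 * d \<noteq> 0" "a dvd (j\<^sup>2 * b\<^sup>2 - 4 * d)"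
    and lat: "I = (\<lambda>z. \<alpha> * z) ` lat j b a"
    and c1: "(cmod \<alpha>)\<^sup>2 \<le> D * (w * n)" and c2: "w * (cmod (cj \<alpha>))\<^sup>2 \<le> D * n"
    using ideal_form_data[OF I w w1] unfolding n_def D_def by blast
  define x where "x = (cmod \<alpha>)\<^sup>2 / (w * n)"
  have wn: "w * n > 0" using w n by simp
  have x0: "x > 0" using \<alpha> wn by (simp add: x_def)
  have xD: "x \<le> D" using c1 wn by (simp add: x_def field_simps)
  have prod: "(cmod \<alpha>)\<^sup>2 * (cmod (cj \<alpha>))\<^sup>2 = n\<^sup>2 * (of_int a)\<^sup>2"
  proof -
    have "(cmod \<alpha> * cmod (cj \<alpha>))\<^sup>2 = (of_rat (nm \<alpha>))\<^sup>2" unfolding cmod_mult_cj[OF \<alpha>(1)] by (rule power2_abs)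
    also have "\<dots> = n\<^sup>2 * (of_int a)\<^sup>2" by (simp add: a(2) n_def of_rat_mult power_mult_distrib)
    finally show ?thesis by (simp add: power_mult_distrib)
  qed
  have a1: "(of_int a)\<^sup>2 \<ge> (1::real)"
  proof -
    have "1 \<le> a\<^sup>2" using a(1) by (metis int_one_le_iff_zero_less zero_less_power2)
    hence "real_of_int 1 \<le> real_of_int (a\<^sup>2)" by (simp only: of_int_le_iff)
    thus ?thesis by simp
  qed
  \<comment> \<open>The norm of \<alpha> is a nonzero multiple of the norm of the ideal, so an upper
    bound for the conjugate of \<alpha> forces a lower bound for \<alpha>.\<close>
  have xlow: "1 / D \<le> x"
  proof -
    have "n\<^sup>2 * 1 \<le> (cmod \<alpha>)\<^sup>2 * (cmod (cj \<alpha>))\<^sup>2" unfolding prod using a1 by (intro mult_left_mono) auto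
    hence "w * n\<^sup>2 \<le> (cmod \<alpha>)\<^sup>2 * (w * (cmod (cj \<alpha>))\<^sup>2)" using w by simp
    also have "\<dots> \<le> (cmod \<alpha>)\<^sup>2 * (D * n)" using c2 by (intro mult_left_mono) auto
    finally have "n * (w * n) \<le> n * ((cmod \<alpha>)\<^sup>2 * D)" by (simp add: power2_eq_square mult_ac)
    hence "w * n \<le> (cmod \<alpha>)\<^sup>2 * D" using n by simp
    thus ?thesis using wn D1 by (simp add: x_def field_simps)
  qed
  define t where "t = ln x"
  have tD: "\<bar>t\<bar> \<le> ln D"
  proof -
    have "t \<le> ln D" unfolding t_def using x0 xD by simp
    moreover have "ln (1 / D) \<le> t" unfolding t_def using x0 xlow D1 by (subst ln_le_cancel_iff) auto
    ultimately show ?thesis using D1 by (simp add: ln_div)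
  qed
  have "\<bar>real l * t\<bar> \<le> real l * ln D" using tD by (simp add: abs_mult mult_left_mono)
  hence "real_of_int \<bar>\<lfloor>real l * t\<rfloor>\<bar> \<le> real l * ln D + 1" by linarith
  hence code: "(\<lfloor>real l * t\<rfloor>, (j, b), a) \<in> ideal_codes d l" unfolding mem_ideal_codes using jb by (simp add: D_def)
  have et: "exp (real l * t) = x ^ l" using x0 by (simp add: t_def exp_of_nat_mult)
  have wnl: "(w * n) ^ l = g1\<^sup>2 * N ^ l" unfolding power_mult_distrib wl nl using g by (simp add: power2_eq_square)
  have e1: "(cmod \<alpha>)\<^sup>2 ^ l = exp (real l * t) * g1\<^sup>2 * N ^ l"
  proof -
    have "(cmod \<alpha>)\<^sup>2 = x * (w * n)" using w n by (simp add: x_def)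
    hence "(cmod \<alpha>)\<^sup>2 ^ l = x ^ l * (w * n) ^ l" by (simp only: power_mult_distrib)
    thus ?thesis unfolding et wnl by (simp add: mult.assoc)
  qed
  have e2: "(cmod (cj \<alpha>))\<^sup>2 ^ l = of_int a ^ (2 * l) * exp (- (real l * t)) * g2\<^sup>2 * N ^ l"
  proof -
    have "x * (w * n) * (cmod (cj \<alpha>))\<^sup>2 = n\<^sup>2 * (of_int a)\<^sup>2" using prod w n by (simp add: x_def)
    hence "n * (x * w * (cmod (cj \<alpha>))\<^sup>2) = n * (n * (of_int a)\<^sup>2)" by (simp add: power2_eq_square mult_ac)
    hence "x * w * (cmod (cj \<alpha>))\<^sup>2 = n * (of_int a)\<^sup>2" using n by simp
    hence "(x * w * (cmod (cj \<alpha>))\<^sup>2) ^ l = (n * (of_int a)\<^sup>2) ^ l" by simp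
    hence "x ^ l * (g1 / g2) * (cmod (cj \<alpha>))\<^sup>2 ^ l = g1 * g2 * N ^ l * of_int a ^ (2 * l)"
      unfolding power_mult_distrib wl nl by (simp add: power_mult)
    hence "(cmod (cj \<alpha>))\<^sup>2 ^ l = of_int a ^ (2 * l) * (1 / x ^ l) * g2\<^sup>2 * N ^ l"
      using g x0 by (simp add: field_simps power2_eq_square)
    thus ?thesis by (simp add: exp_minus et inverse_eq_divide)
  qed
  show ?thesis
    by (rule exI[of _ \<alpha>], rule exI[of _ t], rule exI[of _ j], rule exI[of _ a], rule exI[of _ b])
       (use code \<alpha> a(1) lat e1 e2 in \<open>simp add: I_def g1_def g2_def N_def\<close>)
qed

text \<open>A common lattice makes \<open>A P\<close> and \<open>A' P'\<close> equal up to the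
  factor \<alpha>/\<alpha>'. If the primes agree they cancel and the classes coincide. In general
  the l-th power replaces \<open>A\<close> and \<open>A'\<close> by \<gamma> and \<gamma>', leaving
  a relation between \<open>P\<close> and \<open>P'\<close> modulo principal ideals.\<close>

lemma ideal_code_collision:
  assumes A: "fi A" "A [^]\<^bsub>G\<^esub> l = pideal \<gamma>" "\<gamma> \<in> K" "\<gamma> \<noteq> 0" and P: "fi P"
    and A': "fi A'" "A' [^]\<^bsub>G\<^esub> l = pideal \<gamma>'" "\<gamma>' \<in> K" "\<gamma>' \<noteq> 0" and P': "fi P'"
    and \<alpha>: "\<alpha> \<in> K" "\<alpha> \<noteq> 0" "imul A P = (\<lambda>z. \<alpha> * z) ` L"
    and \<alpha>': "\<alpha>' \<in> K" "\<alpha>' \<noteq> 0" "imul A' P' = (\<lambda>z. \<alpha>' * z) ` L"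
    and a: "a \<noteq> 0"
    and e: "(cmod \<alpha>)\<^sup>2 ^ l = exp (real l * t) * (cmod \<gamma>)\<^sup>2 * of_rat (inm P) ^ l"
      "(cmod (cj \<alpha>))\<^sup>2 ^ l = of_int a ^ (2 * l) * exp (- (real l * t)) * (cmod (cj \<gamma>))\<^sup>2 * of_rat (inm P) ^ l"
    and e': "(cmod \<alpha>')\<^sup>2 ^ l = exp (real l * t') * (cmod \<gamma>')\<^sup>2 * of_rat (inm P') ^ l"
      "(cmod (cj \<alpha>'))\<^sup>2 ^ l = of_int a ^ (2 * l) * exp (- (real l * t')) * (cmod (cj \<gamma>'))\<^sup>2 * of_rat (inm P') ^ l"
    and close: "\<lfloor>real l * t\<rfloor> = \<lfloor>real l * t'\<rfloor>"
  shows "ideal_collision l P P'" and "P = P' \<Longrightarrow> principal_ideals K #>\<^bsub>G\<^esub> A = principal_ideals K #>\<^bsub>G\<^esub> A'"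
proof -
  have eq: "imul (pideal \<alpha>') (imul A P) = imul (pideal \<alpha>) (imul A' P')"
  proof -
    have "imul (pideal \<alpha>') (imul A P) = (\<lambda>z. \<alpha>' * z) ` (imul A P)"
      by (rule imul_pideal[OF fi_imul[OF A(1) P]])
    also have "\<dots> = (\<lambda>z. \<alpha> * z) ` (imul A' P')"
      unfolding \<alpha>(3) \<alpha>'(3) by (simp add: image_image mult.left_commute)
    also have "\<dots> = imul (pideal \<alpha>) (imul A' P')"
      by (rule imul_pideal[OF fi_imul[OF A'(1) P'], symmetric])
    finally show ?thesis .
  qed
  have c: "fi (pideal \<alpha>)" "fi (pideal \<alpha>')" using \<alpha> \<alpha>' by (auto intro: fi_pideal)
  {
    assume PP: "P = P'"
    have "imul P (imul (pideal \<alpha>') A) = imul P (imul (pideal \<alpha>) A')"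
      using eq unfolding PP by (metis imul_assoc imul_commute)
    hence e3: "imul (pideal \<alpha>') A = imul (pideal \<alpha>) A'"
      using G.l_cancel[of P "imul (pideal \<alpha>') A" "imul (pideal \<alpha>) A'"] P c A(1) A'(1) fi_imul by simp
    have "imul (pideal (\<alpha>' / \<alpha>)) A = imul (pideal (1 / \<alpha>)) (imul (pideal \<alpha>') A)"
      using \<alpha> \<alpha>' by (simp add: imul_assoc[symmetric] pideal_mult)
    also have "\<dots> = imul (imul (pideal (1 / \<alpha>)) (pideal \<alpha>)) A'" unfolding e3 by (simp add: imul_assoc)
    also have "\<dots> = A'" using \<alpha> A'(1) by (simp add: pideal_mult pideal_1 imul_one)
    finally have "principal_ideals K #>\<^bsub>G\<^esub> A' = principal_ideals K #>\<^bsub>G\<^esub> A"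
      using coset_eq_of_principal_multiple[OF A(1), of "\<alpha>' / \<alpha>" A'] \<alpha> \<alpha>' by simp
    thus "principal_ideals K #>\<^bsub>G\<^esub> A = principal_ideals K #>\<^bsub>G\<^esub> A'" by simp
  }
  define N N' where "N = inm P" and "N' = inm P'"
  have N: "N > 0" "N' > 0" using inm(1) P P' by (auto simp: N_def N'_def)
  \<comment> \<open>The quotient of the generators in the l-th power relation, times the generator
    of P^l and its conjugate, which moves \<open>P\<close> to the other side as a conjugate ideal.
    In its absolute values \<gamma>, \<gamma>' and \<open>a\<close> all cancel.\<close>
  define \<eta> where "\<eta> = \<alpha>' ^ l * \<gamma> / (\<alpha> ^ l * \<gamma>') * of_rat N ^ l"
  have \<eta>: "\<eta> \<in> K" "\<eta> \<noteq> 0" unfolding \<eta>_def using A A' \<alpha> \<alpha>' N by auto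
  have dist: "imul I J [^]\<^bsub>G\<^esub> l = imul (I [^]\<^bsub>G\<^esub> l) (J [^]\<^bsub>G\<^esub> l)" if "fi I" "fi J" for I J
    using that G.nat_pow_distrib[of I J l] by simp
  have powI: "(imul (pideal x) (imul B Q)) [^]\<^bsub>G\<^esub> l = imul (pideal (x ^ l)) (imul (B [^]\<^bsub>G\<^esub> l) (Q [^]\<^bsub>G\<^esub> l))"
    if "x \<in> K" "x \<noteq> 0" "fi B" "fi Q" for x B Q
    using dist[of "pideal x" "imul B Q"] dist[of B Q] that by (simp add: fi_pideal fi_imul pideal_pow)
  have "imul (pideal (\<alpha>' ^ l)) (imul (pideal \<gamma>) (P [^]\<^bsub>G\<^esub> l)) = imul (pideal (\<alpha> ^ l)) (imul (pideal \<gamma>') (P' [^]\<^bsub>G\<^esub> l))"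
    using arg_cong[OF eq, of "\<lambda>I. I [^]\<^bsub>G\<^esub> l"] powI[OF \<alpha>'(1,2) A(1) P] powI[OF \<alpha>(1,2) A'(1) P'] A(2) A'(2) by simp
  hence e4: "imul (pideal (\<alpha>' ^ l * \<gamma>)) (P [^]\<^bsub>G\<^esub> l) = imul (pideal (\<alpha> ^ l * \<gamma>')) (P' [^]\<^bsub>G\<^esub> l)"
    using A A' \<alpha> \<alpha>' by (simp add: imul_assoc[symmetric] pideal_mult)
  have "imul (P' [^]\<^bsub>G\<^esub> l) (icj P [^]\<^bsub>G\<^esub> l)
      = imul (imul (pideal (1 / (\<alpha> ^ l * \<gamma>'))) (imul (pideal (\<alpha> ^ l * \<gamma>')) (P' [^]\<^bsub>G\<^esub> l))) (icj P [^]\<^bsub>G\<^esub> l)"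
    using A' \<alpha> P' by (simp add: imul_assoc[symmetric] pideal_mult pideal_1 imul_one fi_pow)
  also have "\<dots> = imul (pideal (1 / (\<alpha> ^ l * \<gamma>'))) (imul (pideal (\<alpha>' ^ l * \<gamma>)) (imul (P [^]\<^bsub>G\<^esub> l) (icj P [^]\<^bsub>G\<^esub> l)))"
    unfolding e4[symmetric] by (simp only: imul_assoc)
  also have "imul (P [^]\<^bsub>G\<^esub> l) (icj P [^]\<^bsub>G\<^esub> l) = pideal (of_rat N ^ l)"
    using dist[OF P fi_icj[OF P]] inm(2)[OF P] N pideal_pow[of "of_rat N" l] by (simp add: N_def)
  also have "imul (pideal (1 / (\<alpha> ^ l * \<gamma>'))) (imul (pideal (\<alpha>' ^ l * \<gamma>)) (pideal (of_rat N ^ l))) = pideal \<eta>"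
    using A A' \<alpha> \<alpha>' N by (simp add: pideal_mult \<eta>_def)
  finally have main: "imul (P' [^]\<^bsub>G\<^esub> l) (icj P [^]\<^bsub>G\<^esub> l) = pideal \<eta>" .
  have close1: "real l * t' - real l * t \<le> 1" "real l * t - real l * t' \<le> 1" using close by linarith+
  define x x' where "x = real l * t" and "x' = real l * t'"
  define M M' where "M = (of_rat N :: real) ^ l" and "M' = (of_rat N' :: real) ^ l"
  have M: "M > 0" "M' > 0" using N by (auto simp: M_def M'_def)
  have MM: "of_rat (inm P * inm P') ^ l = M * M'" by (simp add: M_def M'_def N_def N'_def of_rat_mult power_mult_distrib)
  define c1 c2 c1' c2' where "c1 = cmod \<gamma>" and "c2 = cmod (cj \<gamma>)" and "c1' = cmod \<gamma>'" and "c2' = cmod (cj \<gamma>')"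
  have cc: "c1 > 0" "c2 > 0" "c1' > 0" "c2' > 0" using A A' by (auto simp: c1_def c2_def c1'_def c2'_def)
  have pw: "(r ^ l)\<^sup>2 = r\<^sup>2 ^ l" for r :: real by (simp add: power_mult[symmetric] mult.commute)
  have "cmod (of_rat N) = of_rat N" using N by (simp add: of_rat_complex)
  hence Nc2: "(cmod (of_rat N))\<^sup>2 ^ l = M\<^sup>2" unfolding M_def pw by simp
  have b1: "(cmod \<eta>)\<^sup>2 = exp (x' - x) * (M * M')"
  proof -
    have "(cmod \<eta>)\<^sup>2 = (cmod \<alpha>')\<^sup>2 ^ l * c1\<^sup>2 / ((cmod \<alpha>)\<^sup>2 ^ l * c1'\<^sup>2) * M\<^sup>2"
      unfolding \<eta>_def norm_mult norm_divide norm_power power_mult_distrib power_divide pw Nc2 c1_def c1'_def ..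
    also have "\<dots> = (exp x' * c1'\<^sup>2 * M') * c1\<^sup>2 / ((exp x * c1\<^sup>2 * M) * c1'\<^sup>2) * M\<^sup>2"
      unfolding e(1) e'(1) by (simp add: x_def x'_def c1_def c1'_def M_def M'_def N_def N'_def)
    also have "\<dots> = exp x' / exp x * (M * M')" using cc M by (simp add: field_simps power2_eq_square)
    finally show ?thesis by (simp add: exp_diff)
  qed
  have b2: "(cmod (cj \<eta>))\<^sup>2 = exp (x - x') * (M * M')"
  proof -
    have cjeq: "cj \<eta> = cj \<alpha>' ^ l * cj \<gamma> / (cj \<alpha> ^ l * cj \<gamma>') * of_rat N ^ l"
      unfolding \<eta>_def using A A' \<alpha> \<alpha>' by simp
    have "(cmod (cj \<eta>))\<^sup>2 = (cmod (cj \<alpha>'))\<^sup>2 ^ l * c2\<^sup>2 / ((cmod (cj \<alpha>))\<^sup>2 ^ l * c2'\<^sup>2) * M\<^sup>2"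
      unfolding cjeq norm_mult norm_divide norm_power power_mult_distrib power_divide pw Nc2 c2_def c2'_def ..
    also have "\<dots> = (of_int a ^ (2 * l) * exp (- x') * c2'\<^sup>2 * M') * c2\<^sup>2 / ((of_int a ^ (2 * l) * exp (- x) * c2\<^sup>2 * M) * c2'\<^sup>2) * M\<^sup>2"
      unfolding e(2) e'(2) by (simp add: x_def x'_def c2_def c2'_def M_def M'_def N_def N'_def)
    also have "\<dots> = exp (- x') / exp (- x) * (M * M')" using cc M a by (simp add: field_simps power2_eq_square)
    also have "exp (- x') / exp (- x) = exp (x - x')" by (simp add: exp_diff[symmetric])
    finally show ?thesis .
  qed
  have "exp (x' - x) \<le> exp 1" "exp (x - x') \<le> exp 1" using close1 by (auto simp: x_def x'_def)
  hence "(cmod \<eta>)\<^sup>2 \<le> exp 1 * (M * M')" "(cmod (cj \<eta>))\<^sup>2 \<le> exp 1 * (M * M')"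
    unfolding b1 b2 using M by (auto intro!: mult_right_mono)
  thus "ideal_collision l P P'" unfolding ideal_collision_def MM using \<eta> main by blast
qed

lemma finite_ideal_codes: "finite (ideal_codes d l)"
proof -
  define R where "R = real l * ln (3 * sqrt \<bar>of_int d\<bar>) + 1"
  have f1: "finite {u. real_of_int \<bar>u\<bar> \<le> R}"
  proof (rule finite_subset)
    show "{u. real_of_int \<bar>u\<bar> \<le> R} \<subseteq> {-\<lceil>R\<rceil>..\<lceil>R\<rceil>}" by (auto simp: abs_le_iff) linarith+
  qed simp
  have f2: "finite {B::int. B\<^sup>2 \<le> 25 * \<bar>d\<bar>}"
  proof (rule finite_subset)
    show "{B::int. B\<^sup>2 \<le> 25 * \<bar>d\<bar>} \<subseteq> {-(25 * \<bar>d\<bar>)..25 * \<bar>d\<bar>}"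
    proof
      fix B :: int assume "B \<in> {B. B\<^sup>2 \<le> 25 * \<bar>d\<bar>}"
      moreover have "\<bar>B\<bar> \<le> B\<^sup>2"
      proof (cases "B = 0")
        case False
        hence "\<bar>B\<bar> * 1 \<le> \<bar>B\<bar> * \<bar>B\<bar>" by (intro mult_left_mono) auto
        thus ?thesis by (simp add: power2_eq_square)
      qed simp
      ultimately have "\<bar>B\<bar> \<le> 25 * \<bar>d\<bar>" by simp
      thus "B \<in> {-(25 * \<bar>d\<bar>)..25 * \<bar>d\<bar>}" by auto
    qed
  qed simp
  have f3: "finite {A::int. M \<noteq> 0 \<and> A dvd M}" for M
    by (cases "M = 0") (auto intro: finite_divisors_int)
  have "finite (SIGMA (j, B) : {-2..2} \<times> {B::int. B\<^sup>2 \<le> 25 * \<bar>d\<bar>}. {A. j\<^sup>2 * B\<^sup>2 - 4 * d \<noteq> 0 \<and> A dvd (j\<^sup>2 * B\<^sup>2 - 4 * d)})"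
    using f2 f3 by (intro finite_SigmaI) (auto intro!: finite_cartesian_product)
  thus ?thesis unfolding ideal_codes_def using f1 unfolding R_def by (rule finite_cartesian_product[rotated])
qed

text \<open>Assigning a code to each pair of a class and an ideal in \<open>PP\<close> is injective:
  equal codes force a collision, hence the same ideal, and then the same class.\<close>

lemma torsion_card_bound:
  assumes l: "l \<ge> 1" and fin: "finite PP" and ne: "PP \<noteq> {}" and PP: "\<And>P. P \<in> PP \<Longrightarrow> fi P"
    and nocoll: "\<And>P P'. P \<in> PP \<Longrightarrow> P' \<in> PP \<Longrightarrow> P \<noteq> P' \<Longrightarrow> \<not> ideal_collision l P P'"
  shows "finite (class_group_torsion K l)"
    and "card (class_group_torsion K l) * card PP \<le> card (ideal_codes d l)"
proof -
  let ?T = "class_group_torsion K l"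
  obtain Af \<gamma>f where T: "\<And>c. c \<in> ?T \<Longrightarrow> fi (Af c) \<and> c = principal_ideals K #>\<^bsub>G\<^esub> Af c \<and>
      \<gamma>f c \<in> K \<and> \<gamma>f c \<noteq> 0 \<and> Af c [^]\<^bsub>G\<^esub> l = pideal (\<gamma>f c)"
    using torsion_representative[of _ l] by metis
  define Q where "Q = (\<lambda>(c, P) (\<alpha>, t, j, a, b). (\<lfloor>real l * t\<rfloor>, (j, b), a) \<in> ideal_codes d l \<and> \<alpha> \<in> K \<and> \<alpha> \<noteq> 0 \<and> a \<noteq> 0 \<and>
    imul (Af c) P = (\<lambda>z. \<alpha> * z) ` lat j b a \<and>
    (cmod \<alpha>)\<^sup>2 ^ l = exp (real l * t) * (cmod (\<gamma>f c))\<^sup>2 * of_rat (inm P) ^ l \<and>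
    (cmod (cj \<alpha>))\<^sup>2 ^ l = of_int a ^ (2 * l) * exp (- (real l * t)) * (cmod (cj (\<gamma>f c)))\<^sup>2 * of_rat (inm P) ^ l)"
  have "\<exists>v. Q cp v" if cp_in: "cp \<in> ?T \<times> PP" for cp
  proof -
    obtain c P where cp: "cp = (c, P)" "c \<in> ?T" "P \<in> PP" using cp_in by auto
    have "\<exists>\<alpha> t j a b. Q (c, P) (\<alpha>, t, j, a, b)"
      unfolding Q_def prod.case using T[OF cp(2)] PP[OF cp(3)] l by (intro ideal_code) auto
    thus ?thesis unfolding cp(1) by blast
  qed
  then obtain v where v: "\<And>cp. cp \<in> ?T \<times> PP \<Longrightarrow> Q cp (v cp)" by metis
  define code where "code cp = (case v cp of (\<alpha> :: complex, t, j, a, b) \<Rightarrow> (\<lfloor>real l * t\<rfloor>, (j :: int, b :: int), a :: int))" for cp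
  have sub: "code ` (?T \<times> PP) \<subseteq> ideal_codes d l"
  proof
    fix y assume "y \<in> code ` (?T \<times> PP)"
    then obtain c P where cP: "c \<in> ?T" "P \<in> PP" "y = code (c, P)" by auto
    obtain \<alpha> t j a b where vv: "v (c, P) = (\<alpha>, t, j, a, b)" by (metis prod.exhaust)
    have "Q (c, P) (\<alpha>, t, j, a, b)" using v[of "(c, P)"] cP unfolding vv by simp
    thus "y \<in> ideal_codes d l" unfolding cP(3) code_def vv Q_def by simp
  qed
  have inj: "inj_on code (?T \<times> PP)"
  proof (rule inj_onI)
    fix x x' assume x: "x \<in> ?T \<times> PP" and x': "x' \<in> ?T \<times> PP" and eq: "code x = code x'"
    obtain c P where cP: "x = (c, P)" "c \<in> ?T" "P \<in> PP" using x by auto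
    obtain c' P' where cP': "x' = (c', P')" "c' \<in> ?T" "P' \<in> PP" using x' by auto
    obtain \<alpha> t j a b where vv: "v x = (\<alpha>, t, j, a, b)" by (metis prod.exhaust)
    obtain \<alpha>' t' j' a' b' where vv': "v x' = (\<alpha>', t', j', a', b')" by (metis prod.exhaust)
    have same: "\<lfloor>real l * t\<rfloor> = \<lfloor>real l * t'\<rfloor>" "j' = j" "b' = b" "a' = a"
      using eq unfolding code_def vv vv' by auto
    have q: "Q (c, P) (\<alpha>, t, j, a, b)" using v[OF x, unfolded vv] unfolding cP(1) .
    have q': "Q (c', P') (\<alpha>', t', j, a, b)" using v[OF x', unfolded vv'] unfolding cP'(1) same .
    note Tc = T[OF cP(2)] and Tc' = T[OF cP'(2)]
    note q = q[unfolded Q_def prod.case] and q' = q'[unfolded Q_def prod.case]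
    have coll: "ideal_collision l P P'"
      by (rule ideal_code_collision(1)[where A = "Af c" and \<gamma> = "\<gamma>f c" and A' = "Af c'" and \<gamma>' = "\<gamma>f c'"
          and \<alpha> = \<alpha> and \<alpha>' = \<alpha>' and L = "lat j b a" and a = a and t = t and t' = t'])
         (use Tc Tc' q q' PP cP cP' same in blast)+
    hence PP': "P = P'" using nocoll cP(3) cP'(3) by blast
    have "principal_ideals K #>\<^bsub>G\<^esub> Af c = principal_ideals K #>\<^bsub>G\<^esub> Af c'"
      by (rule ideal_code_collision(2)[where P = P and P' = P' and A = "Af c" and \<gamma> = "\<gamma>f c" and A' = "Af c'" and \<gamma>' = "\<gamma>f c'"
          and \<alpha> = \<alpha> and \<alpha>' = \<alpha>' and L = "lat j b a" and a = a and t = t and t' = t' and l = l])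
         (use Tc Tc' q q' PP PP' cP cP' same in blast)+
    hence "c = c'" using Tc Tc' by simp
    thus "x = x'" using cP cP' PP' by simp
  qed
  \<comment> \<open>Finiteness of the torsion comes out here, from an injection into the finite set
    of codes; since \<open>PP\<close> is nonempty it passes from pairs to classes.\<close>
  have finp: "finite (?T \<times> PP)"
    using finite_subset[OF sub finite_ideal_codes] finite_image_iff[OF inj] by blast
  show finT: "finite ?T" using finite_cartesian_productD1[OF finp ne] .
  have "card (?T \<times> PP) \<le> card (ideal_codes d l)"
    using card_inj_on_le[OF inj sub finite_ideal_codes] .
  thus "card ?T * card PP \<le> card (ideal_codes d l)" by (simp add: card_cartesian_product)
qed

end

section \<open>Split primes and collisions\<close>

text \<open>The equation says that \<open>\<rat>(\<surd>d)\<close> is generated by a root of \<open>T\<^sup>2 - t T + \<sigma> (p p')^l\<close>.\<close>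

definition bad_disc :: "nat \<Rightarrow> nat \<Rightarrow> int \<Rightarrow> bool" where
  "bad_disc l Y d \<longleftrightarrow> (\<exists>p\<in>{1..Y}. \<exists>p'\<in>{1..Y}. \<exists>t\<in>{- (4 * int Y ^ l)..4 * int Y ^ l}. \<exists>\<sigma>\<in>{1, -1}. \<exists>f.
     f \<noteq> 0 \<and> t\<^sup>2 - 4 * \<sigma> * int (p * p') ^ l = d * f\<^sup>2)"

definition split_primes :: "int \<Rightarrow> nat \<Rightarrow> nat set" where
  "split_primes d Y = {p. prime p \<and> odd p \<and> p \<le> Y \<and> Legendre d (int p) = 1}"

lemma finite_split_primes: "finite (split_primes d Y)"
  by (rule finite_subset[of _ "{..Y}"]) (auto simp: split_primes_def)

text \<open>The rational number f/f' has square times \<open>d\<close> integral, so f' divides f; by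
  symmetry the squares of both are equal.\<close>

lemma squarefree_int_eq_of_square_multiple:
  fixes d d' f f' :: int
  assumes "squarefree d" "squarefree d'" "f \<noteq> 0" "f' \<noteq> 0" "d * f\<^sup>2 = d' * f'\<^sup>2"
  shows "d = d'"
proof -
  have "f'\<^sup>2 dvd f\<^sup>2" if "squarefree d" "squarefree d'" "f \<noteq> 0" "f' \<noteq> 0" "d * f\<^sup>2 = d' * f'\<^sup>2" for d d' f f' :: int
  proof -
    have "d * f\<^sup>2 = d' * f'\<^sup>2" by fact
    hence "(of_int d * (of_int f)\<^sup>2 :: rat) = of_int d' * (of_int f')\<^sup>2" by (metis of_int_mult of_int_power)
    hence "of_int d * (of_int f / of_int f' :: rat)\<^sup>2 = of_int d'" using that by (simp add: power_divide field_simps)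
    hence "of_int d * (of_int f / of_int f' :: rat)\<^sup>2 \<in> \<int>" by simp
    hence "(of_int f / of_int f' :: rat) \<in> \<int>" by (rule squarefree_mult_rat_square_int[OF that(1)])
    then obtain k where "(of_int f / of_int f' :: rat) = of_int k" by (auto elim: Ints_cases)
    hence "(of_int f :: rat) = of_int (k * f')" using that by (simp add: field_simps)
    hence "f = k * f'" by (simp only: of_int_eq_iff)
    thus ?thesis by (simp add: power_mult_distrib)
  qed
  from this[OF assms] this[OF assms(2,1,4,3) assms(5)[symmetric]]
  have "f\<^sup>2 = f'\<^sup>2" by (metis zdvd_antisym_nonneg zero_le_power2)
  thus ?thesis using assms(3,4,5) by simp
qed

text \<open>A tuple (p, p', t, \<sigma>) determines \<open>d\<close> as a squarefree part. There are
  2 Y^2 (8 Y^l + 1) tuples, at most 18 Y^(l+2).\<close>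

lemma card_bad_disc:
  assumes "Y \<ge> 1"
  shows "finite {d. squarefree d \<and> bad_disc l Y d}" "card {d. squarefree d \<and> bad_disc l Y d} \<le> 18 * Y ^ (l + 2)"
proof -
  let ?S = "{d. squarefree d \<and> bad_disc l Y d}"
  define W :: "(nat \<times> nat \<times> int \<times> int) set" where
    "W = {1..Y} \<times> {1..Y} \<times> {- (4 * int Y ^ l)..4 * int Y ^ l} \<times> {1, -1}"
  define g :: "nat \<times> nat \<times> int \<times> int \<Rightarrow> int" where
    "g = (\<lambda>(p, p', t, \<sigma>). THE d. squarefree d \<and> (\<exists>f. f \<noteq> 0 \<and> t\<^sup>2 - 4 * \<sigma> * int (p * p') ^ l = d * f\<^sup>2))"
  have sub: "?S \<subseteq> g ` W"
  proof
    fix d assume "d \<in> ?S"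
    then obtain p p' t \<sigma> f where d: "squarefree d" "p \<in> {1..Y}" "p' \<in> {1..Y}" "t \<in> {- (4 * int Y ^ l)..4 * int Y ^ l}"
      "\<sigma> \<in> {1, -1}" "f \<noteq> 0" "t\<^sup>2 - 4 * \<sigma> * int (p * p') ^ l = d * f\<^sup>2" unfolding bad_disc_def by blast
    have "g (p, p', t, \<sigma>) = d" unfolding g_def prod.case
    proof (rule the_equality)
      show "squarefree d \<and> (\<exists>f. f \<noteq> 0 \<and> t\<^sup>2 - 4 * \<sigma> * int (p * p') ^ l = d * f\<^sup>2)" using d by blast
      fix d' assume "squarefree d' \<and> (\<exists>f. f \<noteq> 0 \<and> t\<^sup>2 - 4 * \<sigma> * int (p * p') ^ l = d' * f\<^sup>2)"
      then obtain f' where "squarefree d'" "f' \<noteq> 0" "t\<^sup>2 - 4 * \<sigma> * int (p * p') ^ l = d' * f'\<^sup>2" by blast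
      thus "d' = d" using squarefree_int_eq_of_square_multiple[of d' d f' f] d by simp
    qed
    moreover have "(p, p', t, \<sigma>) \<in> W" unfolding W_def using d by blast
    ultimately show "d \<in> g ` W" by (metis image_eqI)
  qed
  have finW: "finite W" unfolding W_def by auto
  show "finite ?S" using finite_subset[OF sub] finW by blast
  have "card ?S \<le> card W" using sub finW by (meson card_image_le card_mono finite_imageI le_trans)
  also have "card W = Y * (Y * ((8 * Y ^ l + 1) * 2))"
  proof -
    have "nat (4 * int Y ^ l + 4 * int Y ^ l + 1) = 8 * Y ^ l + 1"
      by (simp add: nat_add_distrib nat_mult_distrib nat_power_eq)
    thus ?thesis unfolding W_def by (simp add: card_cartesian_product algebra_simps)
  qed
  also have "\<dots> \<le> Y * (Y * (9 * Y ^ l * 2))"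
  proof -
    have "1 \<le> Y ^ l" using assms by simp
    thus ?thesis by (intro mult_left_mono mult_right_mono) auto
  qed
  also have "\<dots> = 18 * Y ^ (l + 2)" by (simp add: power_add power2_eq_square)
  finally show "card ?S \<le> 18 * Y ^ (l + 2)" .
qed

context quad begin

text \<open>The ideal generated by p and b + \<surd>d. It is a prime ideal of degree one when p is
  an odd prime not dividing d and b^2 is congruent to d modulo p.\<close>

definition prime_ideal_over :: "nat \<Rightarrow> int \<Rightarrow> complex set" where
  "prime_ideal_over p b = {of_nat p * x + (of_int b + s) * y | x y. x \<in> Ok \<and> y \<in> Ok}"

lemma prime_ideal_over_mem: "x \<in> Ok \<Longrightarrow> y \<in> Ok \<Longrightarrow> of_nat p * x + (of_int b + s) * y \<in> prime_ideal_over p b"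
  unfolding prime_ideal_over_def by blast

lemma Ok_nat [simp, intro]: "of_nat p \<in> Ok" using Ok_int[of "int p"] by simp

lemma prime_ideal_over_Ok: "prime_ideal_over p b \<subseteq> Ok"
  unfolding prime_ideal_over_def by (auto intro!: Ok_add Ok_mult)

lemma cj_nat [simp]: "cj (of_nat p) = of_nat p" using cj_int[of "int p"] by simp

lemma p_in_prime_ideal: "of_nat p \<in> prime_ideal_over p b"
  using prime_ideal_over_mem[of 1 0 p b] by simp
lemma bs_in_prime_ideal: "of_int b + s \<in> prime_ideal_over p b"
  using prime_ideal_over_mem[of 0 1 p b] by simp

lemma fi_prime_ideal: assumes "p > 0" shows "fi (prime_ideal_over p b)"
proof (rule fiI[where z = "of_nat p" and b = 1])
  show "prime_ideal_over p b \<subseteq> K" using prime_ideal_over_Ok Ok_K by blast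
  show "of_nat p \<in> prime_ideal_over p b" by (rule p_in_prime_ideal)
  show "int_mod.subspace (prime_ideal_over p b)" unfolding int_subspace_iff
  proof (intro conjI ballI allI)
    show "0 \<in> prime_ideal_over p b" using prime_ideal_over_mem[of 0 0 p b] by simp
    fix u v assume "u \<in> prime_ideal_over p b" "v \<in> prime_ideal_over p b"
    then obtain x y x' y' where "x \<in> Ok" "y \<in> Ok" "x' \<in> Ok" "y' \<in> Ok"
      "u = of_nat p * x + (of_int b + s) * y" "v = of_nat p * x' + (of_int b + s) * y'"
      unfolding prime_ideal_over_def by blast
    moreover from this have "u + v = of_nat p * (x + x') + (of_int b + s) * (y + y')" by (simp add: algebra_simps)
    ultimately show "u + v \<in> prime_ideal_over p b" unfolding prime_ideal_over_def using Ok_add by blast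
  next
    fix c :: int and u assume "u \<in> prime_ideal_over p b"
    then obtain x y where "x \<in> Ok" "y \<in> Ok" "u = of_nat p * x + (of_int b + s) * y"
      unfolding prime_ideal_over_def by blast
    moreover from this have "of_int c * u = of_nat p * (of_int c * x) + (of_int b + s) * (of_int c * y)" by (simp add: algebra_simps)
    ultimately show "of_int c * u \<in> prime_ideal_over p b" unfolding prime_ideal_over_def using Ok_mult[OF Ok_int] by blast
  qed
  fix r u assume r: "r \<in> Ok" and "u \<in> prime_ideal_over p b"
  then obtain x y where "x \<in> Ok" "y \<in> Ok" "u = of_nat p * x + (of_int b + s) * y"
    unfolding prime_ideal_over_def by blast
  moreover from this have "r * u = of_nat p * (r * x) + (of_int b + s) * (r * y)" by (simp add: algebra_simps)
  ultimately show "r * u \<in> prime_ideal_over p b" unfolding prime_ideal_over_def using Ok_mult[OF r] by blast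
next
  fix u assume "u \<in> prime_ideal_over p b"
  thus "1 * u \<in> Ok" using prime_ideal_over_Ok by auto
qed (use assms in auto)

text \<open>Every product of a generator with a conjugate generator is divisible by p, since p
  divides b^2 - d. Conversely p^2 and p(b - s) + (b + s)p = 2bp occur, and their greatest common
  divisor is p because p does not divide 2b.\<close>

lemma inm_prime_ideal:
  assumes p: "prime p" "odd p" "\<not> int p dvd d" and b: "int p dvd b\<^sup>2 - d"
  shows "inm (prime_ideal_over p b) = of_nat p" "\<not> int p dvd 2 * b"
proof -
  let ?P = "prime_ideal_over p b"
  have p0: "p > 0" using p by (simp add: prime_gt_0_nat)
  note fP = fi_prime_ideal[OF p0, of b]
  have pr: "prime (int p)" using p by simp
  have pb: "\<not> int p dvd b"
  proof
    assume "int p dvd b"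
    hence "int p dvd b\<^sup>2" by (simp add: power2_eq_square)
    hence "int p dvd b\<^sup>2 - (b\<^sup>2 - d)" using b by (rule dvd_diff)
    thus False using p(3) by simp
  qed
  have "\<not> int p dvd 2"
  proof
    assume "int p dvd 2"
    hence "p dvd 2" by (metis int_dvd_int_iff of_nat_numeral)
    hence "p \<le> 2" by (rule dvd_imp_le) simp
    thus False using p odd_prime_gt_2[of p] by simp
  qed
  thus npb: "\<not> int p dvd 2 * b" using pr pb by (simp add: prime_dvd_mult_iff)
  hence "coprime (int p) (2 * b)" using pr prime_imp_coprime by blast
  then obtain u v where uv: "u * int p + v * (2 * b) = 1"
    using bezout_int[of "int p" "2 * b"] by (auto simp: coprime_iff_gcd_eq_1)
  have icjP: "icj ?P = {of_nat p * x + (of_int b - s) * y | x y. x \<in> Ok \<and> y \<in> Ok}"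
  proof -
    have cjx: "cj (of_nat p * x + (of_int b + s) * y) = of_nat p * cj x + (of_int b - s) * cj y" if "x \<in> Ok" "y \<in> Ok" for x y
      using that Ok_K cj_int[of "int p"] int_in_K[of "int p"] by simp
    show ?thesis
    proof (intro equalityI subsetI)
      fix z assume "z \<in> icj ?P"
      then obtain x y where "x \<in> Ok" "y \<in> Ok" "z = cj (of_nat p * x + (of_int b + s) * y)"
        unfolding icj_def prime_ideal_over_def by blast
      thus "z \<in> {of_nat p * x + (of_int b - s) * y | x y. x \<in> Ok \<and> y \<in> Ok}" using cjx Ok_cj by blast
    next
      fix z assume "z \<in> {of_nat p * x + (of_int b - s) * y | x y. x \<in> Ok \<and> y \<in> Ok}"
      then obtain x y where xy: "x \<in> Ok" "y \<in> Ok" "z = of_nat p * x + (of_int b - s) * y" by blast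
      hence "z = cj (of_nat p * cj x + (of_int b + s) * cj y)" using cjx[OF Ok_cj Ok_cj] Ok_K by simp
      thus "z \<in> icj ?P" unfolding icj_def using prime_ideal_over_mem[OF Ok_cj[OF xy(1)] Ok_cj[OF xy(2)]] by blast
    qed
  qed
  obtain k where k: "b\<^sup>2 - d = int p * k" using b by blast
  have kc: "(of_int b + s) * (of_int b - s) = of_nat p * of_int k"
  proof -
    have "(of_int b + s) * (of_int b - s) = of_int b * of_int b - s * s" by (simp add: algebra_simps)
    also have "\<dots> = of_int (b\<^sup>2 - d)" by (simp add: sqd_mult_self power2_eq_square)
    finally show ?thesis unfolding k by simp
  qed
  note fJ = fi_imul[OF fP fi_icj[OF fP]]
  note DJ = fractional_idealD[OF fJ]
  have fip: "fi (pideal (of_nat p))" using p0 int_in_K[of "int p"] by (intro fi_pideal) auto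
  have "imul ?P (icj ?P) \<subseteq> pideal (of_nat p)"
  proof (rule imul_least[OF fi_subspace[OF fip]])
    fix z z' assume "z \<in> ?P" "z' \<in> icj ?P"
    obtain x y where xy0: "x \<in> Ok" "y \<in> Ok" "z = of_nat p * x + (of_int b + s) * y"
      using \<open>z \<in> ?P\<close> unfolding prime_ideal_over_def by blast
    obtain x' y' where xy1: "x' \<in> Ok" "y' \<in> Ok" "z' = of_nat p * x' + (of_int b - s) * y'"
      using \<open>z' \<in> icj ?P\<close> unfolding icjP by blast
    note xy = xy0(1,2) xy1(1,2) xy0(3) xy1(3)
    have "z * z' = of_nat p * (of_nat p * x * x' + x * y' * (of_int b - s) + x' * y * (of_int b + s)) + (of_int b + s) * (of_int b - s) * (y * y')"
      unfolding xy by (simp add: algebra_simps)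
    also have "\<dots> = of_nat p * (of_nat p * x * x' + x * y' * (of_int b + - s) + x' * y * (of_int b + s) + of_int k * (y * y'))"
      unfolding kc by (simp add: algebra_simps)
    also have "\<dots> \<in> pideal (of_nat p)"
      by (rule pideal_mem) (intro Ok_add Ok_mult Ok_uminus Ok_int Ok_nat Ok_s xy(1-4))
    finally show "z * z' \<in> pideal (of_nat p)" .
  qed
  moreover have "pideal (of_nat p) \<subseteq> imul ?P (icj ?P)"
  proof -
    have i1: "of_nat p \<in> icj ?P" unfolding icjP by (rule CollectI, rule exI[of _ 1], rule exI[of _ 0]) simp
    have i2: "of_int b - s \<in> icj ?P" unfolding icjP by (rule CollectI, rule exI[of _ 0], rule exI[of _ 1]) simp
    have m1: "of_nat p * of_nat p \<in> imul ?P (icj ?P)" using p_in_prime_ideal i1 by (rule imul_mem)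
    have m2: "of_nat p * (of_int b - s) \<in> imul ?P (icj ?P)" using p_in_prime_ideal i2 by (rule imul_mem)
    have m3: "(of_int b + s) * of_nat p \<in> imul ?P (icj ?P)" using bs_in_prime_ideal i1 by (rule imul_mem)
    have "of_int u * (of_nat p * of_nat p) + of_int v * (of_nat p * (of_int b - s) + (of_int b + s) * of_nat p) \<in> imul ?P (icj ?P)"
      by (intro DJ(4) DJ(8) m1 m2 m3)
    also have "of_int u * (of_nat p * of_nat p) + of_int v * (of_nat p * (of_int b - s) + (of_int b + s) * of_nat p)
        = of_nat p * of_int (u * int p + v * (2 * b))" by (simp add: algebra_simps)
    finally have "of_nat p \<in> imul ?P (icj ?P)" using uv by simp
    thus ?thesis using DJ(5) by (auto simp: pideal_def mult.commute)
  qed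
  ultimately have "imul ?P (icj ?P) = pideal (of_rat (of_nat p))" by simp
  thus "inm ?P = of_nat p" using p0 by (intro inm_unique[OF fP]) auto
qed

lemma pow_mem: "x \<in> I \<Longrightarrow> x ^ n \<in> I [^]\<^bsub>G\<^esub> (n::nat)"
proof (induction n)
  case (Suc n)
  have "x ^ n * x \<in> imul (I [^]\<^bsub>G\<^esub> n) I" using Suc by (intro imul_mem) auto
  thus ?case by (simp add: mult.commute)
qed simp

lemma pow_subset_Ok: assumes "I \<subseteq> Ok" shows "I [^]\<^bsub>G\<^esub> (n::nat) \<subseteq> Ok"
proof (induction n)
  case (Suc n)
  have "imul (I [^]\<^bsub>G\<^esub> n) I \<subseteq> Ok" using Suc assms by (intro imul_least[OF Ok_subspace]) (auto intro!: Ok_mult)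
  thus ?case by simp
qed simp

text \<open>Reduction modulo the prime ideal sends \<open>s\<close> to -b, hence b - s to 2b; u - v
  b is the image of u + v s.\<close>

lemma conj_power_mod:
  assumes "int p dvd b\<^sup>2 - d"
  shows "\<exists>u v. (of_int b - s) ^ n = of_int u + of_int v * s \<and> int p dvd u - v * b - (2 * b) ^ n"
proof (induction n)
  case 0
  show ?case by (rule exI[of _ 1], rule exI[of _ 0]) simp
next
  case (Suc n)
  then obtain u v where uv: "(of_int b - s) ^ n = of_int u + of_int v * s" "int p dvd u - v * b - (2 * b) ^ n" by blast
  have "(of_int b - s) ^ Suc n = of_int u * of_int b - of_int v * (s * s) + (of_int v * of_int b - of_int u) * s"
    unfolding power_Suc uv(1) by (simp add: algebra_simps)
  hence e: "(of_int b - s) ^ Suc n = of_int (u * b - v * d) + of_int (v * b - u) * s" by (simp add: sqd_mult_self)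
  have "(u * b - v * d) - (v * b - u) * b - (2 * b) ^ Suc n = 2 * b * (u - v * b - (2 * b) ^ n) + v * (b\<^sup>2 - d)"
    by (simp add: power2_eq_square algebra_simps)
  also have "int p dvd \<dots>" using uv(2) assms by (intro dvd_add dvd_mult)
  finally show ?case using e by blast
qed

lemma split_prime_root:
  assumes "p \<in> split_primes d Y"
  obtains b where "int p dvd b\<^sup>2 - d" "\<not> int p dvd d" "prime p" "odd p" "p \<le> Y"
proof -
  have p: "prime p" "odd p" "p \<le> Y" "Legendre d (int p) = 1" using assms by (auto simp: split_primes_def)
  have "\<not> [d = 0] (mod int p)" "QuadRes (int p) d"
    using p(4) by (auto simp: Legendre_def split: if_splits)
  thus ?thesis using that p by (auto simp: QuadRes_def cong_iff_dvd_diff)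
qed

text \<open>The generator \<eta> is integral, and its norm and trace provide the data of
  \<open>bad_disc\<close>. The essential point is that \<eta> is not rational: otherwise p would
  divide \<eta>, yet the ideal it generates contains an element not divisible by p.\<close>

lemma collision_imp_bad:
  assumes l: "l \<ge> 1" and p: "prime p" "odd p" "\<not> int p dvd d" "int p dvd b\<^sup>2 - d" "p \<le> Y"
    and p': "prime p'" "odd p'" "\<not> int p' dvd d" "int p' dvd b'\<^sup>2 - d" "p' \<le> Y"
    and ne: "p \<noteq> p'"
    and coll: "ideal_collision l (prime_ideal_over p b) (prime_ideal_over p' b')"
  shows "bad_disc l Y d"
proof -
  let ?P = "prime_ideal_over p b" and ?P' = "prime_ideal_over p' b'"
  have pos: "p > 0" "p' > 0" using p p' by (auto simp: prime_gt_0_nat)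
  note fP = fi_prime_ideal[OF pos(1), of b] and fP' = fi_prime_ideal[OF pos(2), of b']
  note iP = inm_prime_ideal[OF p(1-4)] and iP' = inm_prime_ideal[OF p'(1-4)]
  obtain \<eta> where \<eta>: "\<eta> \<in> K" "\<eta> \<noteq> 0" and id: "imul (?P' [^]\<^bsub>G\<^esub> l) (icj ?P [^]\<^bsub>G\<^esub> l) = pideal \<eta>"
    and n1: "(cmod \<eta>)\<^sup>2 \<le> exp 1 * of_rat (inm ?P * inm ?P') ^ l"
    and n2: "(cmod (cj \<eta>))\<^sup>2 \<le> exp 1 * of_rat (inm ?P * inm ?P') ^ l"
    using coll unfolding ideal_collision_def by blast
  have "icj ?P \<subseteq> Ok" using prime_ideal_over_Ok Ok_cj by (auto simp: icj_def)
  hence "pideal \<eta> \<subseteq> Ok" unfolding id[symmetric]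
    using pow_subset_Ok[of "icj ?P" l] pow_subset_Ok[OF prime_ideal_over_Ok, of p' b' l]
    by (intro imul_least[OF Ok_subspace]) (auto intro!: Ok_mult)
  hence \<eta>O: "\<eta> \<in> Ok" using pideal_self by blast
  have "\<bar>nm \<eta>\<bar> = inm (imul (?P' [^]\<^bsub>G\<^esub> l) (icj ?P [^]\<^bsub>G\<^esub> l))" unfolding id using inm_pideal[OF \<eta>] by simp
  also have "\<dots> = of_nat p' ^ l * of_nat p ^ l"
    using fP fP' by (simp add: inm_imul fi_pow fi_icj inm_pow inm_icj iP(1) iP'(1))
  finally have absn: "\<bar>nm \<eta>\<bar> = of_nat (p * p') ^ l" by (simp add: power_mult_distrib)
  obtain N where N: "nm \<eta> = of_int N" using Ok_nm[OF \<eta>O] by metis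
  obtain t where t: "tr \<eta> = of_int t" using \<eta>O by (auto simp: Ok_iff elim: Ints_cases)
  have "(of_int \<bar>N\<bar> :: rat) = of_int (int (p * p') ^ l)" using absn N by simp
  hence absN: "\<bar>N\<bar> = int (p * p') ^ l" by (simp only: of_int_eq_iff)
  define \<sigma> :: int where "\<sigma> = (if N \<ge> 0 then 1 else -1)"
  have \<sigma>: "N = \<sigma> * int (p * p') ^ l" "\<sigma> \<in> {1, -1}" using absN by (auto simp: \<sigma>_def abs_if split: if_splits)
  have dz: "of_int d * (2 * ip \<eta>)\<^sup>2 = (of_int (t\<^sup>2 - 4 * N) :: rat)"
  proof -
    have "of_int d * (2 * ip \<eta>)\<^sup>2 = (tr \<eta>)\<^sup>2 - 4 * nm \<eta>" by (simp add: tr_def nm_def power2_eq_square)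
    thus ?thesis by (simp add: t N)
  qed
  hence "2 * ip \<eta> \<in> \<int>" using squarefree_mult_rat_square_int[OF sqf, of "2 * ip \<eta>"] by simp
  then obtain f where f: "2 * ip \<eta> = of_int f" by (auto elim: Ints_cases)
  have "(of_int (d * f\<^sup>2) :: rat) = of_int (t\<^sup>2 - 4 * N)" using dz f by simp
  hence df: "d * f\<^sup>2 = t\<^sup>2 - 4 * N" by (simp only: of_int_eq_iff)
  have YY: "real (p * p') ^ l \<le> (real Y ^ l)\<^sup>2"
  proof -
    have "real (p * p') \<le> real Y * real Y" unfolding of_nat_mult using p p' by (intro mult_mono) auto
    hence "real (p * p') ^ l \<le> (real Y * real Y) ^ l" by (intro power_mono) auto
    thus ?thesis by (simp add: power_mult_distrib power2_eq_square)
  qed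
  \<comment> \<open>Here exp 1 is estimated by 4 so that the square root is 2; the two absolute
    values then add up to the constant 4 in \<open>bad_disc\<close>.\<close>
  have bound: "cmod z \<le> 2 * real Y ^ l" if "(cmod z)\<^sup>2 \<le> exp 1 * of_rat (inm ?P * inm ?P') ^ l" for z
  proof (rule power2_le_imp_le)
    have "(of_rat (inm ?P * inm ?P') :: real) = real (p * p')" by (simp add: iP(1) iP'(1) of_rat_mult)
    hence "(cmod z)\<^sup>2 \<le> exp 1 * real (p * p') ^ l" using that by simp
    also have "\<dots> \<le> 4 * (real Y ^ l)\<^sup>2" using YY exp_le by (intro mult_mono) auto
    finally show "(cmod z)\<^sup>2 \<le> (2 * real Y ^ l)\<^sup>2" by (simp add: power_mult_distrib)
  qed simp
  have tY: "\<bar>t\<bar> \<le> 4 * int Y ^ l"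
  proof -
    have "\<bar>real_of_int t\<bar> = cmod (\<eta> + cj \<eta>)" unfolding tr_eq[OF \<eta>(1)] t by simp
    also have "\<dots> \<le> cmod \<eta> + cmod (cj \<eta>)" by (rule norm_triangle_ineq)
    also have "\<dots> \<le> 4 * real Y ^ l" using bound[OF n1] bound[OF n2] by simp
    finally have "real_of_int \<bar>t\<bar> \<le> real_of_int (4 * int Y ^ l)" by simp
    thus ?thesis by (simp only: of_int_le_iff)
  qed
  \<comment> \<open>\<open>f = 0\<close> means that \<eta> is an integer r with r^2 = (p p')^l, so p
    divides r.\<close>
  have "f \<noteq> 0"
  proof
    assume "f = 0"
    hence ip0: "ip \<eta> = 0" using f by simp
    define q where "q = rp \<eta>"
    have \<eta>q: "\<eta> = of_rat q" using K_eq[OF \<eta>(1)] ip0 by (simp add: q_def)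
    hence "q \<in> \<int>" using \<eta>O Ok_rat by simp
    then obtain r where r: "q = of_int r" by (auto elim: Ints_cases)
    have \<eta>r: "\<eta> = of_int r" using \<eta>q r by simp
    have "nm \<eta> = of_int (r\<^sup>2)" using \<eta>q nm_rat[of q] r by simp
    hence "(of_int N :: rat) = of_int (r\<^sup>2)" using N by simp
    hence "N = r\<^sup>2" by (simp only: of_int_eq_iff)
    hence "r\<^sup>2 = int (p * p') ^ l" using absN by simp
    moreover have "int p dvd int (p * p') ^ l" using l by (simp add: dvd_power_le power_mult_distrib dvd_mult2 dvd_power)
    ultimately have "int p dvd r\<^sup>2" by simp
    hence pr: "int p dvd r" using p(1) by (metis prime_dvd_power prime_nat_int_transfer)
    obtain r' where r': "r = int p * r'" using pr by blast
    \<comment> \<open>The product of p'^l and (b - s)^l lies in the ideal. If it were divisible by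
      p, so would be its coordinates, up to a factor 2 caused by half-integers; then p divides u and
      v, and by reduction also (2b)^l.\<close>
    have "of_nat p' ^ l \<in> ?P' [^]\<^bsub>G\<^esub> l" by (rule pow_mem[OF p_in_prime_ideal])
    moreover have "of_int b - s \<in> icj ?P"
      unfolding icj_def by (rule image_eqI[OF _ bs_in_prime_ideal]) simp
    hence "(of_int b - s) ^ l \<in> icj ?P [^]\<^bsub>G\<^esub> l" by (rule pow_mem)
    ultimately have "of_nat p' ^ l * (of_int b - s) ^ l \<in> pideal \<eta>" unfolding id[symmetric] by (rule imul_mem)
    then obtain y where y: "y \<in> Ok" "of_nat p' ^ l * (of_int b - s) ^ l = of_int r * y" unfolding pideal_def \<eta>r by blast
    obtain u v where uv: "(of_int b - s) ^ l = of_int u + of_int v * s" "int p dvd u - v * b - (2 * b) ^ l"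
      using conj_power_mod[OF p(4)] by blast
    have "of_int r' * y \<in> Ok" using y(1) by auto
    then obtain m n where mn: "2 * (of_int r' * y) = of_int m + of_int n * s" by (rule Ok_half_ints)
    have "of_int (2 * int p' ^ l * u) + of_int (2 * int p' ^ l * v) * s = 2 * (of_nat p' ^ l * (of_int b - s) ^ l)"
      unfolding uv(1) by (simp add: algebra_simps)
    also have "\<dots> = of_nat p * (2 * (of_int r' * y))" unfolding y(2) r' by simp
    also have "\<dots> = of_int (int p * m) + of_int (int p * n) * s" unfolding mn by (simp add: algebra_simps)
    finally have "2 * int p' ^ l * u = int p * m" "2 * int p' ^ l * v = int p * n"
      using Zs_eq_iff by blast+
    hence pd: "int p dvd 2 * int p' ^ l * u" "int p dvd 2 * int p' ^ l * v" by simp_all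
    have prI: "prime (int p)" using p by simp
    have np2: "\<not> int p dvd 2 * int p' ^ l"
    proof
      assume "int p dvd 2 * int p' ^ l"
      hence "int p dvd 2 \<or> int p dvd int p' ^ l" using prI prime_dvd_mult_iff by blast
      moreover have "\<not> int p dvd 2" using iP(2) by (meson dvd_mult2)
      ultimately have "int p dvd int p'" using prI prime_dvd_power by blast
      hence "p dvd p'" by simp
      thus False using ne p(1) p'(1) primes_dvd_imp_eq by blast
    qed
    have "int p dvd u" "int p dvd v" using pd np2 prI prime_dvd_mult_iff by blast+
    hence "int p dvd u - v * b" by (intro dvd_diff dvd_mult2)
    hence "int p dvd (u - v * b) - (u - v * b - (2 * b) ^ l)" using uv(2) by (rule dvd_diff)
    hence "int p dvd (2 * b) ^ l" by simp
    hence "int p dvd 2 * b" using prI prime_dvd_power by blast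
    thus False using iP(2) by blast
  qed
  moreover have "t\<^sup>2 - 4 * \<sigma> * int (p * p') ^ l = d * f\<^sup>2" using df \<sigma>(1) by (simp add: mult.assoc)
  moreover have "t \<in> {- (4 * int Y ^ l)..4 * int Y ^ l}" using tY by auto
  moreover have "p \<in> {1..Y}" "p' \<in> {1..Y}" using p p' pos by auto
  ultimately show ?thesis unfolding bad_disc_def using \<sigma>(2) by blast
qed

end

section \<open>Asymptotic estimates\<close>

context quad begin

text \<open>Using the unit ideal alone, where there is nothing to collide, gives the bound valid for
  every field.\<close>

lemma torsion_card_le_codes:
  assumes "l \<ge> 1"
  shows "finite (class_group_torsion K l)" "card (class_group_torsion K l) \<le> card (ideal_codes d l)"
  using torsion_card_bound[OF assms, of "{Ok}"] fractional_ideal_Ok by auto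

lemma torsion_card_mult_split_primes:
  assumes l: "l \<ge> 1" and good: "\<not> bad_disc l Y d"
  shows "card (class_group_torsion K l) * card (split_primes d Y) \<le> card (ideal_codes d l)"
proof (cases "split_primes d Y = {}")
  case False
  have "\<forall>p\<in>split_primes d Y. \<exists>b. int p dvd b\<^sup>2 - d \<and> \<not> int p dvd d \<and> prime p \<and> odd p \<and> p \<le> Y"
    using split_prime_root by metis
  then obtain b where b: "\<And>p. p \<in> split_primes d Y \<Longrightarrow> int p dvd (b p)\<^sup>2 - d \<and> \<not> int p dvd d \<and> prime p \<and> odd p \<and> p \<le> Y"
    by metis
  define PP where "PP = (\<lambda>p. prime_ideal_over p (b p)) ` split_primes d Y"
  have inm_eq: "inm (prime_ideal_over p (b p)) = of_nat p" if "p \<in> split_primes d Y" for p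
    using inm_prime_ideal(1)[of p "b p"] b[OF that] by blast
  have "inj_on (\<lambda>p. prime_ideal_over p (b p)) (split_primes d Y)"
    by (rule inj_onI) (metis inm_eq of_nat_eq_iff)
  hence cPP: "card PP = card (split_primes d Y)" unfolding PP_def by (rule card_image)
  have "card (class_group_torsion K l) * card PP \<le> card (ideal_codes d l)"
  proof (rule torsion_card_bound(2)[OF l])
    show "finite PP" "PP \<noteq> {}" using finite_split_primes False by (auto simp: PP_def)
    show "fi P" if "P \<in> PP" for P
      using that b unfolding PP_def by (auto intro!: fi_prime_ideal prime_gt_0_nat)
    fix P P' assume "P \<in> PP" "P' \<in> PP" "P \<noteq> P'"
    then obtain p p' where p: "p \<in> split_primes d Y" "P = prime_ideal_over p (b p)"
      "p' \<in> split_primes d Y" "P' = prime_ideal_over p' (b p')" unfolding PP_def by blast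
    have "p \<noteq> p'" using p \<open>P \<noteq> P'\<close> by blast
    thus "\<not> ideal_collision l P P'"
      using collision_imp_bad[OF l, of p "b p" Y p' "b p'"] b[OF p(1)] b[OF p(3)] good unfolding p(2,4) by blast
  qed
  thus ?thesis unfolding cPP .
qed simp

end

lemma card_int_abs_le:
  assumes "R \<ge> 0" shows "finite {u::int. real_of_int \<bar>u\<bar> \<le> R}" "real (card {u::int. real_of_int \<bar>u\<bar> \<le> R}) \<le> 2 * R + 1"
proof -
  have sub: "{u::int. real_of_int \<bar>u\<bar> \<le> R} \<subseteq> {-\<lfloor>R\<rfloor>..\<lfloor>R\<rfloor>}"
  proof
    fix u :: int assume "u \<in> {u. real_of_int \<bar>u\<bar> \<le> R}"
    hence "\<bar>u\<bar> \<le> \<lfloor>R\<rfloor>" by (simp add: le_floor_iff)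
    thus "u \<in> {-\<lfloor>R\<rfloor>..\<lfloor>R\<rfloor>}" by auto
  qed
  show "finite {u::int. real_of_int \<bar>u\<bar> \<le> R}" using finite_subset[OF sub] by simp
  have "card {u::int. real_of_int \<bar>u\<bar> \<le> R} \<le> card {-\<lfloor>R\<rfloor>..\<lfloor>R\<rfloor>}" using sub by (intro card_mono) auto
  hence "real (card {u::int. real_of_int \<bar>u\<bar> \<le> R}) \<le> real (nat (2 * \<lfloor>R\<rfloor> + 1))" by simp
  also have "\<dots> = 2 * of_int \<lfloor>R\<rfloor> + 1" using assms by simp
  also have "\<dots> \<le> 2 * R + 1" using of_int_floor_le[of R] by linarith
  finally show "real (card {u::int. real_of_int \<bar>u\<bar> \<le> R}) \<le> 2 * R + 1" .
qed

lemma card_int_divisors_le: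
  fixes M :: int
  shows "card {A. M \<noteq> 0 \<and> A dvd M} \<le> 2 * card {a::nat. a dvd nat \<bar>M\<bar>}"
proof (cases "M = 0")
  case False
  let ?S = "{a::nat. a dvd nat \<bar>M\<bar>}"
  have fin: "finite ?S" using False finite_divisors_nat[of "nat \<bar>M\<bar>"] by simp
  have "{A. M \<noteq> 0 \<and> A dvd M} \<subseteq> (\<lambda>(\<sigma>, a). \<sigma> * int a) ` ({1, -1} \<times> ?S)"
  proof
    fix A assume "A \<in> {A. M \<noteq> 0 \<and> A dvd M}"
    hence "nat \<bar>A\<bar> \<in> ?S" by (simp flip: int_dvd_int_iff)
    moreover have "A = (if A \<ge> 0 then 1 else -1) * int (nat \<bar>A\<bar>)" by auto
    ultimately show "A \<in> (\<lambda>(\<sigma>, a). \<sigma> * int a) ` ({1, -1} \<times> ?S)" by (intro image_eqI[of _ _ "(if A \<ge> 0 then 1 else -1, nat \<bar>A\<bar>)"]) auto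
  qed
  hence "card {A. M \<noteq> 0 \<and> A dvd M} \<le> card ({1, -1 :: int} \<times> ?S)"
    using fin by (meson card_image_le card_mono finite_SigmaI finite.intros finite_imageI le_trans)
  thus ?thesis by (simp add: card_cartesian_product)
qed simp

text \<open>The only factor of polynomial size is the number of \<open>B\<close>, of order
  |d|^(1/2). The logarithms are O(log |d|) in number, \<open>j\<close> has five values, and
  \<open>A\<close> divides a nonzero integer of size at most 104 |d| = (4 * 25 + 4) |d|. Half of
  \<epsilon> pays for the logarithm, half for the divisors.\<close>

lemma card_ideal_codes_le:
  fixes \<epsilon> :: real and l :: nat
  assumes \<epsilon>: "\<epsilon> > 0"
  shows "\<exists>C>0. \<forall>d. d \<noteq> 0 \<longrightarrow> real (card (ideal_codes d l)) \<le> C * \<bar>real_of_int d\<bar> powr (1 / 2 + \<epsilon>)"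
proof -
  define \<eta> where "\<eta> = \<epsilon> / 2"
  have \<eta>: "\<eta> > 0" using \<epsilon> by (simp add: \<eta>_def)
  obtain C0 where C0: "C0 > 0" "\<And>n::nat. n > 0 \<Longrightarrow> real (card {d. d dvd n}) \<le> C0 * real n powr \<eta>"
    using divisor_bound[OF \<eta>] by blast
  define C1 where "C1 = 2 * real l * 3 powr \<eta> / \<eta> + 3"
  define C where "C = C1 * (5 * 11 * (2 * C0 * 104 powr \<eta>))"
  have C1: "C1 > 0" using \<eta> by (simp add: C1_def add_nonneg_pos)
  have C: "C > 0" using C1 C0 by (simp add: C_def)
  have "real (card (ideal_codes d l)) \<le> C * \<bar>real_of_int d\<bar> powr (1 / 2 + \<epsilon>)" if d0: "d \<noteq> 0" for d
  proof -
    define D where "D = \<bar>real_of_int d\<bar>"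
    have "1 \<le> \<bar>d\<bar>" using d0 by simp
    hence D1: "D \<ge> 1" unfolding D_def by linarith
    define R where "R = real l * ln (3 * sqrt D) + 1"
    have s1: "sqrt D \<ge> 1" using D1 by simp
    hence "1 \<le> 3 * sqrt D" by linarith
    hence ln0: "ln (3 * sqrt D) \<ge> 0" by simp
    hence R0: "R \<ge> 0" by (simp add: R_def)
    have DD: "D powr \<eta> \<ge> 1" using D1 \<eta> by (simp add: ge_one_powr_ge_zero)
    have "ln (3 * sqrt D) \<le> (3 * sqrt D) powr \<eta> / \<eta>" using \<open>1 \<le> 3 * sqrt D\<close> \<eta> by (rule ln_powr_bound)
    also have "(3 * sqrt D) powr \<eta> \<le> 3 powr \<eta> * D powr \<eta>"
    proof -
      have "sqrt D \<le> D" using D1 real_sqrt_le_iff[of D "D\<^sup>2"] by (simp add: self_le_power)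
      hence "(3 * sqrt D) powr \<eta> \<le> (3 * D) powr \<eta>" using \<eta> D1 by (intro powr_mono2) auto
      thus ?thesis using D1 by (simp add: powr_mult)
    qed
    finally have lnD: "ln (3 * sqrt D) \<le> 3 powr \<eta> * D powr \<eta> / \<eta>" using \<eta> by (simp add: divide_right_mono)
    have "2 * R + 1 \<le> C1 * D powr \<eta>"
    proof -
      have "2 * R + 1 = 2 * real l * ln (3 * sqrt D) + 3" by (simp add: R_def)
      also have "\<dots> \<le> 2 * real l * (3 powr \<eta> * D powr \<eta> / \<eta>) + 3 * D powr \<eta>"
        using lnD DD by (intro add_mono mult_left_mono) auto
      finally show ?thesis by (simp add: C1_def algebra_simps)
    qed
    hence cU: "real (card {u::int. real_of_int \<bar>u\<bar> \<le> R}) \<le> C1 * D powr \<eta>" using card_int_abs_le(2)[OF R0] by linarith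
    define BB where "BB = {B::int. B\<^sup>2 \<le> 25 * \<bar>d\<bar>}"
    have BBsub: "BB \<subseteq> {B. real_of_int \<bar>B\<bar> \<le> 5 * sqrt D}"
    proof
      fix B assume "B \<in> BB"
      hence "real_of_int (B\<^sup>2) \<le> real_of_int (25 * \<bar>d\<bar>)" unfolding BB_def by (simp only: mem_Collect_eq of_int_le_iff)
      hence "sqrt ((real_of_int B)\<^sup>2) \<le> sqrt (25 * D)" by (intro real_sqrt_le_mono) (simp add: D_def)
      thus "B \<in> {B. real_of_int \<bar>B\<bar> \<le> 5 * sqrt D}" by (simp add: real_sqrt_mult)
    qed
    have s5: "0 \<le> 5 * sqrt D" using s1 by linarith
    have finBB: "finite BB" using finite_subset[OF BBsub card_int_abs_le(1)[OF s5]] .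
    have "real (card BB) \<le> 2 * (5 * sqrt D) + 1"
      using card_mono[OF card_int_abs_le(1)[OF s5] BBsub] card_int_abs_le(2)[OF s5] by linarith
    hence cB: "real (card BB) \<le> 11 * sqrt D" using s1 by linarith
    define M where "M = (\<lambda>(j::int, B::int). j\<^sup>2 * B\<^sup>2 - 4 * d)"
    define JB where "JB = {-2..2::int} \<times> BB"
    have finJB: "finite JB" using finBB by (simp add: JB_def)
    have cA: "real (card {A. M jB \<noteq> 0 \<and> A dvd M jB}) \<le> 2 * C0 * 104 powr \<eta> * D powr \<eta>" if jB_in: "jB \<in> JB" for jB
    proof (cases "M jB = 0")
      case False
      obtain j B where jB: "jB = (j, B)" "\<bar>j\<bar> \<le> 2" "B\<^sup>2 \<le> 25 * \<bar>d\<bar>" using jB_in by (auto simp: JB_def BB_def)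
      have "j\<^sup>2 \<le> 4" using jB(2) abs_le_square_iff[of j 2] by simp
      hence "j\<^sup>2 * B\<^sup>2 \<le> 4 * (25 * \<bar>d\<bar>)" using jB(3) by (intro mult_mono) auto
      moreover have "0 \<le> j\<^sup>2 * B\<^sup>2" by simp
      ultimately have "\<bar>M jB\<bar> \<le> 104 * \<bar>d\<bar>" unfolding M_def jB(1) prod.case by linarith
      hence MD: "real (nat \<bar>M jB\<bar>) \<le> 104 * D" unfolding D_def by linarith
      have "real (card {A. M jB \<noteq> 0 \<and> A dvd M jB}) \<le> 2 * real (card {a::nat. a dvd nat \<bar>M jB\<bar>})"
        using card_int_divisors_le[of "M jB"] by linarith
      also have "\<dots> \<le> 2 * (C0 * real (nat \<bar>M jB\<bar>) powr \<eta>)" using C0(2)[of "nat \<bar>M jB\<bar>"] False by simp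
      also have "\<dots> \<le> 2 * (C0 * (104 * D) powr \<eta>)" using C0(1) MD \<eta> by (intro mult_left_mono powr_mono2) auto
      finally show ?thesis using D1 by (simp add: powr_mult mult_ac)
    qed (use C0 in simp)
    have codes_eq: "ideal_codes d l = {u. real_of_int \<bar>u\<bar> \<le> R} \<times> (SIGMA jB : JB. {A. M jB \<noteq> 0 \<and> A dvd M jB})"
      unfolding ideal_codes_def R_def D_def JB_def BB_def M_def by auto
    have "real (card (SIGMA jB : JB. {A. M jB \<noteq> 0 \<and> A dvd M jB})) = (\<Sum>jB\<in>JB. real (card {A. M jB \<noteq> 0 \<and> A dvd M jB}))"
    proof -
      have "finite {A. M jB \<noteq> 0 \<and> A dvd M jB}" for jB by (cases "M jB = 0") (auto intro: finite_divisors_int)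
      thus ?thesis using finJB by (subst card_SigmaI) auto
    qed
    also have "\<dots> \<le> (\<Sum>jB\<in>JB. 2 * C0 * 104 powr \<eta> * D powr \<eta>)" using cA by (rule sum_mono)
    also have "\<dots> = 5 * real (card BB) * (2 * C0 * 104 powr \<eta> * D powr \<eta>)" by (simp add: JB_def card_cartesian_product)
    also have "\<dots> \<le> 5 * (11 * sqrt D) * (2 * C0 * 104 powr \<eta> * D powr \<eta>)"
      using cB C0 by (intro mult_right_mono mult_left_mono) auto
    finally have cS: "real (card (SIGMA jB : JB. {A. M jB \<noteq> 0 \<and> A dvd M jB})) \<le> 5 * (11 * sqrt D) * (2 * C0 * 104 powr \<eta> * D powr \<eta>)" .
    have "real (card (ideal_codes d l)) \<le> (C1 * D powr \<eta>) * (5 * (11 * sqrt D) * (2 * C0 * 104 powr \<eta> * D powr \<eta>))"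
      unfolding codes_eq card_cartesian_product of_nat_mult using cU cS C1 by (intro mult_mono) auto
    also have "\<dots> = C * (sqrt D * (D powr \<eta> * D powr \<eta>))" by (simp add: C_def)
    also have "sqrt D * (D powr \<eta> * D powr \<eta>) = D powr (1 / 2 + \<epsilon>)"
      using D1 by (simp add: powr_add[symmetric] powr_half_sqrt[symmetric] \<eta>_def)
    finally show ?thesis unfolding D_def .
  qed
  thus ?thesis using C by blast
qed

text \<open>The prime counting bound at n = Y div 2 already gives order Y / log Y; a small power of
  \<open>Y\<close> absorbs the logarithm, the rounding and the prime 2.\<close>

lemma odd_primes_lower:
  fixes \<eta> :: real assumes "\<eta> > 0"
  shows "\<exists>Y0. \<forall>Y::nat\<ge>Y0. real Y powr (1 - \<eta>) \<le> real (card {p. prime p \<and> odd p \<and> p \<le> Y})"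
proof -
  have "eventually (\<lambda>y::real. y powr (1 - \<eta>) \<le> (y / 2 - 1) * ln 2 / ln y - 1) at_top"
    using assms by real_asymp
  then obtain y0 where y0: "\<And>y. y \<ge> y0 \<Longrightarrow> y powr (1 - \<eta>) \<le> (y / 2 - 1) * ln 2 / ln y - 1"
    by (auto simp: eventually_at_top_linorder)
  have "real Y powr (1 - \<eta>) \<le> real (card {p. prime p \<and> odd p \<and> p \<le> Y})" if Y: "Y \<ge> max 4 (nat \<lceil>y0\<rceil>)" for Y :: nat
  proof -
    define n where "n = Y div 2"
    let ?Q = "{p. prime p \<and> odd p \<and> p \<le> Y}"
    have Y4: "Y \<ge> 4" using Y by simp
    have "real Y \<ge> y0" using Y by linarith
    have n1: "n \<ge> 1" "2 * n \<le> Y" "real n \<ge> real Y / 2 - 1" using Y4 unfolding n_def by linarith+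
    have finQ: "finite ?Q" by (rule finite_subset[of _ "{..Y}"]) auto
    have "{p. prime p \<and> p \<le> 2 * n} \<subseteq> insert 2 ?Q"
    proof
      fix p assume "p \<in> {p. prime p \<and> p \<le> 2 * n}"
      hence "prime p" "p \<le> Y" using n1 by auto
      thus "p \<in> insert 2 ?Q" using prime_odd_nat[of p] prime_ge_2_nat[of p] by (cases "p = 2") auto
    qed
    hence "card {p. prime p \<and> p \<le> 2 * n} \<le> card (insert 2 ?Q)" using finQ by (intro card_mono) auto
    also have "\<dots> \<le> card ?Q + 1" using finQ by (simp add: card_insert_if)
    finally have c: "real (card {p. prime p \<and> p \<le> 2 * n}) \<le> real (card ?Q) + 1" by simp
    have lnY: "ln (real Y) > 0" using Y4 by simp
    have "real n * ln 2 \<le> real (card {p. prime p \<and> p \<le> 2 * n}) * ln (2 * real n)" using prime_counting_lower[OF n1(1)] .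
    also have "\<dots> \<le> (real (card ?Q) + 1) * ln (real Y)"
    proof (intro mult_mono c)
      have "2 * real n \<le> real Y" using n1(2) by linarith
      thus "ln (2 * real n) \<le> ln (real Y)" using n1(1) by (intro ln_mono) auto
    qed (use n1 in auto)
    finally have nl: "real n * ln 2 \<le> (real (card ?Q) + 1) * ln (real Y)" .
    have "(real Y / 2 - 1) * ln 2 \<le> real n * ln 2" by (rule mult_right_mono[OF n1(3)]) simp
    with nl have "(real Y / 2 - 1) * ln 2 \<le> (real (card ?Q) + 1) * ln (real Y)" by linarith
    hence "(real Y / 2 - 1) * ln 2 / ln (real Y) \<le> real (card ?Q) + 1" using lnY by (simp add: field_simps)
    thus ?thesis using y0[OF \<open>real Y \<ge> y0\<close>] by linarith
  qed
  thus ?thesis by blast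
qed

lemma card_prime_divisors_le_log:
  fixes n :: nat assumes "n > 0"
  shows "2 ^ card {p. prime p \<and> p dvd n} \<le> n"
proof -
  have "(2::nat) ^ card {p. prime p \<and> p dvd n} = (\<Prod>p\<in>prime_factors n. 2)"
    using assms by (simp add: prime_factors_dvd)
  also have "\<dots> \<le> (\<Prod>p\<in>prime_factors n. p ^ multiplicity p n)"
  proof (intro prod_mono conjI)
    fix p assume p: "p \<in> prime_factors n"
    hence pp: "prime p" "p dvd n" by (auto simp: prime_factors_dvd)
    have p2: "p \<ge> 2" using prime_ge_2_nat[OF pp(1)] .
    have "p ^ 1 dvd n" using pp(2) by simp
    hence "1 \<le> multiplicity p n" using assms p2 by (intro multiplicity_geI) auto
    hence "p ^ 1 \<le> p ^ multiplicity p n" using p2 by (intro power_increasing) auto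
    thus "2 \<le> p ^ multiplicity p n" using p2 by simp
  qed simp
  also have "\<dots> = n" using assms prod_prime_factors[of n] by simp
  finally show ?thesis .
qed

text \<open>Splitting off the sign and a possible factor 2 leaves an odd positive number, to which
  reciprocity applies.\<close>

lemma squarefree_decompose_unit_2:
  fixes d :: int assumes "squarefree d"
  shows "\<exists>u e. u \<in> {1, -1, 2, -2} \<and> odd e \<and> squarefree e \<and> d = u * int e \<and> e \<le> nat \<bar>d\<bar>"
proof -
  have d0: "d \<noteq> 0" using assms by auto
  define n where "n = nat \<bar>d\<bar>"
  have sn: "squarefree n"
  proof (rule squarefreeI)
    fix y assume "y\<^sup>2 dvd n"
    hence "int (y\<^sup>2) dvd int n" by (simp only: int_dvd_int_iff)
    hence "(int y)\<^sup>2 dvd d" by (simp add: n_def)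
    hence "int y dvd 1" using assms by (rule squarefreeD[rotated])
    thus "y dvd 1" by simp
  qed
  define \<sigma> :: int where "\<sigma> = (if d \<ge> 0 then 1 else -1)"
  have dn: "d = \<sigma> * int n" by (auto simp: \<sigma>_def n_def)
  have s1: "\<sigma> \<in> {1, -1, 2, -2}" "2 * \<sigma> \<in> {1, -1, 2, -2}" by (simp_all add: \<sigma>_def)
  have nle: "n \<le> nat \<bar>d\<bar>" by (simp add: n_def)
  show ?thesis
  proof (cases "odd n")
    case True
    thus ?thesis using sn dn s1(1) nle by blast
  next
    case False
    then obtain e where e: "n = 2 * e" by blast
    have "odd e"
    proof
      assume "even e"
      hence "2\<^sup>2 dvd n" unfolding e by auto
      hence "(2::nat) dvd 1" using sn by (rule squarefreeD[rotated])
      thus False by simp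
    qed
    moreover have "squarefree e" using sn unfolding e by (rule squarefree_multD)
    moreover have "e \<le> nat \<bar>d\<bar>" using e by (simp add: n_def[symmetric])
    moreover have "d = (2 * \<sigma>) * int e" using dn e by simp
    ultimately show ?thesis using s1(2) by blast
  qed
qed

text \<open>With S, R and P the numbers of split, ramified and all odd primes up to
  \<open>Y\<close>, the sum is 2S + R - P. Now 2S < P/4 and R <= P/2, so it is below -P/4.\<close>

lemma Legendre_sum_biased:
  fixes d :: int
  assumes d0: "d \<noteq> 0" and few: "8 * card (split_primes d Y) < card {p. prime p \<and> odd p \<and> p \<le> Y}"
    and ram: "2 * card {p. prime p \<and> p dvd nat \<bar>d\<bar>} \<le> card {p. prime p \<and> odd p \<and> p \<le> Y}"
  shows "real (card {p. prime p \<and> odd p \<and> p \<le> Y})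
    \<le> 4 * \<bar>\<Sum>p\<in>{p. prime p \<and> odd p \<and> p \<le> Y}. real_of_int (Legendre d (int p))\<bar>"
proof -
  let ?P = "{p. prime p \<and> odd p \<and> p \<le> Y}"
  let ?R = "{p \<in> ?P. Legendre d (int p) = 0}"
  let ?S = "split_primes d Y"
  have finP: "finite ?P" by (rule finite_subset[of _ "{..Y}"]) auto
  have finD: "finite {p. prime p \<and> p dvd nat \<bar>d\<bar>}"
    by (rule finite_subset[OF _ finite_divisors_nat[of "nat \<bar>d\<bar>"]]) (use d0 in auto)
  have "?R \<subseteq> {p. prime p \<and> p dvd nat \<bar>d\<bar>}"
  proof
    fix p assume p: "p \<in> ?R"
    hence "[d = 0] (mod int p)" by (auto simp: Legendre_def split: if_splits)
    hence "int p dvd \<bar>d\<bar>" by (simp add: cong_0_iff)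
    hence "p dvd nat \<bar>d\<bar>" by (metis abs_ge_zero int_dvd_int_iff int_nat_eq)
    thus "p \<in> {p. prime p \<and> p dvd nat \<bar>d\<bar>}" using p by simp
  qed
  hence cR: "card ?R \<le> card {p. prime p \<and> p dvd nat \<bar>d\<bar>}" using finD by (intro card_mono)
  have S: "?S = {p \<in> ?P. Legendre d (int p) = 1}" by (auto simp: split_primes_def)
  have "(\<Sum>p\<in>?P. Legendre d (int p)) = (\<Sum>p\<in>?P. 2 * (if Legendre d (int p) = 1 then 1 else 0) + (if Legendre d (int p) = 0 then 1 else 0) - 1)"
  proof (rule sum.cong[OF refl])
    fix p show "Legendre d (int p) = 2 * (if Legendre d (int p) = 1 then 1 else 0) + (if Legendre d (int p) = 0 then 1 else 0) - 1"
      using Legendre_values[of d "int p"] by auto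
  qed
  also have "\<dots> = 2 * int (card ?S) + int (card ?R) - int (card ?P)"
    using finP by (simp add: sum_subtractf sum.distrib sum_distrib_left[symmetric] S sum.If_cases Int_def)
  finally have "(\<Sum>p\<in>?P. Legendre d (int p)) = 2 * int (card ?S) + int (card ?R) - int (card ?P)" .
  hence "int (card ?P) \<le> 4 * \<bar>\<Sum>p\<in>?P. Legendre d (int p)\<bar>" using few cR ram by linarith
  hence "real_of_int (int (card ?P)) \<le> real_of_int (4 * \<bar>\<Sum>p\<in>?P. Legendre d (int p)\<bar>)" by (simp only: of_int_le_iff)
  thus ?thesis by simp
qed

lemma few_split_primes_rare:
  fixes \<delta> \<epsilon> :: real
  assumes \<delta>: "\<delta> > 0" and \<epsilon>: "\<epsilon> > 0"
  shows "\<exists>C x0. C > 0 \<and> (\<forall>x\<ge>x0. \<forall>Y::nat. x powr \<delta> \<le> real Y \<longrightarrow> real Y \<le> x \<longrightarrow>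
    real (card {d. squarefree d \<and> \<bar>real_of_int d\<bar> \<le> x \<and> 8 * real (card (split_primes d Y)) < real Y powr (1 - \<epsilon>)}) \<le> C * x powr \<epsilon>)"
proof -
  \<comment> \<open>Makes the even number \<open>m = 2 * h\<close> so large that m \<delta> / 2 >=
    3. As there are at least Y^(1/2) odd primes, their number to the power \<open>m\<close> then
    exceeds x^3, which dominates the off-diagonal term of order x^2.\<close>
  define h where "h = nat \<lceil>6 / \<delta>\<rceil> + 1"
  define m where "m = 2 * h"
  have m: "even m" "m > 0" by (simp_all add: m_def h_def)
  have m\<delta>: "real m * \<delta> / 2 \<ge> 3"
  proof -
    have "real h \<ge> 6 / \<delta>" unfolding h_def by linarith
    hence "real h * \<delta> \<ge> 6" using \<delta> by (simp add: field_simps)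
    thus ?thesis by (simp add: m_def)
  qed
  \<comment> \<open>The loss in the prime count is raised to the power \<open>m\<close>, hence the
    bound \<epsilon>/m; the bound 1/2 serves the estimate \<open>half\<close>.\<close>
  define \<eta> where "\<eta> = min (1 / 2) (min \<epsilon> (\<epsilon> / real m))"
  have \<eta>: "\<eta> > 0" "\<eta> \<le> 1 / 2" "\<eta> \<le> \<epsilon>" "\<eta> * real m \<le> \<epsilon>"
  proof -
    show "\<eta> > 0" "\<eta> \<le> 1 / 2" "\<eta> \<le> \<epsilon>" using \<epsilon> m by (auto simp: \<eta>_def)
    have "\<eta> \<le> \<epsilon> / real m" by (simp add: \<eta>_def)
    thus "\<eta> * real m \<le> \<epsilon>" using m by (simp add: field_simps)
  qed
  obtain Y0 where Y0: "\<And>Y::nat. Y \<ge> Y0 \<Longrightarrow> real Y powr (1 - \<eta>) \<le> real (card {p. prime p \<and> odd p \<and> p \<le> Y})"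
    using odd_primes_lower[OF \<eta>(1)] by blast
  define c where "c = (16 * real m) ^ m"
  have c1: "c \<ge> 1" unfolding c_def using m by (intro one_le_power) auto
  have "eventually (\<lambda>x::real. x \<ge> 2 \<and> x powr \<delta> \<ge> real Y0 \<and> x powr \<delta> \<ge> 1 \<and> x \<ge> 2 * c \<and> 2 * (ln x / ln 2) \<le> (x powr \<delta>) powr (1 / 2)) at_top"
    using \<delta> by (intro eventually_conj; real_asymp)
  then obtain x0 where x0: "\<And>x. x \<ge> x0 \<Longrightarrow> x \<ge> 2 \<and> x powr \<delta> \<ge> real Y0 \<and> x powr \<delta> \<ge> 1 \<and> x \<ge> 2 * c \<and> 2 * (ln x / ln 2) \<le> (x powr \<delta>) powr (1 / 2)"
    by (auto simp: eventually_at_top_linorder)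
  have "real (card {d. squarefree d \<and> \<bar>real_of_int d\<bar> \<le> x \<and> 8 * real (card (split_primes d Y)) < real Y powr (1 - \<epsilon>)}) \<le> (16 * c) * x powr \<epsilon>"
    if x: "x \<ge> x0" and Y: "x powr \<delta> \<le> real Y" "real Y \<le> x" for x and Y :: nat
  proof -
    let ?P = "{p. prime p \<and> odd p \<and> p \<le> Y}"
    let ?E = "{d. squarefree d \<and> \<bar>real_of_int d\<bar> \<le> x \<and> 8 * real (card (split_primes d Y)) < real Y powr (1 - \<epsilon>)}"
    note X = x0[OF x]
    have finP: "finite ?P" by (rule finite_subset[of _ "{..Y}"]) auto
    have Y1: "real Y \<ge> 1" using X Y by linarith
    have "Y \<ge> Y0" using X Y by linarith
    hence P: "real Y powr (1 - \<eta>) \<le> real (card ?P)" by (rule Y0)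
    have PY: "real Y powr (1 - \<epsilon>) \<le> real (card ?P)" using P powr_mono[of "1 - \<epsilon>" "1 - \<eta>" "real Y"] \<eta> Y1 by linarith
    have P0: "real (card ?P) > 0" using P Y1 by (smt (verit) powr_gt_zero)
    have half: "(x powr \<delta>) powr (1 / 2) \<le> real (card ?P)"
    proof -
      have "(x powr \<delta>) powr (1 / 2) \<le> real Y powr (1 / 2)" using Y by (intro powr_mono2) auto
      also have "\<dots> \<le> real Y powr (1 - \<eta>)" using \<eta> Y1 by (intro powr_mono) auto
      finally show ?thesis using P by linarith
    qed
    define Z where "Z = nat \<lfloor>x\<rfloor>"
    have Z: "real Z \<le> x" using X by (simp add: Z_def)
    have big: "2 * (16 * real m) ^ m * real Z ^ 2 \<le> real (card ?P) ^ m"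
    proof -
      have "2 * c * real Z ^ 2 \<le> x * x ^ 2" using X Z by (intro mult_mono power_mono) auto
      also have "\<dots> = x powr 3" using X by (simp add: powr_numeral power2_eq_square power3_eq_cube)
      also have "\<dots> \<le> x powr (real m * \<delta> / 2)" using X m\<delta> by (intro powr_mono) auto
      also have "\<dots> = ((x powr \<delta>) powr (1 / 2)) ^ m" using X by (simp add: powr_powr powr_realpow[symmetric] mult_ac)
      also have "\<dots> \<le> real (card ?P) ^ m" using half by (intro power_mono) auto
      finally show ?thesis by (simp add: c_def)
    qed
    \<comment> \<open>Eight classes, given by four unit parts \<open>u\<close> and two odd residues
      modulo 4. Each has at most \<open>2 * c * x powr \<epsilon>\<close> elements, which accounts
      for the 16.\<close>
    define Ef where "Ef u r = {e::nat. odd e \<and> squarefree e \<and> e mod 4 = r \<and> e \<le> Z \<and> u * int e \<in> ?E}" for u :: int and r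
    have finEf: "finite (Ef u r)" for u r by (rule finite_subset[of _ "{..Z}"]) (auto simp: Ef_def)
    have ratio: "(real Y / real (card ?P)) ^ m \<le> x powr \<epsilon>"
    proof -
      have "real Y / real (card ?P) \<le> real Y / real Y powr (1 - \<eta>)" using P P0 Y1 by (intro divide_left_mono mult_pos_pos) auto
      also have "\<dots> = real Y powr \<eta>" using Y1 by (simp add: powr_diff)
      finally have "(real Y / real (card ?P)) ^ m \<le> (real Y powr \<eta>) ^ m" by (intro power_mono) auto
      also have "\<dots> = real Y powr (\<eta> * real m)" using Y1 by (simp add: powr_powr powr_realpow[symmetric])
      also have "\<dots> \<le> x powr (\<eta> * real m)" using Y \<eta> by (intro powr_mono2) auto
      also have "\<dots> \<le> x powr \<epsilon>" using X \<eta> by (intro powr_mono) auto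
      finally show ?thesis .
    qed
    have cEf: "real (card (Ef u r)) \<le> 2 * c * x powr \<epsilon>" if u: "u \<in> {1, -1, 2, -2}" for u r
    proof -
      have "real (card (Ef u r)) * real (card ?P) ^ m \<le> 2 * (16 * real m) ^ m * real Y ^ m"
      proof (rule card_few_split_primes_le[OF finEf _ u finP _ _ m big])
        show "odd e \<and> squarefree e \<and> e mod 4 = r \<and> e \<le> Z" if "e \<in> Ef u r" for e using that by (simp add: Ef_def)
        show "prime p \<and> odd p \<and> p \<le> Y" if "p \<in> ?P" for p using that by simp
        fix e assume e: "e \<in> Ef u r"
        hence d: "squarefree (u * int e)" "\<bar>real_of_int (u * int e)\<bar> \<le> x" "8 * real (card (split_primes (u * int e) Y)) < real Y powr (1 - \<epsilon>)"
          by (auto simp: Ef_def)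
        have d0: "u * int e \<noteq> 0" using d(1) by (metis not_squarefree_0)
        show "real (card ?P) \<le> 4 * \<bar>\<Sum>p\<in>?P. real_of_int (Legendre (u * int e) (int p))\<bar>"
        proof (rule Legendre_sum_biased[OF d0])
          show "8 * card (split_primes (u * int e) Y) < card ?P" using d(3) PY by linarith
          define n where "n = nat \<bar>u * int e\<bar>"
          have n0: "n > 0" using d0 by (simp add: n_def)
          have "real n \<le> x" using d(2) unfolding n_def by linarith
          moreover have "real (2 ^ card {p. prime p \<and> p dvd n}) \<le> real n"
            using card_prime_divisors_le_log[OF n0] by (rule of_nat_mono)
          ultimately have "real (2 ^ card {p. prime p \<and> p dvd n}) \<le> x" by linarith
          hence "2 ^ card {p. prime p \<and> p dvd n} \<le> x" by (simp only: of_nat_power of_nat_numeral)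
          hence "ln (2 ^ card {p. prime p \<and> p dvd n}) \<le> ln x" by (intro ln_mono) auto
          hence "real (card {p. prime p \<and> p dvd n}) * ln 2 \<le> ln x" by (simp add: ln_realpow)
          hence "real (card {p. prime p \<and> p dvd n}) \<le> ln x / ln 2" by (simp add: field_simps)
          hence "2 * real (card {p. prime p \<and> p dvd n}) \<le> real (card ?P)" using X half by linarith
          thus "2 * card {p. prime p \<and> p dvd nat \<bar>u * int e\<bar>} \<le> card ?P" unfolding n_def by linarith
        qed
      qed
      hence "real (card (Ef u r)) \<le> 2 * c * (real Y / real (card ?P)) ^ m"
        using P0 by (simp add: c_def power_divide field_simps)
      also have "\<dots> \<le> 2 * c * x powr \<epsilon>" using ratio c1 by (intro mult_left_mono) auto
      finally show ?thesis .
    qed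
    have sub: "?E \<subseteq> (\<Union>u\<in>{1, -1, 2, -2}. \<Union>r\<in>{1, 3}. (\<lambda>e. u * int e) ` Ef u r)"
    proof
      fix d assume d: "d \<in> ?E"
      then obtain u e where ue: "u \<in> {1, -1, 2, -2}" "odd e" "squarefree e" "d = u * int e" "e \<le> nat \<bar>d\<bar>"
        using squarefree_decompose_unit_2[of d] by blast
      have "\<bar>d\<bar> \<le> \<lfloor>x\<rfloor>" using d by (simp add: le_floor_iff)
      hence "e \<le> Z" using ue(5) unfolding Z_def by linarith
      hence "e \<in> Ef u (e mod 4)" unfolding Ef_def using ue d by blast
      moreover have "e mod 4 \<in> {1, 3}" using odd_mod_4[OF ue(2)] by blast
      ultimately show "d \<in> (\<Union>u\<in>{1, -1, 2, -2}. \<Union>r\<in>{1, 3}. (\<lambda>e. u * int e) ` Ef u r)"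
        using ue(1,4) by blast
    qed
    have img: "real (card ((\<lambda>e. u * int e) ` Ef u r)) \<le> 2 * c * x powr \<epsilon>" if "u \<in> {1, -1, 2, -2}" for u r
      using cEf[OF that, of r] card_image_le[OF finEf, of "\<lambda>e. u * int e" u r] by linarith
    have "card ?E \<le> card (\<Union>u\<in>{1, -1, 2, -2}. \<Union>r\<in>{1, 3}. (\<lambda>e. u * int e) ` Ef u r)"
      using sub finEf by (intro card_mono) auto
    also have "\<dots> \<le> (\<Sum>u\<in>{1, -1, 2, -2::int}. card (\<Union>r\<in>{1, 3}. (\<lambda>e. u * int e) ` Ef u r))"
      by (rule card_UN_le) simp
    also have "\<dots> \<le> (\<Sum>u\<in>{1, -1, 2, -2::int}. \<Sum>r\<in>{1, 3}. card ((\<lambda>e. u * int e) ` Ef u r))"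
      by (intro sum_mono card_UN_le) simp
    finally have "real (card ?E) \<le> (\<Sum>u\<in>{1, -1, 2, -2::int}. \<Sum>r\<in>{1, 3}. real (card ((\<lambda>e. u * int e) ` Ef u r)))"
      by (metis (mono_tags, lifting) of_nat_mono of_nat_sum sum.cong)
    also have "\<dots> \<le> (\<Sum>u\<in>{1, -1, 2, -2::int}. \<Sum>r\<in>{1, 3::nat}. 2 * c * x powr \<epsilon>)"
      using img by (intro sum_mono) auto
    also have "\<dots> = (16 * c) * x powr \<epsilon>" by simp
    finally show ?thesis .
  qed
  thus ?thesis using c1 by (intro exI[of _ "16 * c"] exI[of _ x0]) auto
qed

section \<open>Moments of torsion\<close>

definition discs_upto :: "real \<Rightarrow> int set" where
  "discs_upto x = {d. squarefree d \<and> d \<noteq> 1 \<and> \<bar>real_of_int d\<bar> \<le> x}"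

lemma discs_upto_abs: "discs_upto x \<subseteq> {u. real_of_int \<bar>u\<bar> \<le> x}"
  by (auto simp: discs_upto_def)

lemma finite_discs_upto: "finite (discs_upto x)"
proof (cases "x \<ge> 0")
  case True
  thus ?thesis using finite_subset[OF discs_upto_abs] card_int_abs_le(1) by blast
next
  case False
  hence "discs_upto x = {}" by (auto simp: discs_upto_def)
  thus ?thesis by simp
qed

lemma card_discs_upto: assumes "x \<ge> 0" shows "real (card (discs_upto x)) \<le> 2 * x + 1"
  using card_mono[OF card_int_abs_le(1)[OF assms] discs_upto_abs] card_int_abs_le(2)[OF assms] by linarith

lemma quadratic_fields_upto_subset: "quadratic_fields_upto x \<subseteq> quad_set ` discs_upto x"
proof
  fix L assume "L \<in> quadratic_fields_upto x"
  hence L: "quadratic_field L" "abs_disc L \<le> x" by (auto simp: quadratic_fields_upto_def)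
  obtain d where d: "squarefree d" "d \<noteq> 1" "L = quad_set d" using quadratic_field_imp_quad_set[OF L(1)] by blast
  interpret quad d by unfold_locales (use d in auto)
  have "\<bar>real_of_int d\<bar> \<le> abs_disc L" unfolding d(3) by (rule abs_disc_ge)
  hence "\<bar>real_of_int d\<bar> \<le> x" using L(2) by linarith
  thus "L \<in> quad_set ` discs_upto x" using d by (auto simp: discs_upto_def)
qed

text \<open>Each \<open>d\<close> without an exceptional shortage of split primes is assigned to the
  first level i at which it is bad. At most about x^(i/J) indices reach level i, and not being bad
  at level i - 1 saves a factor of almost x^((i-1)/(J L)), with L = l + 2.\<close>

lemma torsion_moment_large:
  fixes \<epsilon> k :: real and l :: nat
  assumes \<epsilon>: "\<epsilon> > 0" and k: "k \<ge> 0" and l: "l \<ge> 1"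
  shows "\<exists>C x0. C > 0 \<and> (\<forall>x\<ge>x0. (\<Sum>d\<in>discs_upto x. real (card (class_group_torsion (quad_set d) l)) powr k)
    \<le> C * x powr (k / 2 + 1 - min 1 (k / (real l + 2)) + \<epsilon>))"
proof -
  define L where "L = real l + 2"
  have L: "L \<ge> 3" using l by (simp add: L_def)
  define E where "E = k / 2 + 1 - min 1 (k / L) + \<epsilon>"
  \<comment> \<open>Neighbouring levels differ by 1/J in the exponent of the count; this loss is to
    be at most \<epsilon>/2.\<close>
  define J where "J = nat \<lceil>2 / \<epsilon>\<rceil> + 1"
  have J: "J \<ge> 1" by (simp add: J_def)
  have J\<epsilon>: "1 / real J \<le> \<epsilon> / 2"
  proof -
    have "2 / \<epsilon> \<le> real J" unfolding J_def by linarith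
    thus ?thesis using \<epsilon> J by (simp add: field_simps)
  qed
  define \<epsilon>1 where "\<epsilon>1 = min (1 / 2) (\<epsilon> / (4 * (1 + k)))"
  have \<epsilon>1: "\<epsilon>1 > 0" "\<epsilon>1 \<le> 1 / 2" "\<epsilon>1 + k * \<epsilon>1 \<le> \<epsilon> / 4"
  proof -
    show "\<epsilon>1 > 0" using \<epsilon> k by (simp add: \<epsilon>1_def)
    show "\<epsilon>1 \<le> 1 / 2" unfolding \<epsilon>1_def by (rule min.cobounded1)
    have "\<epsilon>1 \<le> \<epsilon> / (4 * (1 + k))" by (simp add: \<epsilon>1_def)
    thus "\<epsilon>1 + k * \<epsilon>1 \<le> \<epsilon> / 4" using k by (simp add: field_simps)
  qed
  have k\<epsilon>1: "2 * (k * \<epsilon>1) \<le> \<epsilon> / 2" using \<epsilon>1 by linarith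
  obtain C1 where C1: "C1 > 0" "\<And>d. d \<noteq> 0 \<Longrightarrow> real (card (ideal_codes d l)) \<le> C1 * \<bar>real_of_int d\<bar> powr (1 / 2 + \<epsilon>1)"
    using card_ideal_codes_le[OF \<epsilon>1(1)] by blast
  define \<delta> where "\<delta> = 1 / (real J * L)"
  have \<delta>: "\<delta> > 0" using J L by (simp add: \<delta>_def)
  have J\<delta>: "real J * \<delta> = 1 / L" using J L by (simp add: \<delta>_def)
  obtain Cf x1 where Cf: "Cf > 0" "\<And>x Y. x \<ge> x1 \<Longrightarrow> x powr \<delta> \<le> real Y \<Longrightarrow> real Y \<le> x \<Longrightarrow>
    real (card {d. squarefree d \<and> \<bar>real_of_int d\<bar> \<le> x \<and> 8 * real (card (split_primes d Y)) < real Y powr (1 - \<epsilon>1)}) \<le> Cf * x powr \<epsilon>1"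
    using few_split_primes_rare[OF \<delta> \<epsilon>1(1)] by blast
  define cB where "cB = 18 * (2::real) ^ (l + 2)"
  have cB: "cB \<ge> 18"
  proof -
    have "(1::real) \<le> 2 ^ (l + 2)" by (rule one_le_power) simp
    thus ?thesis unfolding cB_def by linarith
  qed
  define C where "C = real J * (Cf * C1 powr k) + (real J + 1) * (cB * (8 * C1) powr k)"
  have C: "C > 0" unfolding C_def using Cf C1 cB J by (intro add_pos_pos mult_pos_pos) auto
  have "(\<Sum>d\<in>discs_upto x. real (card (class_group_torsion (quad_set d) l)) powr k) \<le> C * x powr E"
    if xx: "x \<ge> max x1 4" for x
  proof -
    have x: "x \<ge> x1" "x \<ge> 4" using xx by auto
    let ?D = "discs_upto x"
    let ?t = "\<lambda>d. real (card (class_group_torsion (quad_set d) l))"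
    define Y where "Y i = nat \<lceil>x powr (real i * \<delta>)\<rceil>" for i :: nat
    have Ylow: "x powr (real i * \<delta>) \<le> real (Y i)" for i unfolding Y_def by linarith
    have Yup1: "real (Y i) \<le> x powr (real i * \<delta>) + 1" for i
    proof -
      have "x powr (real i * \<delta>) \<ge> 0" by simp
      thus ?thesis unfolding Y_def by linarith
    qed
    have xge1: "x powr (real i * \<delta>) \<ge> 1" for i using x \<delta> by (intro ge_one_powr_ge_zero) auto
    have Yup: "real (Y i) \<le> 2 * x powr (real i * \<delta>)" for i using Yup1[of i] xge1[of i] by linarith
    have Y1: "Y i \<ge> 1" for i using Ylow[of i] xge1[of i] by linarith
    \<comment> \<open>The top level is about x^(1/L) with L >= 3, so sqrt x + 1 is an upper bound,
      and it is at most \<open>x\<close> because \<open>x\<close> is at least 4.\<close>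
    have Yx: "real (Y i) \<le> x" if "i \<le> J" for i
    proof -
      have "real i * \<delta> \<le> real J * \<delta>" using that \<delta> by simp
      also have "\<dots> \<le> 1 / 2" unfolding J\<delta> using L by (simp add: field_simps)
      finally have "x powr (real i * \<delta>) \<le> x powr (1 / 2)" using x by (intro powr_mono) auto
      also have "\<dots> = sqrt x" using x by (simp add: powr_half_sqrt)
      finally have "real (Y i) \<le> sqrt x + 1" using Yup1[of i] by linarith
      moreover have "sqrt x \<ge> 2" using x real_sqrt_le_mono[of 4 x] by simp
      hence "sqrt x * 2 \<le> sqrt x * sqrt x" by (rule mult_left_mono) (use x in simp)
      hence "2 * sqrt x \<le> x" using x by simp
      ultimately show ?thesis using \<open>sqrt x \<ge> 2\<close> by linarith
    qed
    define Ex where "Ex i = {d. squarefree d \<and> \<bar>real_of_int d\<bar> \<le> x \<and> 8 * real (card (split_primes d (Y i))) < real (Y i) powr (1 - \<epsilon>1)}" for i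
    \<comment> \<open>Level \<open>J + 1\<close> contains every \<open>d\<close>, so a first bad
      level always exists.\<close>
    define Ba where "Ba i = {d. i = J + 1 \<or> bad_disc l (Y i) d}" for i
    define M0 where "M0 = (C1 * x powr (1 / 2 + \<epsilon>1)) powr k"
    define M where "M i = (8 * C1 * x powr (1 / 2 + 2 * \<epsilon>1 - real (i - 1) * \<delta>)) powr k" for i :: nat
    have cEx: "real (card (?D \<inter> Ex i)) \<le> Cf * x powr \<epsilon>1" if i: "i \<in> {1..J}" for i
    proof -
      have "x powr \<delta> \<le> x powr (real i * \<delta>)" using x \<delta> i by (intro powr_mono) auto
      hence "x powr \<delta> \<le> real (Y i)" using Ylow[of i] by linarith
      hence c: "real (card (Ex i)) \<le> Cf * x powr \<epsilon>1" unfolding Ex_def using Cf(2)[OF x(1)] Yx i by auto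
      have "Ex i \<subseteq> {u. real_of_int \<bar>u\<bar> \<le> x}" by (auto simp: Ex_def)
      hence "finite (Ex i)" using finite_subset card_int_abs_le(1)[of x] x by auto
      hence "card (?D \<inter> Ex i) \<le> card (Ex i)" by (intro card_mono) auto
      thus ?thesis using c by linarith
    qed
    have cBa: "real (card (?D \<inter> Ba i)) \<le> cB * x powr (real (min i J) / real J)" if i: "i \<in> {1..J + 1}" for i
    proof (cases "i = J + 1")
      case True
      have "card (?D \<inter> Ba i) \<le> card ?D" using finite_discs_upto by (intro card_mono) auto
      hence "real (card (?D \<inter> Ba i)) \<le> 2 * x + 1" using card_discs_upto[of x] x by linarith
      also have "\<dots> \<le> cB * x" using cB x mult_right_mono[of 18 cB x] by linarith
      finally show ?thesis using True J x by simp
    next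
      case False
      hence iJ: "min i J = i" using i by auto
      have "?D \<inter> Ba i \<subseteq> {d. squarefree d \<and> bad_disc l (Y i) d}" using False by (auto simp: Ba_def discs_upto_def)
      hence "card (?D \<inter> Ba i) \<le> card {d. squarefree d \<and> bad_disc l (Y i) d}" using card_bad_disc(1)[OF Y1] by (intro card_mono)
      also have "\<dots> \<le> 18 * Y i ^ (l + 2)" using card_bad_disc(2)[OF Y1] .
      finally have "real (card (?D \<inter> Ba i)) \<le> real (18 * Y i ^ (l + 2))" by (rule of_nat_mono)
      also have "\<dots> = 18 * real (Y i) ^ (l + 2)" by simp
      also have "\<dots> \<le> 18 * (2 * x powr (real i * \<delta>)) ^ (l + 2)" using Yup[of i] by (intro mult_left_mono power_mono) auto
      also have "\<dots> = cB * (x powr (real i * \<delta>)) ^ (l + 2)" unfolding cB_def power_mult_distrib by (simp only: mult.assoc)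
      also have "(x powr (real i * \<delta>)) ^ (l + 2) = (x powr (real i * \<delta>)) powr real (l + 2)"
        by (rule powr_realpow[symmetric]) (use x in simp)
      also have "\<dots> = x powr (real i * \<delta> * real (l + 2))" by (rule powr_powr)
      also have "real i * \<delta> * real (l + 2) = real i / real J"
      proof -
        have "real (l + 2) = L" by (simp add: L_def)
        thus ?thesis using L J by (simp add: \<delta>_def)
      qed
      finally show ?thesis unfolding iJ .
    qed
    have pt: "?t d powr k \<le> (\<Sum>i\<in>{1..J}. if d \<in> Ex i then M0 else 0) + (\<Sum>i\<in>{1..J + 1}. if d \<in> Ba i then M i else 0)"
      if d: "d \<in> ?D" for d
    proof -
      have dd: "squarefree d" "d \<noteq> 1" "\<bar>real_of_int d\<bar> \<le> x" using d by (auto simp: discs_upto_def)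
      interpret quad d by unfold_locales (use dd in auto)
      have codes: "real (card (ideal_codes d l)) \<le> C1 * x powr (1 / 2 + \<epsilon>1)"
      proof -
        have "\<bar>real_of_int d\<bar> powr (1 / 2 + \<epsilon>1) \<le> x powr (1 / 2 + \<epsilon>1)" using dd(3) \<epsilon>1 by (intro powr_mono2) auto
        hence "C1 * \<bar>real_of_int d\<bar> powr (1 / 2 + \<epsilon>1) \<le> C1 * x powr (1 / 2 + \<epsilon>1)" using C1(1) by simp
        thus ?thesis using C1(2)[OF d0] by linarith
      qed
      have triv: "?t d \<le> C1 * x powr (1 / 2 + \<epsilon>1)" using torsion_card_le_codes(2)[OF l] codes by linarith
      have s1: "(\<Sum>i\<in>{1..J}. if d \<in> Ex i then M0 else 0) \<ge> 0" by (intro sum_nonneg) (simp add: M0_def)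
      have s2: "(\<Sum>i\<in>{1..J + 1}. if d \<in> Ba i then M i else 0) \<ge> 0" by (intro sum_nonneg) (simp add: M_def)
      show ?thesis
      proof (cases "\<exists>i\<in>{1..J}. d \<in> Ex i")
        case True
        then obtain i where i: "i \<in> {1..J}" "d \<in> Ex i" by blast
        have "?t d powr k \<le> M0" unfolding M0_def using triv k by (intro powr_mono2) auto
        also have "M0 = (if d \<in> Ex i then M0 else 0)" using i by simp
        also have "\<dots> \<le> (\<Sum>i\<in>{1..J}. if d \<in> Ex i then M0 else 0)"
          using i(1) by (intro member_le_sum) (auto simp: M0_def)
        finally show ?thesis using s2 by linarith
      next
        case False
        define i where "i = (LEAST i. i \<ge> 1 \<and> d \<in> Ba i)"
        have ex: "J + 1 \<ge> 1 \<and> d \<in> Ba (J + 1)" by (simp add: Ba_def)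
        have i: "i \<ge> 1" "d \<in> Ba i" "i \<le> J + 1"
          using LeastI[of "\<lambda>i. i \<ge> 1 \<and> d \<in> Ba i", OF ex] Least_le[of "\<lambda>i. i \<ge> 1 \<and> d \<in> Ba i", OF ex]
          unfolding i_def by blast+
        have imin: "d \<notin> Ba j" if "j \<ge> 1" "j < i" for j
          using not_less_Least[of j "\<lambda>i. i \<ge> 1 \<and> d \<in> Ba i"] that unfolding i_def by blast
        have "?t d \<le> 8 * C1 * x powr (1 / 2 + 2 * \<epsilon>1 - real (i - 1) * \<delta>)"
        proof (cases "i = 1")
          case True
          have "C1 * x powr (1 / 2 + \<epsilon>1) \<le> C1 * x powr (1 / 2 + 2 * \<epsilon>1)"
            using C1(1) x \<epsilon>1 by (intro mult_left_mono powr_mono) auto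
          moreover have "0 \<le> C1 * x powr (1 / 2 + 2 * \<epsilon>1)" using C1 by simp
          ultimately show ?thesis using triv True by simp
        next
          case False
          define j where "j = i - 1"
          have j: "j \<ge> 1" "j < i" "j \<in> {1..J}" using False i unfolding j_def by auto
          have nb: "\<not> bad_disc l (Y j) d" using imin[OF j(1,2)] by (simp add: Ba_def)
          have nE: "d \<notin> Ex j" using \<open>\<not> (\<exists>i\<in>{1..J}. d \<in> Ex i)\<close> j(3) by blast
          hence sp: "real (Y j) powr (1 - \<epsilon>1) \<le> 8 * real (card (split_primes d (Y j)))"
            using dd unfolding Ex_def by auto
          have "x powr (real j * \<delta> * (1 - \<epsilon>1)) = (x powr (real j * \<delta>)) powr (1 - \<epsilon>1)" by (simp add: powr_powr)
          also have "\<dots> \<le> real (Y j) powr (1 - \<epsilon>1)" using Ylow[of j] \<epsilon>1 by (intro powr_mono2) auto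
          also note sp
          finally have sp': "x powr (real j * \<delta> * (1 - \<epsilon>1)) \<le> 8 * real (card (split_primes d (Y j)))" .
          have "?t d * real (card (split_primes d (Y j))) \<le> C1 * x powr (1 / 2 + \<epsilon>1)"
          proof -
            have "real (card (class_group_torsion (quad_set d) l) * card (split_primes d (Y j))) \<le> real (card (ideal_codes d l))"
              using torsion_card_mult_split_primes[OF l nb] by (rule of_nat_mono)
            thus ?thesis using codes by simp
          qed
          moreover have "?t d * x powr (real j * \<delta> * (1 - \<epsilon>1)) \<le> ?t d * (8 * real (card (split_primes d (Y j))))"
            using sp' by (intro mult_left_mono) auto
          ultimately have "?t d * x powr (real j * \<delta> * (1 - \<epsilon>1)) \<le> 8 * C1 * x powr (1 / 2 + \<epsilon>1)" by linarith
          hence "?t d \<le> 8 * C1 * x powr (1 / 2 + \<epsilon>1) / x powr (real j * \<delta> * (1 - \<epsilon>1))"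
            using x by (simp add: pos_le_divide_eq)
          also have "\<dots> = 8 * C1 * x powr (1 / 2 + \<epsilon>1 - real j * \<delta> * (1 - \<epsilon>1))" by (simp add: powr_diff)
          \<comment> \<open>One \<epsilon>1 comes from the number of codes, the second from the
            missing \<epsilon>1 in the number of split primes.\<close>
          also have "\<dots> \<le> 8 * C1 * x powr (1 / 2 + 2 * \<epsilon>1 - real j * \<delta>)"
          proof (intro mult_left_mono powr_mono)
            have "real j * \<delta> \<le> real J * \<delta>" using j(3) \<delta> by simp
            also have "\<dots> \<le> 1" unfolding J\<delta> using L by (simp add: field_simps)
            finally have "real j * \<delta> * \<epsilon>1 \<le> 1 * \<epsilon>1" using \<epsilon>1 by (intro mult_right_mono) auto
            thus "1 / 2 + \<epsilon>1 - real j * \<delta> * (1 - \<epsilon>1) \<le> 1 / 2 + 2 * \<epsilon>1 - real j * \<delta>" by (simp add: algebra_simps)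
          qed (use x C1 in auto)
          finally show ?thesis unfolding j_def .
        qed
        hence "?t d powr k \<le> M i" unfolding M_def using k by (intro powr_mono2) auto
        also have "M i = (if d \<in> Ba i then M i else 0)" using i by simp
        also have "\<dots> \<le> (\<Sum>i\<in>{1..J + 1}. if d \<in> Ba i then M i else 0)"
          using i by (intro member_le_sum) (auto simp: M_def)
        finally show ?thesis using s1 by linarith
      qed
    qed
    have count: "(\<Sum>d\<in>?D. if d \<in> A then m else 0) = real (card (?D \<inter> A)) * m" for A and m :: real
      using finite_discs_upto by (simp add: sum.If_cases)
    have "(\<Sum>d\<in>?D. ?t d powr k) \<le> (\<Sum>d\<in>?D. (\<Sum>i\<in>{1..J}. if d \<in> Ex i then M0 else 0) + (\<Sum>i\<in>{1..J + 1}. if d \<in> Ba i then M i else 0))"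
      using pt by (rule sum_mono)
    also have "\<dots> = (\<Sum>i\<in>{1..J}. \<Sum>d\<in>?D. if d \<in> Ex i then M0 else 0) + (\<Sum>i\<in>{1..J + 1}. \<Sum>d\<in>?D. if d \<in> Ba i then M i else 0)"
      unfolding sum.distrib by (intro arg_cong2[of _ _ _ _ "(+)"] sum.swap)
    also have "\<dots> = (\<Sum>i\<in>{1..J}. real (card (?D \<inter> Ex i)) * M0) + (\<Sum>i\<in>{1..J + 1}. real (card (?D \<inter> Ba i)) * M i)"
      unfolding count ..
    also have "\<dots> \<le> (\<Sum>i\<in>{1..J}. Cf * C1 powr k * x powr E) + (\<Sum>i\<in>{1..J + 1}. cB * (8 * C1) powr k * x powr E)"
    proof (intro add_mono sum_mono)
      fix i assume i: "i \<in> {1..J}"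
      have "real (card (?D \<inter> Ex i)) * M0 \<le> Cf * x powr \<epsilon>1 * M0" using cEx[OF i] by (intro mult_right_mono) (auto simp: M0_def)
      also have "\<dots> = Cf * C1 powr k * (x powr \<epsilon>1 * x powr ((1 / 2 + \<epsilon>1) * k))"
        unfolding M0_def using C1 by (simp add: powr_mult powr_powr)
      also have "x powr \<epsilon>1 * x powr ((1 / 2 + \<epsilon>1) * k) = x powr (\<epsilon>1 + (1 / 2 + \<epsilon>1) * k)" by (simp add: powr_add)
      also have "Cf * C1 powr k * \<dots> \<le> Cf * C1 powr k * x powr E"
      proof (intro mult_left_mono powr_mono)
        have "\<epsilon>1 + (1 / 2 + \<epsilon>1) * k = k / 2 + (\<epsilon>1 + k * \<epsilon>1)" by (simp add: algebra_simps)
        thus "\<epsilon>1 + (1 / 2 + \<epsilon>1) * k \<le> E" using \<epsilon>1(3) \<epsilon> unfolding E_def by linarith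
      qed (use x Cf in auto)
      finally show "real (card (?D \<inter> Ex i)) * M0 \<le> Cf * C1 powr k * x powr E" .
    next
      fix i assume i: "i \<in> {1..J + 1}"
      define a where "a = real (i - 1) / real J"
      have a: "0 \<le> a" "a \<le> 1" using i J by (auto simp: a_def field_simps)
      have "real (card (?D \<inter> Ba i)) * M i \<le> cB * x powr (real (min i J) / real J) * M i"
        using cBa[OF i] by (intro mult_right_mono) (auto simp: M_def)
      also have "\<dots> = cB * (8 * C1) powr k * (x powr (real (min i J) / real J) * x powr ((1 / 2 + 2 * \<epsilon>1 - real (i - 1) * \<delta>) * k))"
        unfolding M_def using C1 by (simp add: powr_mult powr_powr)
      also have "x powr (real (min i J) / real J) * x powr ((1 / 2 + 2 * \<epsilon>1 - real (i - 1) * \<delta>) * k)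
          = x powr (real (min i J) / real J + (1 / 2 + 2 * \<epsilon>1 - real (i - 1) * \<delta>) * k)" by (simp add: powr_add)
      also have "cB * (8 * C1) powr k * \<dots> \<le> cB * (8 * C1) powr k * x powr E"
      proof (intro mult_left_mono powr_mono)
        have "real (min i J) \<le> real (i - 1) + 1" using i by linarith
        hence "real (min i J) / real J \<le> (real (i - 1) + 1) / real J" using J by (intro divide_right_mono) auto
        hence e1: "real (min i J) / real J \<le> a + 1 / real J" by (simp add: a_def add_divide_distrib)
        have e2: "real (i - 1) * \<delta> * k = a * (k / L)" by (simp add: a_def \<delta>_def)
        \<comment> \<open>The exponent is linear in the position a of the level in [0, 1]; its
          maximum, at a = 1 or a = 0 according to the sign of 1 - k/L, produces the minimum in the
          theorem.\<close>
        have e3: "a - a * (k / L) \<le> 1 - min 1 (k / L)"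
        proof (cases "k / L \<le> 1")
          case True
          hence "a * (1 - k / L) \<le> 1 * (1 - k / L)" using a by (intro mult_right_mono) auto
          thus ?thesis using True by (simp add: algebra_simps)
        next
          case False
          hence "a * 1 \<le> a * (k / L)" using a by (intro mult_left_mono) auto
          thus ?thesis using False by simp
        qed
        have "(1 / 2 + 2 * \<epsilon>1 - real (i - 1) * \<delta>) * k = k / 2 + 2 * (k * \<epsilon>1) - real (i - 1) * \<delta> * k"
          by (simp add: algebra_simps)
        thus "real (min i J) / real J + (1 / 2 + 2 * \<epsilon>1 - real (i - 1) * \<delta>) * k \<le> E"
          using e1 e2 e3 k\<epsilon>1 J\<epsilon> unfolding E_def by linarith
      qed (use x cB in auto)
      finally show "real (card (?D \<inter> Ba i)) * M i \<le> cB * (8 * C1) powr k * x powr E" .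
    qed
    also have "\<dots> = C * x powr E" by (simp add: C_def algebra_simps)
    finally show ?thesis .
  qed
  thus ?thesis using C unfolding E_def L_def by blast
qed

theorem theorem1p1:
  fixes \<epsilon> k :: real and l :: nat
  assumes "\<epsilon> > 0" and "k \<ge> 0" and "l \<ge> 1"
  shows "\<exists>C>0. \<forall>x\<ge>2.
    finite (quadratic_fields_upto x) \<and>
    (\<forall>K\<in>quadratic_fields_upto x. finite (class_group_torsion K l)) \<and>
    (\<Sum>K\<in>quadratic_fields_upto x. real (card (class_group_torsion K l)) powr k)
      \<le> C * x powr (k / 2 + 1 - min 1 (k / (real l + 2)) + \<epsilon>)"
proof -
  define E where "E = k / 2 + 1 - min 1 (k / (real l + 2)) + \<epsilon>"
  \<comment> \<open>A nonnegative exponent makes \<open>x powr E\<close> at least 1, so that the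
    finite sum \<open>S0\<close> can cover all x below \<open>x0\<close>.\<close>
  have E: "E \<ge> 0" using assms unfolding E_def by (smt (verit) divide_nonneg_nonneg min.cobounded1)
  let ?t = "\<lambda>d. real (card (class_group_torsion (quad_set d) l)) powr k"
  obtain C x0 where C: "C > 0" "\<And>x. x \<ge> x0 \<Longrightarrow> (\<Sum>d\<in>discs_upto x. ?t d) \<le> C * x powr E"
    using torsion_moment_large[OF assms] unfolding E_def by blast
  define S0 where "S0 = (\<Sum>d\<in>discs_upto x0. ?t d)"
  have S0: "S0 \<ge> 0" unfolding S0_def by (intro sum_nonneg) simp
  show ?thesis
  proof (intro exI[of _ "C + S0"] conjI allI impI ballI)
    show "C + S0 > 0" using C(1) S0 by simp
    fix x :: real assume x: "x \<ge> 2"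
    note sub = quadratic_fields_upto_subset[of x]
    show "finite (quadratic_fields_upto x)" using finite_subset[OF sub] finite_discs_upto by blast
    show "finite (class_group_torsion L l)" if L: "L \<in> quadratic_fields_upto x" for L
    proof -
      obtain d where d: "squarefree d" "d \<noteq> 1" "L = quad_set d" using sub L by (auto simp: discs_upto_def)
      interpret quad d by unfold_locales (use d in auto)
      show ?thesis using torsion_card_le_codes(1)[OF assms(3)] d(3) by simp
    qed
    have "(\<Sum>K\<in>quadratic_fields_upto x. real (card (class_group_torsion K l)) powr k)
        \<le> (\<Sum>K\<in>quad_set ` discs_upto x. real (card (class_group_torsion K l)) powr k)"
      using sub finite_discs_upto by (intro sum_mono2) auto
    \<comment> \<open>A field occurring for several \<open>d\<close> would only be counted more
      often on the right.\<close>
    also have "\<dots> \<le> (\<Sum>d\<in>discs_upto x. ?t d)"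
      using sum_image_le[of "discs_upto x" "\<lambda>K. real (card (class_group_torsion K l)) powr k" quad_set] finite_discs_upto
      by (simp add: o_def)
    also have "\<dots> \<le> (C + S0) * x powr E"
    proof (cases "x \<ge> x0")
      case True
      have "C * x powr E \<le> (C + S0) * x powr E" using S0 by (intro mult_right_mono) auto
      thus ?thesis using C(2)[OF True] by linarith
    next
      case False
      hence "discs_upto x \<subseteq> discs_upto x0" by (auto simp: discs_upto_def)
      hence "(\<Sum>d\<in>discs_upto x. ?t d) \<le> S0" unfolding S0_def using finite_discs_upto by (intro sum_mono2) auto
      also have "S0 * 1 \<le> (C + S0) * x powr E"
        using C(1) S0 x E by (intro mult_mono ge_one_powr_ge_zero) auto
      finally show ?thesis by simp
    qed
    finally show "(\<Sum>K\<in>quadratic_fields_upto x. real (card (class_group_torsion K l)) powr k)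
      \<le> (C + S0) * x powr (k / 2 + 1 - min 1 (k / (real l + 2)) + \<epsilon>)" unfolding E_def .
  qed
qed

end
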